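(* Let $F=\langle x,y\rangle$ be a free group of rank $2$. Let $\mathcal{K}$ be $Nil$, $Sol$, $Fin$, $Alt$ or $Sym$, and let $F\hookrightarrow\hat F_{\mathcal{K}}$ be, respectively, the pro-nilpotent completion, the pro-solvable completion, the pro-finite completion of $F$, the group $\mathcal{A}$, or the group $\mathcal{S}$. Then the following are equivalent. (1) All groups are $\mathcal{K}$-approximable. (2) $F$ has the congruence extension property (CEP) in $\hat F_{\mathcal{K}}$. (3) $F$ almost has CEP in $\hat F_{\mathcal{K}}$. (4) $\hat F_{\mathcal{K}}$ is SQ-universal.
   Context: $Nil$, $Sol$, $Fin$, $Alt$, $Sym$ are the classes of finite nilpotent, finite solvable, all finite, finite alternating (groups $A_m$), and finite symmetric (groups $S_m$) groups, respectively. The pro-nilpotent (pro-solvable, pro-finite) completion of $F$ is the inverse limit of all finite nilpotent (finite solvable, finite) quotients of $F$, with $F$ embedded canonically. $\mathcal{A}=\prod_{m\ge1}\prod_{\phi\in\mathrm{Hom}(F,A_m)}A_m$ is the unrestricted direct product having one factor $A_m$ for each homomorphism $\phi:F\to A_m$; $F$ is a subgroup of $\mathcal{A}$ via the injective homomorphism $w\mapsto(\phi(w))_\phi$. $\mathcal{S}$ and $F\hookrightarrow\mathcal{S}$ are defined in the same way with the symmetric groups $S_m$ in place of $A_m$. $\langle\langle N\rangle\rangle_G$ is the smallest normal subgroup of $G$ containing $N$ (as an abstract group). A subgroup $H<G$ has CEP in $G$ if every $N\triangleleft H$ satisfies $N=H\cap\langle\langle N\rangle\rangle_G$. A subgroup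 $H<G$ almost has CEP in $G$ if there is a finite set $\mathcal{F}$ of group elements with $1\notin\mathcal{F}$ such that every $N\triangleleft H$ with $N\cap\mathcal{F}=\emptyset$ satisfies $N=H\cap\langle\langle N\rangle\rangle_G$. A group $G$ is SQ-universal if every countable group injects into a quotient of $G$. For a group $H$, $X\subseteq H$ and $n\in\mathbb{N}$, put $C_n(X,H)=\{x_1^{g_1}\cdots x_n^{g_n} : x_i\in X\text{ or }x_i^{-1}\in X,\ g_i\in H\}$, where $x^g=g^{-1}xg$. A set $Y\subseteq H$ is $n$-separated from $X$ in $H$ if $Y\cap C_n(X,H)=\emptyset$. A group $G$ is $\mathcal{K}$-approximable if for every finite $\Phi\subset G$ and every $n\in\mathbb{N}$ there exist $H\in\mathcal{K}$ and a map $\phi:\Phi\to H$ such that $\phi(1)=1$ (when $1\in\Phi$) and $\phi(\Phi\setminus\{1\})$ is $n$-separated in $H$ from $\{\phi(g)\phi(h)(\phi(gh))^{-1} : g,h,gh\in\Phi\}$. *)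

theory Defs
  imports "HOL-Algebra.Sym_Groups" "HOL-Algebra.Product_Groups" "HOL-Library.Countable_Set"
begin

section \<open>Free groups\<close>

text \<open>A word is a list of letters \<open>(s, e)\<close>: the generator \<open>s\<close> if \<open>e\<close> holds and its inverse
  otherwise.\<close>

definition reduced_word :: "('a \<times> bool) list \<Rightarrow> bool" where
  "reduced_word w \<longleftrightarrow> (\<nexists>u v s e. w = u @ [(s, e), (s, \<not> e)] @ v)"

definition word_value :: "('a, 'b) monoid_scheme \<Rightarrow> ('a \<times> bool) list \<Rightarrow> 'a" where
  "word_value G w =
     foldr (\<lambda>(s, e) r. (if e then s else inv\<^bsub>G\<^esub> s) \<otimes>\<^bsub>G\<^esub> r) w \<one>\<^bsub>G\<^esub>"

definition free_group_on :: "('a, 'b) monoid_scheme \<Rightarrow> 'a set \<Rightarrow> bool" where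
  "free_group_on G S \<longleftrightarrow>
     group G \<and> S \<subseteq> carrier G \<and> generate G S = carrier G \<and>
     (\<forall>w. w \<noteq> [] \<and> fst ` set w \<subseteq> S \<and> reduced_word w \<longrightarrow> word_value G w \<noteq> \<one>\<^bsub>G\<^esub>)"


section \<open>Classes of finite groups\<close>

primrec lower_central :: "('a, 'b) monoid_scheme \<Rightarrow> nat \<Rightarrow> 'a set" where
  "lower_central G 0 = carrier G"
| "lower_central G (Suc n) =
     generate G {a \<otimes>\<^bsub>G\<^esub> b \<otimes>\<^bsub>G\<^esub> inv\<^bsub>G\<^esub> a \<otimes>\<^bsub>G\<^esub> inv\<^bsub>G\<^esub> b | a b. a \<in> lower_central G n \<and> b \<in> carrier G}"

definition fin_nilpotent :: "('a, 'b) monoid_scheme \<Rightarrow> bool" where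
  "fin_nilpotent G \<longleftrightarrow>
     group G \<and> finite (carrier G) \<and> (\<exists>n. lower_central G n = {\<one>\<^bsub>G\<^esub>})"

definition fin_solvable :: "('a, 'b) monoid_scheme \<Rightarrow> bool" where
  "fin_solvable G \<longleftrightarrow> group G \<and> finite (carrier G) \<and> solvable G"

definition fin_group :: "('a, 'b) monoid_scheme \<Rightarrow> bool" where
  "fin_group G \<longleftrightarrow> group G \<and> finite (carrier G)"

definition fin_alternating :: "('a, 'b) monoid_scheme \<Rightarrow> bool" where
  "fin_alternating G \<longleftrightarrow> group G \<and> (\<exists>m\<ge>1. G \<cong> alt_group m)"

definition fin_symmetric :: "('a, 'b) monoid_scheme \<Rightarrow> bool" where
  "fin_symmetric G \<longleftrightarrow> group G \<and> (\<exists>m\<ge>1. G \<cong> sym_group m)"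


section \<open>The completions\<close>

definition class_kernels :: "('a set monoid \<Rightarrow> bool) \<Rightarrow> ('a, 'b) monoid_scheme \<Rightarrow> 'a set set" where
  "class_kernels K F = {N. N \<lhd> F \<and> K (F Mod N)}"

text \<open>For normal subgroups \<open>N \<subseteq> M\<close> the canonical map from \<open>F Mod N\<close> to \<open>F Mod M\<close> sends a
  coset \<open>c\<close> to the coset \<open>M <#> c\<close>.\<close>

definition pro_completion ::
    "('a set monoid \<Rightarrow> bool) \<Rightarrow> ('a, 'b) monoid_scheme \<Rightarrow> ('a set \<Rightarrow> 'a set) monoid" where
  "pro_completion K F =
     (product_group (class_kernels K F) (\<lambda>N. F Mod N))
       \<lparr>carrier := {s \<in> carrier (product_group (class_kernels K F) (\<lambda>N. F Mod N)).
          \<forall>N \<in> class_kernels K F. \<forall>M \<in> class_kernels K F. N \<subseteq> M \<longrightarrow> s M = M <#>\<^bsub>F\<^esub> s N}\<rparr>"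

definition pro_embedding ::
    "('a set monoid \<Rightarrow> bool) \<Rightarrow> ('a, 'b) monoid_scheme \<Rightarrow> 'a \<Rightarrow> 'a set \<Rightarrow> 'a set" where
  "pro_embedding K F w = (\<lambda>N \<in> class_kernels K F. N #>\<^bsub>F\<^esub> w)"

text \<open>Elements of \<^const>\<open>hom\<close> are arbitrary outside the carrier. The restriction to extensional
  functions makes each homomorphism occur as exactly one index.\<close>

definition hom_index ::
    "('a, 'b) monoid_scheme \<Rightarrow> (nat \<Rightarrow> ('c, 'd) monoid_scheme) \<Rightarrow> (nat \<times> ('a \<Rightarrow> 'c)) set" where
  "hom_index F A = (SIGMA m:{1..}. hom F (A m) \<inter> extensional (carrier F))"

definition hom_product ::
    "('a, 'b) monoid_scheme \<Rightarrow> (nat \<Rightarrow> ('c, 'd) monoid_scheme) \<Rightarrow>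
     (nat \<times> ('a \<Rightarrow> 'c) \<Rightarrow> 'c) monoid" where
  "hom_product F A = product_group (hom_index F A) (\<lambda>(m, \<phi>). A m)"

definition hom_embedding ::
    "('a, 'b) monoid_scheme \<Rightarrow> (nat \<Rightarrow> ('c, 'd) monoid_scheme) \<Rightarrow>
     'a \<Rightarrow> nat \<times> ('a \<Rightarrow> 'c) \<Rightarrow> 'c" where
  "hom_embedding F A w = (\<lambda>(m, \<phi>) \<in> hom_index F A. \<phi> w)"


section \<open>Congruence extension property and SQ-universality\<close>

definition normal_closure :: "('a, 'b) monoid_scheme \<Rightarrow> 'a set \<Rightarrow> 'a set" where
  "normal_closure G X = \<Inter>{M. M \<lhd> G \<and> X \<subseteq> M}"

definition has_CEP :: "('a, 'b) monoid_scheme \<Rightarrow> 'a set \<Rightarrow> bool" where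
  "has_CEP G H \<longleftrightarrow> (\<forall>N. N \<lhd> G\<lparr>carrier := H\<rparr> \<longrightarrow> N = H \<inter> normal_closure G N)"

definition almost_has_CEP :: "('a, 'b) monoid_scheme \<Rightarrow> 'a set \<Rightarrow> bool" where
  "almost_has_CEP G H \<longleftrightarrow>
     (\<exists>E. finite E \<and> E \<subseteq> carrier G \<and> \<one>\<^bsub>G\<^esub> \<notin> E \<and>
        (\<forall>N. N \<lhd> G\<lparr>carrier := H\<rparr> \<and> N \<inter> E = {} \<longrightarrow> N = H \<inter> normal_closure G N))"

text \<open>Quantification over all (countable) groups is quantification over the groups whose carrier
  lies in a type \<open>'g\<close>. Every countable group has a copy there when \<open>'g\<close> is infinite.\<close>

definition SQ_universal :: "'g itself \<Rightarrow> ('a, 'b) monoid_scheme \<Rightarrow> bool" where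
  "SQ_universal _ G \<longleftrightarrow>
     (\<forall>H :: 'g monoid. group H \<and> countable (carrier H) \<longrightarrow>
        (\<exists>N. N \<lhd> G \<and> mon H (G Mod N) \<noteq> {}))"


section \<open>Approximable groups\<close>

definition conj_products :: "nat \<Rightarrow> 'a set \<Rightarrow> ('a, 'b) monoid_scheme \<Rightarrow> 'a set" where
  "conj_products n X H =
     {foldr (\<lambda>(x, g) r. (inv\<^bsub>H\<^esub> g \<otimes>\<^bsub>H\<^esub> x \<otimes>\<^bsub>H\<^esub> g) \<otimes>\<^bsub>H\<^esub> r) ps \<one>\<^bsub>H\<^esub> | ps.
        length ps = n \<and>
        (\<forall>(x, g) \<in> set ps. x \<in> carrier H \<and> (x \<in> X \<or> inv\<^bsub>H\<^esub> x \<in> X) \<and> g \<in> carrier H)}"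

definition separated :: "nat \<Rightarrow> 'a set \<Rightarrow> 'a set \<Rightarrow> ('a, 'b) monoid_scheme \<Rightarrow> bool" where
  "separated n Y X H \<longleftrightarrow> Y \<inter> conj_products n X H = {}"

text \<open>The approximating group ranges over groups on \<^typ>\<open>nat\<close>. This loses nothing for the
  classes above, which consist of finite groups and are closed under isomorphism.\<close>

definition approximable :: "(nat monoid \<Rightarrow> bool) \<Rightarrow> ('g, 'b) monoid_scheme \<Rightarrow> bool" where
  "approximable K G \<longleftrightarrow>
     (\<forall>\<Phi> n. finite \<Phi> \<and> \<Phi> \<subseteq> carrier G \<longrightarrow>
        (\<exists>H \<phi>. K H \<and> \<phi> \<in> \<Phi> \<rightarrow> carrier H \<and>
           (\<one>\<^bsub>G\<^esub> \<in> \<Phi> \<longrightarrow> \<phi> \<one>\<^bsub>G\<^esub> = \<one>\<^bsub>H\<^esub>) \<and>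
           separated n (\<phi> ` (\<Phi> - {\<one>\<^bsub>G\<^esub>}))
             {\<phi> g \<otimes>\<^bsub>H\<^esub> \<phi> h \<otimes>\<^bsub>H\<^esub> inv\<^bsub>H\<^esub> (\<phi> (g \<otimes>\<^bsub>G\<^esub> h)) | g h. g \<in> \<Phi> \<and> h \<in> \<Phi> \<and> g \<otimes>\<^bsub>G\<^esub> h \<in> \<Phi>} H))"

text \<open>Approximability concerns finite subsets, so it holds for all groups as soon as it holds for all
  groups in one infinite type \<open>'g\<close>.\<close>

definition all_groups_approximable :: "'g itself \<Rightarrow> (nat monoid \<Rightarrow> bool) \<Rightarrow> bool" where
  "all_groups_approximable _ K \<longleftrightarrow> (\<forall>G :: 'g monoid. group G \<longrightarrow> approximable K G)"

definition all_equivalent :: "bool list \<Rightarrow> bool" where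
  "all_equivalent ps \<longleftrightarrow> (\<forall>p \<in> set ps. \<forall>q \<in> set ps. p \<longleftrightarrow> q)"

end

(* The implications (2) => (3) => (4) => (1) => (2), for any completion through whose homomorphisms
   to groups of the class all homomorphisms of F to such groups factor.

   (1) => (2): if w lies in F and in the normal closure of N, then w is a product of n conjugates of
   finitely many elements of N. An approximation of F/N on a large ball gives a homomorphism of F to
   a group in the class that nearly agrees with it; it maps N into products of conjugates of the
   defects, hence also w, so w is trivial in F/N.
   (3) => (4): a countable group H is realised by commutators of two permutations a, b, where the
   commutators can be taken in any normal subgroup of F that contains a power of x; residual
   finiteness supplies such a subgroup avoiding the exceptional set.
   (4) => (1): embed the given group into a countable one in which every nontrivial element of the
   finite set generates, by a product of two conjugates, the same noncentral element c. Lift to the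
   completion; it then suffices to find one coordinate detecting c. For pro-completions this is
   compactness. For unrestricted products the conjugates cannot be chosen uniformly, but those in the
   expression of the commutator of c with another element can. *)

theory Submission
  imports Defs "HOL-Algebra.Multiplicative_Group" "HOL-Analysis.Function_Topology"
begin

section \<open>Groups, words and free groups\<close>

text \<open>An approximation is one map into one group that separates all nontrivial elements of the
  finite set at once. Separate detecting maps could be merged into a direct product, but alternating
  and symmetric groups are not closed under products; hence the single element \<open>c\<close>
  shared by all elements. It has to be noncentral because for unrestricted products only its
  commutators can be lifted. The class enters only through homomorphisms: those from
  \<open>F\<close> extend to the completion, they detect every nontrivial element of
  \<open>F\<close>, and membership in products of \<open>k\<close> conjugates lifts back. The length
  \<open>k\<close> is the same for all homomorphisms; this makes the sets of solutions finite in the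
  pro-completions and gives one list of factors for all coordinates in the unrestricted products.
  One residual property serves all five classes: a nontrivial element of \<open>F\<close> survives
  in a finite unitriangular group, which is nilpotent, hence solvable, and embeds in an alternating
  and thus in a symmetric group.\<close>

lemma exists_iso_copy:
  fixes G :: "('a, 'b) monoid_scheme"
  assumes "group G" and "countable (carrier G)" and "infinite (UNIV :: 'g set)"
  shows "\<exists>(H :: 'g monoid) \<theta>. group H \<and> \<theta> \<in> iso G H"
proof -
  interpret G: group G by fact
  obtain e :: "nat \<Rightarrow> 'g" where e: "inj e"
    using infinite_countable_subset[OF assms(3)] by blast
  define f where "f = e \<circ> to_nat_on (carrier G)"
  have inj: "inj_on f (carrier G)"
    unfolding f_def by (intro comp_inj_on inj_on_to_nat_on assms inj_on_subset[OF e]) auto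
  define h where "h = inv_into (carrier G) f"
  have hf: "h (f a) = a" if "a \<in> carrier G" for a
    unfolding h_def using inv_into_f_f[OF inj that] .
  define H where "H = \<lparr>carrier = f ` carrier G, mult = (\<lambda>a b. f (h a \<otimes>\<^bsub>G\<^esub> h b)), one = f \<one>\<^bsub>G\<^esub>\<rparr>"
  have "group H"
  proof (rule groupI)
    show "\<exists>y\<in>carrier H. y \<otimes>\<^bsub>H\<^esub> x = \<one>\<^bsub>H\<^esub>" if x: "x \<in> carrier H" for x
    proof -
      obtain a where "a \<in> carrier G" "x = f a" using x by (auto simp: H_def)
      then show ?thesis by (intro bexI[of _ "f (inv\<^bsub>G\<^esub> a)"]) (auto simp: H_def hf)
    qed
  qed (auto simp: H_def hf G.m_assoc)
  moreover have "f \<in> iso G H"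
    using inj by (auto simp: iso_def hom_def bij_betw_def H_def hf)
  ultimately show ?thesis by blast
qed

section \<open>Values of words and the universal property of free groups\<close>

definition letter :: "('a, 'b) monoid_scheme \<Rightarrow> 'a \<times> bool \<Rightarrow> 'a" where
  "letter G l = (if snd l then fst l else inv\<^bsub>G\<^esub> (fst l))"

lemma word_value_Nil [simp]: "word_value G [] = \<one>\<^bsub>G\<^esub>"
  by (simp add: word_value_def)

lemma word_value_Cons [simp]: "word_value G (l # w) = letter G l \<otimes>\<^bsub>G\<^esub> word_value G w"
  by (cases l) (simp add: word_value_def letter_def)

context group
begin

lemma letter_closed: "fst l \<in> carrier G \<Longrightarrow> letter G l \<in> carrier G"
  by (simp add: letter_def)

lemma letter_cancel:
  assumes "s \<in> carrier G" "a \<in> carrier G"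
  shows "letter G (s, e) \<otimes> (letter G (s, \<not> e) \<otimes> a) = a"
  using assms by (cases e) (simp_all add: letter_def m_assoc[symmetric])

lemma word_value_closed:
  "fst ` set w \<subseteq> carrier G \<Longrightarrow> word_value G w \<in> carrier G"
  by (induction w) (auto simp: letter_closed)

lemma word_value_append:
  assumes "fst ` set u \<subseteq> carrier G" "fst ` set v \<subseteq> carrier G"
  shows "word_value G (u @ v) = word_value G u \<otimes> word_value G v"
  using assms by (induction u) (auto simp: letter_closed word_value_closed m_assoc)

lemma word_value_inverse:
  assumes "fst ` set w \<subseteq> carrier G"
  shows "word_value G (rev (map (apsnd Not) w)) = inv (word_value G w)"
  using assms
proof (induction w)
  case (Cons l w)
  have "word_value G (rev (map (apsnd Not) (l # w))) = inv (word_value G w) \<otimes> letter G (apsnd Not l)"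
    using Cons by (subst list.map, subst rev.simps, subst word_value_append)
      (auto simp: letter_def)
  also have "letter G (apsnd Not l) = inv (letter G l)"
    using Cons.prems by (auto simp: letter_def)
  finally show ?case
    using Cons.prems by (simp add: inv_mult_group letter_closed word_value_closed)
qed simp

lemma generate_eq_word_values:
  assumes "S \<subseteq> carrier G"
  shows "generate G S = word_value G ` {w. fst ` set w \<subseteq> S}"
proof
  show "generate G S \<subseteq> word_value G ` {w. fst ` set w \<subseteq> S}"
  proof
    fix a assume "a \<in> generate G S"
    then show "a \<in> word_value G ` {w. fst ` set w \<subseteq> S}"
    proof induction
      case one
      show ?case by (rule image_eqI[of _ _ "[]"]) auto
    next
      case (incl h)
      then show ?case using assms
        by (intro image_eqI[of _ _ "[(h, True)]"]) (auto simp: letter_def)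
    next
      case (inv h)
      then show ?case using assms
        by (intro image_eqI[of _ _ "[(h, False)]"]) (auto simp: letter_def)
    next
      case (eng h1 h2)
      then obtain u v where "fst ` set u \<subseteq> S" "fst ` set v \<subseteq> S"
        "h1 = word_value G u" "h2 = word_value G v" by auto
      then show ?case using assms
        by (intro image_eqI[of _ _ "u @ v"]) (auto simp: word_value_append)
    qed
  qed
  show "word_value G ` {w. fst ` set w \<subseteq> S} \<subseteq> generate G S"
  proof clarify
    fix w :: "('a \<times> bool) list" assume "fst ` set w \<subseteq> S"
    then show "word_value G w \<in> generate G S"
      by (induction w) (auto simp: letter_def intro: generate.intros)
  qed
qed

lemma countable_generate:
  assumes "S \<subseteq> carrier G" "countable S"
  shows "countable (generate G S)"
proof -
  have "{w. fst ` set w \<subseteq> S} = lists (S \<times> (UNIV :: bool set))"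
    by (auto simp: lists_eq_set)
  then show ?thesis
    unfolding generate_eq_word_values[OF assms(1)] using assms(2)
    by (simp add: countable_lists)
qed

end

lemma fst_set_map_apfst: "fst ` set (map (apfst f) w) = f ` fst ` set w"
  by (induction w) auto

text \<open>A word that is trivial in the free group cannot be reduced, so it contains a pair of
  adjacent inverse letters, which can be cancelled in any target group.\<close>

lemma free_group_word_trivial:
  assumes F: "free_group_on F S" and H: "group H" and f: "f \<in> S \<rightarrow> carrier H"
    and "fst ` set w \<subseteq> S" and "word_value F w = \<one>\<^bsub>F\<^esub>"
  shows "word_value H (map (apfst f) w) = \<one>\<^bsub>H\<^esub>"
  using assms(4,5)
proof (induction w rule: length_induct)
  case (1 w)
  interpret F: group F using F by (simp add: free_group_on_def)
  interpret H: group H by fact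
  have S: "S \<subseteq> carrier F" using F by (simp add: free_group_on_def)
  show ?case
  proof (cases "w = []")
    case False
    then have "\<not> reduced_word w" using F 1 by (auto simp: free_group_on_def)
    then obtain u v s e where w: "w = u @ [(s, e), (s, \<not> e)] @ v"
      by (auto simp: reduced_word_def)
    have sub: "fst ` set u \<subseteq> carrier F" "fst ` set v \<subseteq> carrier F" "s \<in> carrier F"
      using 1(2) S by (auto simp: w)
    have im: "fst ` set (map (apfst f) u) \<subseteq> carrier H" "fst ` set (map (apfst f) v) \<subseteq> carrier H"
      "f s \<in> carrier H"
      using 1(2) f unfolding w fst_set_map_apfst by auto
    have cF: "word_value F ([(s, e), (s, \<not> e)] @ v) = word_value F v"
      using sub F.letter_cancel[of s _ e] by (simp add: F.word_value_closed)
    have cH: "word_value H ([(f s, e), (f s, \<not> e)] @ map (apfst f) v) = word_value H (map (apfst f) v)"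
      using im H.word_value_closed[OF im(2)] H.letter_cancel[of "f s" _ e] by simp
    have "word_value F w = word_value F u \<otimes>\<^bsub>F\<^esub> word_value F ([(s, e), (s, \<not> e)] @ v)"
      unfolding w using sub by (intro F.word_value_append) auto
    then have "word_value F (u @ v) = \<one>\<^bsub>F\<^esub>"
      using 1(3) sub unfolding cF by (simp add: F.word_value_append)
    then have "word_value H (map (apfst f) (u @ v)) = \<one>\<^bsub>H\<^esub>"
      using 1(1)[rule_format, of "u @ v"] 1(2) by (simp add: w)
    moreover have "word_value H (map (apfst f) w) =
        word_value H (map (apfst f) u) \<otimes>\<^bsub>H\<^esub> word_value H ([(f s, e), (f s, \<not> e)] @ map (apfst f) v)"
      unfolding w map_append list.map apfst_conv using im
      by (intro H.word_value_append) auto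
    ultimately show ?thesis using im unfolding cH by (simp add: H.word_value_append)
  qed simp
qed

text \<open>Freeness is given as nontriviality of reduced words, so the universal property has to be
  derived. Each element gets a chosen word, whose value in \<open>H\<close> is independent of the
  choice: \<open>u\<close> followed by the inverse of \<open>v\<close> is trivial in
  \<open>F\<close>, hence in \<open>H\<close>.\<close>

lemma free_group_hom_exists:
  assumes F: "free_group_on F S" and H: "group H" and f: "f \<in> S \<rightarrow> carrier H"
  shows "\<exists>h\<in>hom F H. \<forall>s\<in>S. h s = f s"
proof -
  interpret F: group F using F by (simp add: free_group_on_def)
  interpret H: group H by fact
  have S: "S \<subseteq> carrier F" and gen: "generate F S = carrier F"
    using F by (auto simp: free_group_on_def)
  have ex: "\<exists>w. fst ` set w \<subseteq> S \<and> a = word_value F w" if "a \<in> carrier F" for a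
    using that F.generate_eq_word_values[OF S] gen by auto
  define W where "W a = (SOME w. fst ` set w \<subseteq> S \<and> a = word_value F w)" for a
  have W: "fst ` set (W a) \<subseteq> S" "word_value F (W a) = a" if "a \<in> carrier F" for a
    using someI_ex[OF ex[OF that]] by (auto simp: W_def)
  define val where "val w = word_value H (map (apfst f) w)" for w
  have im: "fst ` set (map (apfst f) w) \<subseteq> carrier H" if "fst ` set w \<subseteq> S" for w
    using that f unfolding fst_set_map_apfst by auto
  have val_closed: "val w \<in> carrier H" if "fst ` set w \<subseteq> S" for w
    unfolding val_def using im[OF that] by (rule H.word_value_closed)
  have val_append: "val (u @ v) = val u \<otimes>\<^bsub>H\<^esub> val v" if "fst ` set u \<subseteq> S" "fst ` set v \<subseteq> S" for u v
    unfolding val_def map_append using that by (intro H.word_value_append im)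
  have val_eq: "val u = val v"
    if uv: "fst ` set u \<subseteq> S" "fst ` set v \<subseteq> S" "word_value F u = word_value F v" for u v
  proof -
    let ?v = "rev (map (apsnd Not) v)"
    have v': "fst ` set ?v \<subseteq> S" using uv by force
    have "word_value F (u @ ?v) = \<one>\<^bsub>F\<^esub>"
      using F.word_value_append[OF subset_trans[OF uv(1) S] subset_trans[OF v' S]]
        F.word_value_inverse[OF subset_trans[OF uv(2) S]]
        F.word_value_closed[OF subset_trans[OF uv(2) S]] uv(3) by simp
    then have "val (u @ ?v) = \<one>\<^bsub>H\<^esub>"
      unfolding val_def using uv v' by (intro free_group_word_trivial[OF F H f]) auto
    moreover have "val ?v = inv\<^bsub>H\<^esub> val v"
    proof -
      have "map (apfst f) ?v = rev (map (apsnd Not) (map (apfst f) v))"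
        by (simp add: rev_map comp_def apfst_def apsnd_def map_prod_def split_beta)
      then show ?thesis
        unfolding val_def using H.word_value_inverse[OF im[OF uv(2)]] by metis
    qed
    ultimately have "val u \<otimes>\<^bsub>H\<^esub> inv\<^bsub>H\<^esub> val v = \<one>\<^bsub>H\<^esub>"
      using val_append[OF uv(1) v'] by simp
    then show ?thesis
      using H.inv_solve_right[of "\<one>\<^bsub>H\<^esub>" "val u" "val v"] val_closed uv by simp
  qed
  define h where "h a = val (W a)" for a
  have "h \<in> hom F H"
  proof (rule homI)
    fix a b assume ab: "a \<in> carrier F" "b \<in> carrier F"
    have "val (W (a \<otimes>\<^bsub>F\<^esub> b)) = val (W a @ W b)"
      using ab W S F.word_value_append[of "W a" "W b"]
      by (intro val_eq) (simp_all add: subset_trans[OF W(1) S] image_Un)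
    then show "h (a \<otimes>\<^bsub>F\<^esub> b) = h a \<otimes>\<^bsub>H\<^esub> h b"
      using ab W by (simp add: h_def val_append)
  qed (simp add: h_def val_closed W)
  moreover have "h s = f s" if "s \<in> S" for s
  proof -
    have "val (W s) = val [(s, True)]"
      using that W S by (intro val_eq) (auto simp: letter_def)
    moreover have "f s \<in> carrier H" using that f by auto
    ultimately show ?thesis by (simp add: h_def val_def letter_def)
  qed
  ultimately show ?thesis by blast
qed

text \<open>A shortest word for \<open>a\<close> is reduced, since a cancelling pair could be
  deleted.\<close>

lemma free_group_reduced_word:
  assumes F: "free_group_on F S" and "a \<in> carrier F"
  shows "\<exists>w. fst ` set w \<subseteq> S \<and> reduced_word w \<and> word_value F w = a"
proof -
  interpret F: group F using F by (simp add: free_group_on_def)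
  have S: "S \<subseteq> carrier F" and gen: "generate F S = carrier F"
    using F by (auto simp: free_group_on_def)
  let ?P = "\<lambda>w. fst ` set w \<subseteq> S \<and> word_value F w = a"
  obtain w0 where "?P w0" using assms(2) F.generate_eq_word_values[OF S] gen by auto
  from ex_has_least_nat[of ?P, OF this]
  obtain w where w: "?P w" and min: "\<And>u. ?P u \<Longrightarrow> length w \<le> length u" by blast
  have "reduced_word w"
    unfolding reduced_word_def
  proof clarify
    fix u v s e assume eq: "w = u @ [(s, e), (s, \<not> e)] @ v"
    have sub: "fst ` set u \<subseteq> carrier F" "fst ` set v \<subseteq> carrier F" "s \<in> carrier F"
      using w S by (auto simp: eq)
    have c: "word_value F ([(s, e), (s, \<not> e)] @ v) = word_value F v"
      using sub F.letter_cancel[of s _ e] by (simp add: F.word_value_closed)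
    have "word_value F w = word_value F u \<otimes>\<^bsub>F\<^esub> word_value F ([(s, e), (s, \<not> e)] @ v)"
      unfolding eq using sub by (intro F.word_value_append) auto
    then have "?P (u @ v)"
      using w sub unfolding c by (auto simp: F.word_value_append eq)
    then show False using min[of "u @ v"] by (simp add: eq)
  qed
  then show ?thesis using w by blast
qed

section \<open>Products of conjugates and normal closures\<close>

lemma conj_products_0 [simp]: "conj_products 0 X H = {\<one>\<^bsub>H\<^esub>}"
  by (auto simp: conj_products_def)

lemma conj_products_Suc:
  "conj_products (Suc n) X H =
     {(inv\<^bsub>H\<^esub> g \<otimes>\<^bsub>H\<^esub> x \<otimes>\<^bsub>H\<^esub> g) \<otimes>\<^bsub>H\<^esub> r | x g r.
        x \<in> carrier H \<and> (x \<in> X \<or> inv\<^bsub>H\<^esub> x \<in> X) \<and> g \<in> carrier H \<and> r \<in> conj_products n X H}"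
    (is "?L = ?R")
proof
  show "?L \<subseteq> ?R"
  proof
    fix c assume "c \<in> ?L"
    then obtain ps where ps: "length ps = Suc n"
      "\<forall>(x, g) \<in> set ps. x \<in> carrier H \<and> (x \<in> X \<or> inv\<^bsub>H\<^esub> x \<in> X) \<and> g \<in> carrier H"
      "c = foldr (\<lambda>(x, g) r. (inv\<^bsub>H\<^esub> g \<otimes>\<^bsub>H\<^esub> x \<otimes>\<^bsub>H\<^esub> g) \<otimes>\<^bsub>H\<^esub> r) ps \<one>\<^bsub>H\<^esub>"
      by (auto simp: conj_products_def)
    then obtain x g qs where "ps = (x, g) # qs" by (cases ps) auto
    with ps show "c \<in> ?R"
      by (auto simp: conj_products_def)
  qed
  show "?R \<subseteq> ?L"
  proof
    fix c assume "c \<in> ?R"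
    then obtain x g qs where x: "x \<in> carrier H" "x \<in> X \<or> inv\<^bsub>H\<^esub> x \<in> X" "g \<in> carrier H"
      and qs: "length qs = n"
      "\<forall>(x, g) \<in> set qs. x \<in> carrier H \<and> (x \<in> X \<or> inv\<^bsub>H\<^esub> x \<in> X) \<and> g \<in> carrier H"
      and c: "c = (inv\<^bsub>H\<^esub> g \<otimes>\<^bsub>H\<^esub> x \<otimes>\<^bsub>H\<^esub> g) \<otimes>\<^bsub>H\<^esub>
        foldr (\<lambda>(x, g) r. (inv\<^bsub>H\<^esub> g \<otimes>\<^bsub>H\<^esub> x \<otimes>\<^bsub>H\<^esub> g) \<otimes>\<^bsub>H\<^esub> r) qs \<one>\<^bsub>H\<^esub>"
      by (auto simp: conj_products_def)
    show "c \<in> ?L"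
      unfolding conj_products_def mem_Collect_eq
      by (rule exI[of _ "(x, g) # qs"]) (use x qs c in auto)
  qed
qed

lemma conj_products_SucI:
  assumes "x \<in> carrier H" "x \<in> X \<or> inv\<^bsub>H\<^esub> x \<in> X" "g \<in> carrier H" "r \<in> conj_products n X H"
  shows "(inv\<^bsub>H\<^esub> g \<otimes>\<^bsub>H\<^esub> x \<otimes>\<^bsub>H\<^esub> g) \<otimes>\<^bsub>H\<^esub> r \<in> conj_products (Suc n) X H"
  unfolding conj_products_Suc using assms by blast

lemma conj_products_SucE:
  assumes "c \<in> conj_products (Suc n) X H"
  obtains x g r where "c = (inv\<^bsub>H\<^esub> g \<otimes>\<^bsub>H\<^esub> x \<otimes>\<^bsub>H\<^esub> g) \<otimes>\<^bsub>H\<^esub> r" "x \<in> carrier H"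
    "x \<in> X \<or> inv\<^bsub>H\<^esub> x \<in> X" "g \<in> carrier H" "r \<in> conj_products n X H"
  using assms unfolding conj_products_Suc by blast

lemma conj_products_mono_set: "X \<subseteq> Y \<Longrightarrow> conj_products n X H \<subseteq> conj_products n Y H"
  by (induction n) (auto intro!: conj_products_SucI elim!: conj_products_SucE)

text \<open>An approximation sees only a finite part of a group, so membership in a normal closure
  is first reduced to finitely many relators.\<close>

lemma conj_products_finite_support:
  "c \<in> conj_products n X H \<Longrightarrow> \<exists>R. finite R \<and> R \<subseteq> X \<and> c \<in> conj_products n R H"
proof (induction n arbitrary: c)
  case 0
  then show ?case by (intro exI[of _ "{}"]) auto
next
  case (Suc n)
  then obtain x g r where c: "c = (inv\<^bsub>H\<^esub> g \<otimes>\<^bsub>H\<^esub> x \<otimes>\<^bsub>H\<^esub> g) \<otimes>\<^bsub>H\<^esub> r" "x \<in> carrier H"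
    "x \<in> X \<or> inv\<^bsub>H\<^esub> x \<in> X" "g \<in> carrier H" "r \<in> conj_products n X H"
    by (blast elim: conj_products_SucE)
  from Suc.IH[OF c(5)] obtain R where R: "finite R" "R \<subseteq> X" "r \<in> conj_products n R H" by blast
  \<comment> \<open>\<open>x\<close> may have entered only through its inverse, so whichever of the
    two lies in \<open>X\<close> is added.\<close>
  let ?R = "R \<union> ({x, inv\<^bsub>H\<^esub> x} \<inter> X)"
  have "r \<in> conj_products n ?R H" using R(3) conj_products_mono_set[of R ?R n H] by blast
  then have "c \<in> conj_products (Suc n) ?R H"
    unfolding c(1) using c by (intro conj_products_SucI) auto
  then show ?case using R by (intro exI[of _ ?R]) auto
qed

context group
begin

lemma conj_products_closed: "c \<in> conj_products n X G \<Longrightarrow> c \<in> carrier G"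
  by (induction n arbitrary: c) (auto simp: conj_products_Suc)

lemma conj_products_mult:
  "a \<in> conj_products m X G \<Longrightarrow> b \<in> conj_products n X G \<Longrightarrow> a \<otimes> b \<in> conj_products (m + n) X G"
proof (induction m arbitrary: a)
  case (Suc m)
  then obtain x g r where *: "a = (inv g \<otimes> x \<otimes> g) \<otimes> r" "x \<in> carrier G"
    "x \<in> X \<or> inv x \<in> X" "g \<in> carrier G" "r \<in> conj_products m X G"
    by (blast elim: conj_products_SucE)
  then have "a \<otimes> b = (inv g \<otimes> x \<otimes> g) \<otimes> (r \<otimes> b)"
    using conj_products_closed Suc.prems by (simp add: m_assoc)
  then show ?case
    using * Suc by (simp add: conj_products_SucI)
qed (simp add: conj_products_closed)

lemma conj_products_conjI:
  assumes "x \<in> carrier G" "x \<in> X \<or> inv x \<in> X" "g \<in> carrier G"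
  shows "inv g \<otimes> x \<otimes> g \<in> conj_products 1 X G"
proof -
  have "inv g \<otimes> x \<otimes> g = (inv g \<otimes> x \<otimes> g) \<otimes> \<one>" using assms by simp
  then show ?thesis
    using conj_products_SucI[of x G X g \<one> 0] assms by simp
qed

lemma conj_products_incl:
  assumes "x \<in> carrier G" "x \<in> X \<or> inv x \<in> X"
  shows "x \<in> conj_products 1 X G"
  using conj_products_conjI[OF assms one_closed] assms by simp

lemma conj_products_conj:
  "c \<in> conj_products n X G \<Longrightarrow> h \<in> carrier G \<Longrightarrow> inv h \<otimes> c \<otimes> h \<in> conj_products n X G"
proof (induction n arbitrary: c)
  case (Suc n)
  then obtain x g r where *: "c = (inv g \<otimes> x \<otimes> g) \<otimes> r" "x \<in> carrier G"
    "x \<in> X \<or> inv x \<in> X" "g \<in> carrier G" "r \<in> conj_products n X G"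
    by (blast elim: conj_products_SucE)
  have r: "r \<in> carrier G" using * conj_products_closed by blast
  have cancel: "h \<otimes> (inv h \<otimes> a) = a" if "a \<in> carrier G" for a
    using that Suc.prems by (simp add: m_assoc[symmetric])
  have "inv h \<otimes> c \<otimes> h = (inv (g \<otimes> h) \<otimes> x \<otimes> (g \<otimes> h)) \<otimes> (inv h \<otimes> r \<otimes> h)"
    using * r Suc.prems by (simp add: m_assoc inv_mult_group cancel)
  then show ?case
    using * Suc by (simp add: conj_products_SucI)
qed simp

lemma conj_products_conj':
  assumes "c \<in> conj_products n X G" "h \<in> carrier G"
  shows "h \<otimes> c \<otimes> inv h \<in> conj_products n X G"
  using conj_products_conj[OF assms(1), of "inv h"] assms(2) by simp

lemma conj_products_inv: "c \<in> conj_products n X G \<Longrightarrow> inv c \<in> conj_products n X G"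
proof (induction n arbitrary: c)
  case (Suc n)
  then obtain x g r where *: "c = (inv g \<otimes> x \<otimes> g) \<otimes> r" "x \<in> carrier G"
    "x \<in> X \<or> inv x \<in> X" "g \<in> carrier G" "r \<in> conj_products n X G"
    by (blast elim: conj_products_SucE)
  have "inv c = inv r \<otimes> (inv g \<otimes> inv x \<otimes> g)"
    using * conj_products_closed by (simp add: inv_mult_group m_assoc)
  also have "\<dots> \<in> conj_products (n + 1) X G"
    using * Suc by (intro conj_products_mult conj_products_conjI) auto
  finally show ?case by simp
qed simp

text \<open>Products have exactly \<open>n\<close> factors, and a trivial element of
  \<open>X\<close> serves as padding. Among defects it is supplied by the pair
  \<open>(\<one>, \<one>)\<close>.\<close>

lemma conj_products_mono:
  assumes "\<one> \<in> X" "m \<le> n"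
  shows "conj_products m X G \<subseteq> conj_products n X G"
proof
  fix c assume c: "c \<in> conj_products m X G"
  have "\<one> \<in> conj_products k X G" for k
  proof (induction k)
    case (Suc k)
    have "\<one> \<otimes> \<one> \<in> conj_products (1 + k) X G"
      using Suc assms by (intro conj_products_mult conj_products_incl) auto
    then show ?case by simp
  qed simp
  then have "c \<otimes> \<one> \<in> conj_products (m + (n - m)) X G"
    using c by (intro conj_products_mult)
  then show "c \<in> conj_products n X G"
    using assms(2) conj_products_closed[OF c] by simp
qed

lemma conj_products_subst:
  assumes "X' \<subseteq> conj_products k X G" "c \<in> conj_products n X' G"
  shows "c \<in> conj_products (n * k) X G"
  using assms(2)
proof (induction n arbitrary: c)
  case (Suc n)
  then obtain x g r where *: "c = (inv g \<otimes> x \<otimes> g) \<otimes> r" "x \<in> carrier G"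
    "x \<in> X' \<or> inv x \<in> X'" "g \<in> carrier G" "r \<in> conj_products n X' G"
    by (blast elim: conj_products_SucE)
  have "x \<in> conj_products k X G"
    using * assms(1) conj_products_inv[of "inv x" k X] by auto
  then have "c \<in> conj_products (k + n * k) X G"
    unfolding *(1) using * Suc by (intro conj_products_mult conj_products_conj)
  then show ?case by simp
qed simp

lemma conj_products_subset_normal:
  assumes "M \<lhd> G" "X \<subseteq> M"
  shows "conj_products n X G \<subseteq> M"
proof
  interpret M: normal M G by fact
  fix c assume "c \<in> conj_products n X G"
  then show "c \<in> M"
  proof (induction n arbitrary: c)
    case (Suc n)
    then obtain x g r where *: "c = (inv g \<otimes> x \<otimes> g) \<otimes> r" "x \<in> carrier G"
      "x \<in> X \<or> inv x \<in> X" "g \<in> carrier G" "r \<in> conj_products n X G"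
      by (blast elim: conj_products_SucE)
    have "x \<in> M" using * assms(2) M.m_inv_closed[of "inv x"] by auto
    then show ?case
      using * Suc M.inv_op_closed1 by simp
  qed simp
qed

lemma normal_closure_subset: "M \<lhd> G \<Longrightarrow> X \<subseteq> M \<Longrightarrow> normal_closure G X \<subseteq> M"
  by (auto simp: normal_closure_def)

lemma subset_normal_closure: "X \<subseteq> normal_closure G X"
  by (auto simp: normal_closure_def)

lemma normal_closure_normal:
  assumes "X \<subseteq> carrier G"
  shows "normal_closure G X \<lhd> G"
proof (rule normal_invI)
  have ne: "carrier G \<in> {M. M \<lhd> G \<and> X \<subseteq> M}" using assms normal_self by auto
  show "subgroup (normal_closure G X) G"
    unfolding normal_closure_def using ne by (intro subgroups_Inter) (auto intro: normal_imp_subgroup)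
  fix x h assume *: "x \<in> carrier G" "h \<in> normal_closure G X"
  show "x \<otimes> h \<otimes> inv x \<in> normal_closure G X"
    unfolding normal_closure_def
  proof clarify
    fix M assume M: "M \<lhd> G" "X \<subseteq> M"
    then have "h \<in> M" using * by (auto simp: normal_closure_def)
    then show "x \<otimes> h \<otimes> inv x \<in> M"
      using normal.inv_op_closed2[OF M(1)] * by blast
  qed
qed

lemma conj_products_subset_normal_closure:
  assumes "X \<subseteq> carrier G"
  shows "conj_products n X G \<subseteq> normal_closure G X"
  using conj_products_subset_normal normal_closure_normal[OF assms] subset_normal_closure by blast

text \<open>The union over all lengths is already a normal subgroup containing
  \<open>X\<close>.\<close>

lemma normal_closure_conj_products:
  assumes "X \<subseteq> carrier G" "c \<in> normal_closure G X"
  shows "\<exists>n. c \<in> conj_products n X G"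
proof -
  let ?M = "\<Union>n. conj_products n X G"
  have "?M \<lhd> G"
  proof (rule normal_invI)
    show "subgroup ?M G"
    proof (rule subgroupI)
      show "?M \<noteq> {}" using conj_products_0[of X G] by blast
      show "?M \<subseteq> carrier G" by (auto intro: conj_products_closed)
      show "inv a \<in> ?M" if "a \<in> ?M" for a
        using that by (auto intro: conj_products_inv)
      show "a \<otimes> b \<in> ?M" if "a \<in> ?M" "b \<in> ?M" for a b
        using that by (auto intro: conj_products_mult)
    qed
  qed (auto intro: conj_products_conj')
  moreover have "X \<subseteq> ?M"
  proof
    fix x assume "x \<in> X"
    then have "x \<in> conj_products 1 X G" using assms(1) by (intro conj_products_incl) auto
    then show "x \<in> ?M" by blast
  qed
  ultimately show ?thesis
    using normal_closure_subset assms(2) by blast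
qed

end

lemma hom_conj_products:
  assumes "group G" "group H" "h \<in> hom G H" "c \<in> conj_products n X G"
  shows "h c \<in> conj_products n (h ` X) H"
proof -
  interpret group_hom G H h
    using assms by (simp add: group_hom_def group_hom_axioms_def)
  show ?thesis
    using assms(4)
  proof (induction n arbitrary: c)
    case (Suc n)
    then obtain x g r where *: "c = (inv\<^bsub>G\<^esub> g \<otimes>\<^bsub>G\<^esub> x \<otimes>\<^bsub>G\<^esub> g) \<otimes>\<^bsub>G\<^esub> r" "x \<in> carrier G"
      "x \<in> X \<or> inv\<^bsub>G\<^esub> x \<in> X" "g \<in> carrier G" "r \<in> conj_products n X G"
      by (blast elim: conj_products_SucE)
    have "h x \<in> h ` X \<or> inv\<^bsub>H\<^esub> (h x) \<in> h ` X"
      using * by (metis hom_inv image_eqI)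
    moreover have "h c = (inv\<^bsub>H\<^esub> (h g) \<otimes>\<^bsub>H\<^esub> h x \<otimes>\<^bsub>H\<^esub> h g) \<otimes>\<^bsub>H\<^esub> h r"
      using * G.conj_products_closed by simp
    ultimately show ?case
      using * Suc.IH by (simp add: conj_products_SucI)
  qed simp
qed

section \<open>Approximability and the congruence extension property\<close>

definition approx_defects ::
    "('g, 'b) monoid_scheme \<Rightarrow> ('h, 'c) monoid_scheme \<Rightarrow> 'g set \<Rightarrow> ('g \<Rightarrow> 'h) \<Rightarrow> 'h set" where
  "approx_defects G H \<Phi> \<phi> =
     {\<phi> g \<otimes>\<^bsub>H\<^esub> \<phi> h \<otimes>\<^bsub>H\<^esub> inv\<^bsub>H\<^esub> (\<phi> (g \<otimes>\<^bsub>G\<^esub> h)) | g h. g \<in> \<Phi> \<and> h \<in> \<Phi> \<and> g \<otimes>\<^bsub>G\<^esub> h \<in> \<Phi>}"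

text \<open>Each letter costs two defects: one for multiplying its image with that of the remaining
  word, and one because \<open>\<phi>\<close>, unlike \<open>\<psi>\<close>, need not respect
  inverses. By \<open>ball\<close> all partial products stay where \<open>\<phi>\<close> is
  controlled.\<close>

lemma almost_hom_word_value:
  assumes F: "group F" and G: "group G" and H: "group H" and S: "S \<subseteq> carrier F"
    and tau: "\<tau> \<in> hom F G" and psi: "\<psi> \<in> hom F H"
    and phi: "\<phi> \<in> \<Phi> \<rightarrow> carrier H" "\<phi> \<one>\<^bsub>G\<^esub> = \<one>\<^bsub>H\<^esub>" and eq: "\<And>s. s \<in> S \<Longrightarrow> \<psi> s = \<phi> (\<tau> s)"
    and ball: "\<And>u. fst ` set u \<subseteq> S \<Longrightarrow> length u \<le> L \<Longrightarrow> \<tau> (word_value F u) \<in> \<Phi>"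
    and u: "fst ` set u \<subseteq> S" "length u \<le> L"
  shows "\<exists>c \<in> conj_products (2 * length u) (approx_defects G H \<Phi> \<phi>) H.
           \<psi> (word_value F u) = c \<otimes>\<^bsub>H\<^esub> \<phi> (\<tau> (word_value F u))"
  using u
proof (induction u)
  case Nil
  interpret group_hom F G \<tau> using F G tau by (simp add: group_hom_def group_hom_axioms_def)
  interpret p: group_hom F H \<psi> using F H psi by (simp add: group_hom_def group_hom_axioms_def)
  show ?case using phi(2) by simp
next
  case (Cons l u)
  interpret t: group_hom F G \<tau> using F G tau by (simp add: group_hom_def group_hom_axioms_def)
  interpret p: group_hom F H \<psi> using F H psi by (simp add: group_hom_def group_hom_axioms_def)
  let ?X = "approx_defects G H \<Phi> \<phi>"
  let ?d = "\<lambda>g h. \<phi> g \<otimes>\<^bsub>H\<^esub> \<phi> h \<otimes>\<^bsub>H\<^esub> inv\<^bsub>H\<^esub> (\<phi> (g \<otimes>\<^bsub>G\<^esub> h))"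
  have defect: "?d g h \<in> ?X" if "g \<in> \<Phi>" "h \<in> \<Phi>" "g \<otimes>\<^bsub>G\<^esub> h \<in> \<Phi>" for g h
    using that by (auto simp: approx_defects_def)
  have S': "S \<subseteq> carrier F" by fact
  have sub: "fst ` set u \<subseteq> carrier F" "fst l \<in> carrier F" using Cons.prems S by auto
  have uF: "word_value F u \<in> carrier F" and lF: "letter F l \<in> carrier F"
    using sub t.G.word_value_closed t.G.letter_closed by auto
  have one: "\<one>\<^bsub>G\<^esub> \<in> \<Phi>" using ball[of "[]"] by simp
  have s: "\<tau> (fst l) \<in> \<Phi>" "\<tau> (inv\<^bsub>F\<^esub> (fst l)) \<in> \<Phi>"
    using ball[of "[(fst l, True)]"] ball[of "[(fst l, False)]"] Cons.prems sub
    by (auto simp: letter_def)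
  have lPhi: "\<tau> (letter F l) \<in> \<Phi>" using s by (simp add: letter_def)
  have uPhi: "\<tau> (word_value F u) \<in> \<Phi>" using Cons.prems by (intro ball) auto
  have luPhi: "\<tau> (letter F l) \<otimes>\<^bsub>G\<^esub> \<tau> (word_value F u) \<in> \<Phi>"
    using ball[of "l # u"] Cons.prems uF lF by simp
  note cl = s[THEN funcset_mem[OF phi(1)]] lPhi[THEN funcset_mem[OF phi(1)]]
    uPhi[THEN funcset_mem[OF phi(1)]] luPhi[THEN funcset_mem[OF phi(1)]]
  have letter: "\<exists>c \<in> conj_products 1 ?X H. \<psi> (letter F l) = c \<otimes>\<^bsub>H\<^esub> \<phi> (\<tau> (letter F l))"
  proof (cases "snd l")
    case True
    \<comment> \<open>On a positive letter \<open>\<psi>\<close> and \<open>\<phi>\<close> agree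
      exactly; the trivial defect fills the slot, so that both signs use one factor.\<close>
    have "\<one>\<^bsub>H\<^esub> \<in> ?X" using defect[of "\<one>\<^bsub>G\<^esub>" "\<one>\<^bsub>G\<^esub>"] one phi(2) by simp
    then have "\<one>\<^bsub>H\<^esub> \<in> conj_products 1 ?X H" by (intro p.H.conj_products_incl) auto
    then show ?thesis
      using True eq[of "fst l"] Cons.prems cl by (intro bexI[of _ "\<one>\<^bsub>H\<^esub>"]) (auto simp: letter_def)
  next
    case False
    let ?a = "\<phi> (\<tau> (fst l))" and ?b = "\<phi> (\<tau> (inv\<^bsub>F\<^esub> (fst l)))"
    have inv: "\<tau> (fst l) \<otimes>\<^bsub>G\<^esub> \<tau> (inv\<^bsub>F\<^esub> (fst l)) = \<one>\<^bsub>G\<^esub>" using sub by simp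
    have "?d (\<tau> (fst l)) (\<tau> (inv\<^bsub>F\<^esub> (fst l))) \<in> ?X" using s one inv by (intro defect) auto
    then have ab: "?a \<otimes>\<^bsub>H\<^esub> ?b \<in> ?X" unfolding inv phi(2) using cl by simp
    \<comment> \<open>The product of \<open>?a\<close> and \<open>?b\<close> is a defect, so the
      inverse of \<open>?a\<close> differs from \<open>?b\<close> by a conjugate of an inverted
      defect.\<close>
    define c where "c = inv\<^bsub>H\<^esub> ?a \<otimes>\<^bsub>H\<^esub> inv\<^bsub>H\<^esub> (?a \<otimes>\<^bsub>H\<^esub> ?b) \<otimes>\<^bsub>H\<^esub> ?a"
    have "c \<in> conj_products 1 ?X H"
      unfolding c_def using cl ab by (intro p.H.conj_products_conjI) auto
    moreover have "\<psi> (letter F l) = c \<otimes>\<^bsub>H\<^esub> ?b"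
      using False eq[of "fst l"] Cons.prems cl sub
      by (simp add: letter_def c_def p.H.inv_mult_group p.H.m_assoc)
    ultimately show ?thesis using False by (auto simp: letter_def)
  qed
  then obtain c where c: "c \<in> conj_products 1 ?X H" "\<psi> (letter F l) = c \<otimes>\<^bsub>H\<^esub> \<phi> (\<tau> (letter F l))"
    by blast
  obtain d where d: "d \<in> conj_products (2 * length u) ?X H"
    "\<psi> (word_value F u) = d \<otimes>\<^bsub>H\<^esub> \<phi> (\<tau> (word_value F u))"
    using Cons by auto
  let ?l = "\<phi> (\<tau> (letter F l))" and ?u = "\<phi> (\<tau> (word_value F u))"
    and ?lu = "\<phi> (\<tau> (letter F l) \<otimes>\<^bsub>G\<^esub> \<tau> (word_value F u))"
  note cd = p.H.conj_products_closed[OF c(1)] p.H.conj_products_closed[OF d(1)]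
  \<comment> \<open>\<open>d\<close> moves to the left past \<open>?l\<close> as a conjugate; the
    last factor replaces the product of \<open>?l\<close> and \<open>?u\<close> by
    \<open>?lu\<close>.\<close>
  define e where "e = c \<otimes>\<^bsub>H\<^esub> (?l \<otimes>\<^bsub>H\<^esub> d \<otimes>\<^bsub>H\<^esub> inv\<^bsub>H\<^esub> ?l) \<otimes>\<^bsub>H\<^esub> (?l \<otimes>\<^bsub>H\<^esub> ?u \<otimes>\<^bsub>H\<^esub> inv\<^bsub>H\<^esub> ?lu)"
  have "?l \<otimes>\<^bsub>H\<^esub> ?u \<otimes>\<^bsub>H\<^esub> inv\<^bsub>H\<^esub> ?lu \<in> conj_products 1 ?X H"
    using defect[OF lPhi uPhi luPhi] cl by (intro p.H.conj_products_incl) auto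
  then have "e \<in> conj_products (1 + 2 * length u + 1) ?X H"
    unfolding e_def using c d cl by (intro p.H.conj_products_mult p.H.conj_products_conj')
  moreover have "\<psi> (word_value F (l # u)) = e \<otimes>\<^bsub>H\<^esub> \<phi> (\<tau> (word_value F (l # u)))"
  proof -
    have canc: "inv\<^bsub>H\<^esub> b \<otimes>\<^bsub>H\<^esub> (b \<otimes>\<^bsub>H\<^esub> a) = a" if "a \<in> carrier H" "b \<in> carrier H" for a b
      using that by (simp add: p.H.m_assoc[symmetric])
    have "e \<otimes>\<^bsub>H\<^esub> ?lu = (c \<otimes>\<^bsub>H\<^esub> ?l) \<otimes>\<^bsub>H\<^esub> (d \<otimes>\<^bsub>H\<^esub> ?u)"
      unfolding e_def using cd cl by (simp add: p.H.m_assoc canc)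
    then show ?thesis using c(2) d(2) uF lF by simp
  qed
  ultimately show ?case by auto
qed

text \<open>The interface shared by all five cases. \<open>lifting\<close> carries a bound
  \<open>k\<close>, uniform over all images in the class, back to \<open>Fh\<close>; its conclusion
  is about commutators so that unrestricted products can satisfy it as well as
  pro-completions.\<close>

locale free_completion =
  fixes F :: "('f, 'b) monoid_scheme" and x y :: 'f
    and Fh :: "('h, 'c) monoid_scheme" and \<iota> :: "'f \<Rightarrow> 'h" and K :: "nat monoid \<Rightarrow> bool"
  assumes free: "free_group_on F {x, y}" and xy: "x \<noteq> y"
    and group_Fh: "group Fh" and hom_\<iota>: "\<iota> \<in> hom F Fh"
    and K_group: "K H \<Longrightarrow> group H" and K_finite: "K H \<Longrightarrow> finite (carrier H)"
    and extend: "\<lbrakk>K H; \<psi> \<in> hom F H\<rbrakk> \<Longrightarrow> \<exists>\<sigma>\<in>hom Fh H. \<forall>a\<in>carrier F. \<sigma> (\<iota> a) = \<psi> a"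
    and residual: "\<lbrakk>w \<in> carrier F; w \<noteq> \<one>\<^bsub>F\<^esub>\<rbrakk> \<Longrightarrow> \<exists>H. K H \<and> (\<exists>\<psi>\<in>hom F H. \<psi> w \<noteq> \<one>\<^bsub>H\<^esub>)"
    and lifting: "\<lbrakk>a \<in> carrier Fh; u \<in> carrier Fh; X \<subseteq> carrier Fh; finite X;
        \<And>H \<sigma>. \<lbrakk>K H; \<sigma> \<in> hom Fh H\<rbrakk> \<Longrightarrow> \<sigma> a \<in> conj_products k (\<sigma> ` X) H\<rbrakk>
      \<Longrightarrow> a \<otimes>\<^bsub>Fh\<^esub> u \<otimes>\<^bsub>Fh\<^esub> inv\<^bsub>Fh\<^esub> a \<otimes>\<^bsub>Fh\<^esub> inv\<^bsub>Fh\<^esub> u \<in> normal_closure Fh X"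
begin

sublocale group_F: group F using free by (simp add: free_group_on_def)
sublocale Fh: group Fh by (rule group_Fh)
sublocale \<iota>: group_hom F Fh \<iota> by unfold_locales (rule hom_\<iota>)

lemma gen_subset: "{x, y} \<subseteq> carrier F" and gen: "generate F {x, y} = carrier F"
  using free by (auto simp: free_group_on_def)

lemma countable_F: "countable (carrier F)"
  using group_F.countable_generate[OF gen_subset] by (simp add: gen)

text \<open>The number of defects spent is bounded in terms of \<open>n\<close> and the lengths of
  words for \<open>w\<close> and \<open>R\<close>, which are all fixed before the approximation is
  chosen; this is why separation can be applied with that bound.\<close>

lemma mem_of_conj_products_image:
  assumes inf: "infinite (UNIV :: 'g set)" and all: "all_groups_approximable TYPE('g) K"
    and N: "N \<lhd> F" and w: "w \<in> carrier F" and R: "R \<subseteq> N" "finite R"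
    and c: "\<iota> w \<in> conj_products n (\<iota> ` R) Fh"
  shows "w \<in> N"
proof (rule ccontr)
  assume "w \<notin> N"
  interpret N: normal N F by fact
  have "countable (carrier (F Mod N))" unfolding carrier_FactGroup using countable_F by blast
  then obtain G :: "'g monoid" and \<theta> where G: "group G" and th: "\<theta> \<in> iso (F Mod N) G"
    using exists_iso_copy[OF N.factorgroup_is_group _ inf] by blast
  define \<tau> where "\<tau> a = \<theta> (N #>\<^bsub>F\<^esub> a)" for a
  have tau: "\<tau> \<in> hom F G"
    using hom_compose[OF N.r_coset_hom_Mod, of \<theta> G] th by (simp add: iso_def comp_def \<tau>_def[abs_def])
  interpret \<tau>: group_hom F G \<tau> using tau G by (simp add: group_hom_def group_hom_axioms_def)
  have tau_one: "\<tau> a = \<one>\<^bsub>G\<^esub> \<longleftrightarrow> a \<in> N" if a: "a \<in> carrier F" for a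
  proof -
    have "\<tau> a = \<tau> \<one>\<^bsub>F\<^esub> \<longleftrightarrow> N #>\<^bsub>F\<^esub> a = N #>\<^bsub>F\<^esub> \<one>\<^bsub>F\<^esub>"
      unfolding \<tau>_def using th a inj_on_eq_iff[of \<theta> "carrier (F Mod N)"]
      by (simp add: iso_def bij_betw_def carrier_FactGroup)
    also have "\<dots> \<longleftrightarrow> a \<in> N"
      using a N.subset N.subgroup_axioms group_F.coset_join1[of N a] group_F.coset_join2[of a N] by auto
    finally show ?thesis by simp
  qed
  have "\<exists>u. fst ` set u \<subseteq> {x, y} \<and> word_value F u = a" if "a \<in> carrier F" for a
    using free_group_reduced_word[OF free that] by blast
  then obtain W where W: "\<And>a. a \<in> carrier F \<Longrightarrow> fst ` set (W a) \<subseteq> {x, y} \<and> word_value F (W a) = a"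
    by metis
  obtain L where L: "\<And>a. a \<in> insert w R \<Longrightarrow> length (W a) \<le> L"
    using finite_imageI[of "insert w R" "length \<circ> W"] R(2) Max_ge[of "(length \<circ> W) ` insert w R"]
    by (metis comp_apply finite_insert image_eqI)
  \<comment> \<open>Radius \<open>Suc L\<close> instead of \<open>L\<close>, so that the generators
    are in the ball even if all chosen words are empty.\<close>
  define B :: "('f \<times> bool) list set" where "B = {u. fst ` set u \<subseteq> {x, y} \<and> length u \<le> Suc L}"
  have "B \<subseteq> {u. set u \<subseteq> {x, y} \<times> UNIV \<and> length u \<le> Suc L}" by (force simp: B_def)
  moreover have "finite {u. set u \<subseteq> {x, y} \<times> (UNIV :: bool set) \<and> length u \<le> Suc L}"
    by (rule finite_lists_length_le) simp
  ultimately have "finite B" by (rule finite_subset)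
  define \<Phi> where "\<Phi> = (\<tau> \<circ> word_value F) ` B"
  have ball: "\<tau> (word_value F u) \<in> \<Phi>" if "fst ` set u \<subseteq> {x, y}" "length u \<le> Suc L" for u
    using that by (auto simp: \<Phi>_def B_def)
  have fin: "finite \<Phi>" using \<open>finite B\<close> by (simp add: \<Phi>_def)
  have sub: "\<Phi> \<subseteq> carrier G"
  proof
    fix g assume "g \<in> \<Phi>"
    then obtain u where "g = \<tau> (word_value F u)" "fst ` set u \<subseteq> {x, y}"
      unfolding \<Phi>_def B_def by auto
    then show "g \<in> carrier G"
      using group_F.word_value_closed[OF subset_trans[OF _ gen_subset]] by simp
  qed
  have one: "\<one>\<^bsub>G\<^esub> \<in> \<Phi>" using ball[of "[]"] by simp
  \<comment> \<open>\<open>\<phi> (\<tau> w)\<close> is the inverse of an error term with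
    \<open>2 * Suc L\<close> defects, times \<open>\<psi> w\<close>, a product of \<open>n\<close>
    conjugates of elements that each cost \<open>2 * Suc L\<close> defects.\<close>
  let ?n = "2 * Suc L + n * (2 * Suc L)"
  obtain H \<phi> where H: "K H" and phi: "\<phi> \<in> \<Phi> \<rightarrow> carrier H" "\<phi> \<one>\<^bsub>G\<^esub> = \<one>\<^bsub>H\<^esub>"
    and sep: "separated ?n (\<phi> ` (\<Phi> - {\<one>\<^bsub>G\<^esub>})) (approx_defects G H \<Phi> \<phi>) H"
    using all[unfolded all_groups_approximable_def approximable_def, rule_format, OF G conjI[OF fin sub],
        of ?n] one unfolding approx_defects_def[symmetric] by blast
  let ?X = "approx_defects G H \<Phi> \<phi>"
  interpret H: group H using K_group[OF H] .
  have gens: "s \<in> \<Phi>" if "s \<in> \<tau> ` {x, y}" for s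
    using that ball[of "[(x, True)]"] ball[of "[(y, True)]"] gen_subset by (auto simp: letter_def)
  have phis: "(\<lambda>s. \<phi> (\<tau> s)) \<in> {x, y} \<rightarrow> carrier H"
    using gens phi(1) by (auto simp: Pi_iff)
  obtain \<psi> where psi: "\<psi> \<in> hom F H" "\<And>s. s \<in> {x, y} \<Longrightarrow> \<psi> s = \<phi> (\<tau> s)"
    using free_group_hom_exists[OF free H.group_axioms phis] by blast
  obtain \<sigma> where sigma: "\<sigma> \<in> hom Fh H" "\<And>a. a \<in> carrier F \<Longrightarrow> \<sigma> (\<iota> a) = \<psi> a"
    using extend[OF H psi(1)] by blast
  have X1: "\<one>\<^bsub>H\<^esub> \<in> ?X"
    unfolding approx_defects_def mem_Collect_eq using one phi(2)
    by (intro exI[of _ "\<one>\<^bsub>G\<^esub>"]) simp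
  have near: "\<exists>d \<in> conj_products (2 * Suc L) ?X H. \<psi> a = d \<otimes>\<^bsub>H\<^esub> \<phi> (\<tau> a)"
    if a: "a \<in> insert w R" for a
  proof -
    have aF: "a \<in> carrier F" using a w R N.subset by auto
    have "\<exists>d \<in> conj_products (2 * length (W a)) ?X H.
        \<psi> (word_value F (W a)) = d \<otimes>\<^bsub>H\<^esub> \<phi> (\<tau> (word_value F (W a)))"
      using W[OF aF] L[OF a]
      by (intro almost_hom_word_value[OF group_F.group_axioms G H.group_axioms gen_subset tau psi(1)
            phi psi(2) ball]) auto
    then show ?thesis
      using W[OF aF] L[OF a] H.conj_products_mono[OF X1, of "2 * length (W a)" "2 * Suc L"] by auto
  qed
  have R': "\<psi> ` R \<subseteq> conj_products (2 * Suc L) ?X H"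
  proof clarify
    fix a assume a: "a \<in> R"
    then have "\<tau> a = \<one>\<^bsub>G\<^esub>" using tau_one R N.subset by auto
    moreover obtain d where "d \<in> conj_products (2 * Suc L) ?X H" "\<psi> a = d \<otimes>\<^bsub>H\<^esub> \<phi> (\<tau> a)"
      using near[of a] a by auto
    ultimately show "\<psi> a \<in> conj_products (2 * Suc L) ?X H"
      using phi(2) H.conj_products_closed by auto
  qed
  have "\<sigma> ` \<iota> ` R = \<psi> ` R"
    unfolding image_image using R N.subset by (intro image_cong) (auto simp: sigma(2))
  then have "\<psi> w \<in> conj_products n (\<psi> ` R) H"
    using hom_conj_products[OF group_Fh H.group_axioms sigma(1) c] w by (simp add: sigma(2))
  then have psiw: "\<psi> w \<in> conj_products (n * (2 * Suc L)) ?X H"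
    by (rule H.conj_products_subst[OF R'])
  obtain d where d: "d \<in> conj_products (2 * Suc L) ?X H" "\<psi> w = d \<otimes>\<^bsub>H\<^esub> \<phi> (\<tau> w)"
    using near[of w] by auto
  have wPhi: "\<tau> w \<in> \<Phi>" using ball[of "W w"] W[OF w] L[of w] by simp
  have phiw: "\<phi> (\<tau> w) = inv\<^bsub>H\<^esub> d \<otimes>\<^bsub>H\<^esub> \<psi> w"
    using d H.conj_products_closed[OF d(1)] funcset_mem[OF phi(1) wPhi]
    by (simp add: H.m_assoc[symmetric])
  have "inv\<^bsub>H\<^esub> d \<otimes>\<^bsub>H\<^esub> \<psi> w \<in> conj_products ?n ?X H"
    by (intro H.conj_products_mult H.conj_products_inv d psiw)
  then have "\<phi> (\<tau> w) \<in> conj_products ?n ?X H" by (simp only: phiw)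
  moreover have "\<tau> w \<noteq> \<one>\<^bsub>G\<^esub>" using tau_one[OF w] \<open>w \<notin> N\<close> by simp
  ultimately show False using sep wPhi unfolding separated_def by blast
qed

lemma normal_subgroup_imageD:
  assumes "N \<lhd> Fh\<lparr>carrier := \<iota> ` carrier F\<rparr>"
  shows "N \<subseteq> \<iota> ` carrier F" and "{a \<in> carrier F. \<iota> a \<in> N} \<lhd> F"
proof -
  interpret N: normal N "Fh\<lparr>carrier := \<iota> ` carrier F\<rparr>" by fact
  have sub: "subgroup (\<iota> ` carrier F) Fh" by (rule \<iota>.img_is_subgroup)
  show "N \<subseteq> \<iota> ` carrier F" using N.subset by simp
  have inv: "inv\<^bsub>Fh\<^esub> a \<in> N" if "a \<in> N" for a
  proof -
    have "a \<in> \<iota> ` carrier F" using N.subset that by auto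
    from Fh.m_inv_consistent[OF sub this] N.m_inv_closed[OF that] show ?thesis by argo
  qed
  show "{a \<in> carrier F. \<iota> a \<in> N} \<lhd> F"
  proof (rule group_F.normal_invI)
    show "subgroup {a \<in> carrier F. \<iota> a \<in> N} F"
      using subgroup.one_closed[OF N.subgroup_axioms] subgroup.m_closed[OF N.subgroup_axioms] inv
      by unfold_locales auto
    fix g a assume *: "g \<in> carrier F" "a \<in> {a \<in> carrier F. \<iota> a \<in> N}"
    then have "\<iota> g \<otimes>\<^bsub>Fh\<^esub> \<iota> a \<otimes>\<^bsub>Fh\<^esub> inv\<^bsub>Fh\<^esub> (\<iota> g) \<in> N"
      using N.inv_op_closed2[of "\<iota> g" "\<iota> a"] Fh.m_inv_consistent[OF sub, of "\<iota> g"] by simp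
    then show "g \<otimes>\<^bsub>F\<^esub> a \<otimes>\<^bsub>F\<^esub> inv\<^bsub>F\<^esub> g \<in> {a \<in> carrier F. \<iota> a \<in> N}" using * by simp
  qed
qed

theorem approximable_imp_CEP:
  assumes inf: "infinite (UNIV :: 'g set)" and all: "all_groups_approximable TYPE('g) K"
  shows "has_CEP Fh (\<iota> ` carrier F)"
  unfolding has_CEP_def
proof (intro allI impI equalityI subsetI)
  fix N v assume N: "N \<lhd> Fh\<lparr>carrier := \<iota> ` carrier F\<rparr>"
  note N' = normal_subgroup_imageD[OF N]
  show "v \<in> \<iota> ` carrier F \<inter> normal_closure Fh N" if "v \<in> N"
    using that N' Fh.subset_normal_closure by auto
  assume v: "v \<in> \<iota> ` carrier F \<inter> normal_closure Fh N"
  then obtain w where w: "w \<in> carrier F" "v = \<iota> w" by auto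
  have "N \<subseteq> carrier Fh" using N'(1) by auto
  moreover have "v \<in> normal_closure Fh N" using v by simp
  ultimately obtain n where n: "v \<in> conj_products n N Fh"
    using Fh.normal_closure_conj_products by blast
  from conj_products_finite_support[OF n]
  obtain R' where R': "finite R'" "R' \<subseteq> N" "v \<in> conj_products n R' Fh" by blast
  from finite_subset_image[OF R'(1) subset_trans[OF R'(2) N'(1)]]
  obtain R where R: "R \<subseteq> carrier F" "finite R" "R' = \<iota> ` R" by blast
  have "w \<in> {a \<in> carrier F. \<iota> a \<in> N}"
    by (rule mem_of_conj_products_image[OF inf all N'(2) w(1) _ R(2)])
      (use R R' w in auto)
  then show "v \<in> N" using w by simp
qed

end

lemma CEP_imp_almost_CEP: "has_CEP G H \<Longrightarrow> almost_has_CEP G H"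
  unfolding has_CEP_def almost_has_CEP_def by (intro exI[of _ "{}"]) auto

section \<open>Embedding countable groups with prescribed trivial words\<close>

definition bij_group :: "('a \<Rightarrow> 'a) monoid" where
  "bij_group = \<lparr>carrier = {f. bij f}, mult = (\<circ>), one = id\<rparr>"

lemma bij_group_simps [simp]:
  "f \<in> carrier bij_group \<longleftrightarrow> bij f" "f \<otimes>\<^bsub>bij_group\<^esub> g = f \<circ> g" "\<one>\<^bsub>bij_group\<^esub> = id"
  by (auto simp: bij_group_def)

lemma group_bij_group: "group (bij_group :: ('a \<Rightarrow> 'a) monoid)"
proof (rule groupI)
  show "\<exists>g\<in>carrier bij_group. g \<otimes>\<^bsub>bij_group\<^esub> f = \<one>\<^bsub>bij_group\<^esub>"
    if "f \<in> carrier bij_group" for f :: "'a \<Rightarrow> 'a"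
    using that by (intro bexI[of _ "inv' f"]) (auto simp: bij_imp_bij_inv bij_is_inj)
qed (auto simp: bij_comp comp_assoc)

lemma bij_of_mutual_inverses:
  assumes "f \<circ> g = id" "g \<circ> f = id" shows "bij f" "bij g"
  using assms by (auto intro: o_bij)

lemma bij_fibrewise:
  assumes "\<And>k. bij (f k)"
  shows "bij (\<lambda>(z, k). (f k z, k))"
  using assms by (auto simp: bij_def inj_def surj_def)

text \<open>Two permutations \<open>a\<close> and \<open>b\<close> of \<open>('g \<times> \<int>) \<times> \<int>\<close>: \<open>a\<close> shifts the last coordinate
  \<open>k\<close>, and \<open>b\<close> acts on the slice \<open>k = 0\<close> as the shift of the middle coordinate \<open>n\<close>, on the slice
  \<open>k = e (2 i + 1)\<close> as the \<open>i\<close>-th element of \<open>H\<close> on the half line \<open>n \<ge> 0\<close>, and trivially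
  elsewhere. Translating \<open>b\<close> by \<open>e (2 i + 1)\<close> makes it meet \<open>b\<close> only in the slice \<open>0\<close>, where the
  commutator is the \<open>i\<close>-th element of \<open>H\<close> acting at \<open>n = 0\<close>. The factor \<open>e\<close> makes the commutator
  trivial in every group in which \<open>a\<^sup>e = 1\<close>.\<close>

lemma countable_group_commutator_embedding:
  fixes H :: "('g, 'b) monoid_scheme" and e :: nat
  assumes "group H" "countable (carrier H)" "e > 0"
  shows "\<exists>(a :: ('g \<times> int) \<times> int \<Rightarrow> ('g \<times> int) \<times> int) b R k. bij a \<and> bij b \<and>
    R \<in> mon H bij_group \<and>
    (\<forall>h\<in>carrier H. e dvd k h \<and> (\<exists>p. bij p \<and> (a ^^ k h) \<circ> p = b \<circ> (a ^^ k h) \<and> p \<circ> b = R h \<circ> b \<circ> p))"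
proof -
  interpret H: group H by fact
  define C where "C = carrier H"
  obtain hh :: "nat \<Rightarrow> 'g" where hh: "range hh = C"
    using range_from_nat_into[of C] assms(2) unfolding C_def by blast
  \<comment> \<open>Acting on a half line makes \<open>D h\<close> and its conjugate by the shift
    \<open>S\<close> differ only at middle coordinate \<open>0\<close>, which yields the commutator
    \<open>R h\<close>.\<close>
  define D where "D h = (\<lambda>(a, n :: int). (if a \<in> C \<and> n \<ge> 0 then h \<otimes>\<^bsub>H\<^esub> a else a, n))" for h
  define S where "S = (\<lambda>(a :: 'g, n :: int). (a, n + 1))"
  \<comment> \<open>Odd multiples of \<open>e\<close>: the sum of two of them is an even multiple,
    hence never a third. This keeps \<open>b\<close> and its translate from interfering outside
    slice \<open>0\<close>.\<close>
  define K :: "nat \<Rightarrow> nat" where "K i = e * (2 * i + 1)" for i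
  have K_inj: "K i = K j \<longleftrightarrow> i = j" and K_pos: "K i > 0" for i j
    using assms(3) by (auto simp: K_def)
  have K_sum: "K i + K j \<noteq> K l" for i j l
  proof
    assume "K i + K j = K l"
    then have "e * (2 * (i + j + 1)) = e * (2 * l + 1)" by (simp add: K_def algebra_simps)
    then have "2 * (i + j + 1) = 2 * l + 1" using assms(3) by (metis mult_cancel1 not_gr_zero)
    then show False by presburger
  qed
  define p where "p k = (if k = 0 then S else if \<exists>i. k = int (K i) then D (hh (THE i. k = int (K i)))
    else id)" for k
  have p0: "p 0 = S" by (simp add: p_def)
  have pK: "p (int (K i)) = D (hh i)" for i
    using K_pos[of i] by (auto simp: p_def K_inj)
  have p_id: "p k = id" if "k \<noteq> 0" "\<And>i. k \<noteq> int (K i)" for k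
    using that by (simp add: p_def)
  have D_D: "D g \<circ> D h = D (g \<otimes>\<^bsub>H\<^esub> h)" if "g \<in> C" "h \<in> C" for g h
    using that by (auto simp: D_def C_def H.m_assoc fun_eq_iff)
  have D_one: "D \<one>\<^bsub>H\<^esub> = id" by (auto simp: D_def C_def fun_eq_iff)
  have D_bij: "bij (D h)" if "h \<in> C" for h
    using that by (intro bij_of_mutual_inverses(1)[of _ "D (inv\<^bsub>H\<^esub> h)"])
      (simp_all add: D_D C_def D_one)
  have S_bij: "bij S"
    by (rule bij_of_mutual_inverses(1)[of _ "\<lambda>(a, n). (a, n - 1)"]) (auto simp: S_def fun_eq_iff)
  have hhC: "hh i \<in> C" for i using hh by auto
  have p_bij: "bij (p k)" for k
    using p0 pK p_id D_bij[OF hhC] S_bij by (metis bij_id)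
  define a where "a = (\<lambda>(z :: 'g \<times> int, k :: int). (z, k + 1))"
  define b where "b = (\<lambda>(z, k). (p k z, k))"
  have a_pow: "(a ^^ m) (z, k) = (z, k + int m)" for m z k
    by (induction m) (auto simp: a_def)
  have a_bij: "bij a"
    by (rule bij_of_mutual_inverses(1)[of _ "\<lambda>(z, k). (z, k - 1)"]) (auto simp: a_def fun_eq_iff)
  have b_bij: "bij b" unfolding b_def by (rule bij_fibrewise[OF p_bij])
  define R where "R h = (\<lambda>((c, n :: int), k :: int). ((if c \<in> C \<and> n = 0 \<and> k = 0 then h \<otimes>\<^bsub>H\<^esub> c else c, n), k))" for h
  have R_R: "R g \<circ> R h = R (g \<otimes>\<^bsub>H\<^esub> h)" if "g \<in> C" "h \<in> C" for g h
    using that by (auto simp: R_def C_def H.m_assoc fun_eq_iff)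
  have R_one: "R \<one>\<^bsub>H\<^esub> = id" by (auto simp: R_def C_def fun_eq_iff)
  have R_bij: "bij (R h)" if "h \<in> C" for h
    using that by (intro bij_of_mutual_inverses(1)[of _ "R (inv\<^bsub>H\<^esub> h)"])
      (simp_all add: R_R C_def R_one)
  have R_eq: "g = h" if "g \<in> C" "h \<in> C" "R g = R h" for g h
    using fun_cong[OF that(3), of "((\<one>\<^bsub>H\<^esub>, 0), 0)"] that by (simp add: R_def C_def)
  have R_mon: "R \<in> mon H bij_group"
    using R_bij R_eq by (auto simp: mon_def hom_def inj_on_def C_def[symmetric] R_R)
  define k where "k h = K (SOME i. hh i = h)" for h
  have "e dvd k h \<and> (\<exists>q. bij q \<and> (a ^^ k h) \<circ> q = b \<circ> (a ^^ k h) \<and> q \<circ> b = R h \<circ> b \<circ> q)"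
    if h: "h \<in> C" for h
  proof -
    define i where "i = (SOME i. hh i = h)"
    have "\<exists>i. hh i = h" using h hh by blast
    then have hi: "hh i = h" unfolding i_def by (rule someI_ex)
    have kh: "k h = K i" by (simp add: k_def i_def)
    define q where "q = (\<lambda>(z, k). (p (k + int (K i)) z, k))"
    have "bij q" unfolding q_def by (rule bij_fibrewise[OF p_bij])
    moreover have "(a ^^ k h) \<circ> q = b \<circ> (a ^^ k h)"
      by (auto simp: fun_eq_iff a_pow q_def b_def kh)
    moreover have "(q \<circ> b) ((c, n), j) = (R h \<circ> b \<circ> q) ((c, n), j)" for c n j
    proof (cases "j = 0")
      case True
      then show ?thesis
        using h by (auto simp: q_def b_def p0 pK hi S_def D_def R_def C_def)
    next
      case False
      have R_id: "R h (z, j) = (z, j)" for z using False by (cases z) (simp add: R_def)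
      \<comment> \<open>One of the two permutations is the identity: if \<open>j\<close> is some
        \<open>K l\<close>, then \<open>j + K i\<close> is neither \<open>0\<close> nor of this
        form, and otherwise \<open>p j\<close> is trivial.\<close>
      have "p (j + int (K i)) \<circ> p j = p j \<circ> p (j + int (K i))"
      proof (cases "\<exists>l. j = int (K l)")
        case True
        then obtain l where l: "j = int (K l)" by blast
        have "p (j + int (K i)) = id"
        proof (rule p_id)
          show "j + int (K i) \<noteq> 0" using K_pos[of i] l by simp
          show "j + int (K i) \<noteq> int (K m)" for m
            using K_sum[of l i m] l by (metis of_nat_add of_nat_eq_iff)
        qed
        then show ?thesis by simp
      next
        case False
        then have "p j = id" using \<open>j \<noteq> 0\<close> by (intro p_id) auto
        then show ?thesis by simp
      qed
      then show ?thesis by (simp add: q_def b_def R_id fun_eq_iff)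
    qed
    ultimately show ?thesis by (auto simp: kh K_def fun_eq_iff)
  qed
  then show ?thesis using a_bij b_bij R_mon unfolding C_def by blast
qed

section \<open>From the almost congruence extension property to SQ-universality\<close>

lemma (in group) subgroup_nat_pow_closed:
  "subgroup M G \<Longrightarrow> a \<in> M \<Longrightarrow> a [^] (n :: nat) \<in> M"
  by (induction n) (auto intro: subgroup.one_closed subgroup.m_closed)

lemma (in normal) r_coset_eq_self_iff:
  assumes "a \<in> carrier G" shows "H #> a = H \<longleftrightarrow> a \<in> H"
  using assms coset_join1[of H a] coset_join2[of a H] subset subgroup_axioms by auto

lemma bij_group_nat_pow: "f [^]\<^bsub>bij_group\<^esub> (n :: nat) = f ^^ n"
proof -
  interpret group bij_group by (rule group_bij_group)
  show ?thesis by (induction n) (simp_all add: funpow_Suc_right del: funpow.simps(2))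
qed

section \<open>Normal subgroups avoiding a finite set, and embedding countable groups in
  quotients\<close>

context free_completion
begin

lemma inj_\<iota>: "inj_on \<iota> (carrier F)"
  unfolding \<iota>.inj_on_one_iff
proof (intro allI impI)
  fix w assume w: "w \<in> carrier F" "\<iota> w = \<one>\<^bsub>Fh\<^esub>"
  show "w = \<one>\<^bsub>F\<^esub>"
  proof (rule ccontr)
    assume "w \<noteq> \<one>\<^bsub>F\<^esub>"
    then obtain H \<psi> where H: "K H" and psi: "\<psi> \<in> hom F H" "\<psi> w \<noteq> \<one>\<^bsub>H\<^esub>"
      using residual w(1) by blast
    obtain \<sigma> where "\<sigma> \<in> hom Fh H" "\<sigma> (\<iota> w) = \<psi> w" using extend[OF H psi(1)] w(1) by blast
    then show False
      using hom_one[OF _ group_Fh K_group[OF H]] w(2) psi(2) by metis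
  qed
qed

text \<open>Each element to be avoided costs one kernel of a finite image; multiplying the exponent
  by the order of that image keeps the power of \<open>x\<close> inside the intersection.\<close>

lemma exists_normal_avoiding:
  assumes "finite W" "W \<subseteq> carrier F" "\<one>\<^bsub>F\<^esub> \<notin> W"
  shows "\<exists>M (e :: nat). M \<lhd> F \<and> M \<inter> W = {} \<and> e > 0 \<and> x [^]\<^bsub>F\<^esub> e \<in> M"
  using assms
proof (induction W)
  case empty
  then show ?case
    using group_F.normal_self gen_subset by (intro exI[of _ "carrier F"] exI[of _ "1 :: nat"]) auto
next
  case (insert w W)
  then obtain M and e :: nat where M: "M \<lhd> F" "M \<inter> W = {}" "e > 0" "x [^]\<^bsub>F\<^esub> e \<in> M" by auto
  obtain H \<psi> where H: "K H" and psi: "\<psi> \<in> hom F H" "\<psi> w \<noteq> \<one>\<^bsub>H\<^esub>"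
    using residual[of w] insert.prems by auto
  interpret H: group H using K_group[OF H] .
  interpret \<psi>: group_hom F H \<psi> by unfold_locales (rule psi(1))
  have xF: "x \<in> carrier F" using gen_subset by simp
  have "x [^]\<^bsub>F\<^esub> (e * order H) \<in> M"
    using group_F.subgroup_nat_pow_closed[OF normal_imp_subgroup[OF M(1)] M(4), of "order H"] xF
    by (simp add: group_F.nat_pow_pow)
  moreover have "x [^]\<^bsub>F\<^esub> (e * order H) \<in> kernel F H \<psi>"
    using xF H.pow_order_eq_1[of "\<psi> x [^]\<^bsub>H\<^esub> e"]
    by (simp add: kernel_def \<psi>.hom_nat_pow H.nat_pow_pow)
  moreover have "w \<notin> kernel F H \<psi>" using psi(2) by (simp add: kernel_def)
  moreover have "e * order H > 0" using M(3) H.order_gt_0_iff_finite K_finite[OF H] by simp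
  ultimately show ?case
    using group_F.normal_subgroup_intersect[OF M(1) \<psi>.normal_kernel] M(2)
    by (intro exI[of _ "M \<inter> kernel F H \<psi>"] exI[of _ "e * order H"]) auto
qed

text \<open>CEP is applied to the image of \<open>N0\<close>, the part of \<open>M\<close> killed by
  \<open>\<theta>\<close>: being inside \<open>M\<close> it avoids \<open>E\<close>. All
  \<open>w h\<close> lie in \<open>M\<close>, so relations between them modulo \<open>N0\<close> are
  exactly relations between the permutations \<open>R h\<close>, and CEP preserves this in the
  quotient of the completion.\<close>

theorem almost_CEP_imp_SQ_universal:
  assumes "almost_has_CEP Fh (\<iota> ` carrier F)"
  shows "SQ_universal TYPE('g) Fh"
  unfolding SQ_universal_def
proof (intro allI impI)
  fix H :: "'g monoid" assume "group H \<and> countable (carrier H)"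
  then have H: "group H" and countable: "countable (carrier H)" by auto
  interpret H: group H by fact
  obtain E where E: "finite E" "\<one>\<^bsub>Fh\<^esub> \<notin> E"
    and CEP: "\<forall>N. N \<lhd> Fh\<lparr>carrier := \<iota> ` carrier F\<rparr> \<and> N \<inter> E = {} \<longrightarrow>
      N = \<iota> ` carrier F \<inter> normal_closure Fh N"
    using assms unfolding almost_has_CEP_def by (elim exE conjE) (rule that)
  define W where "W = {w \<in> carrier F. \<iota> w \<in> E}"
  have "W = \<iota> -` E \<inter> carrier F" by (auto simp: W_def)
  then have "finite W" using finite_vimage_IntI[OF E(1) inj_\<iota>] by simp
  moreover have "\<one>\<^bsub>F\<^esub> \<notin> W" using E(2) by (simp add: W_def)
  ultimately obtain M and e :: nat where M: "M \<lhd> F" "M \<inter> W = {}" "e > 0" "x [^]\<^bsub>F\<^esub> e \<in> M"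
    using exists_normal_avoiding[of W] by (auto simp: W_def)
  interpret M: normal M F by fact
  let ?B = "bij_group :: (('g \<times> int) \<times> int \<Rightarrow> ('g \<times> int) \<times> int) monoid"
  interpret B: group ?B by (rule group_bij_group)
  from countable_group_commutator_embedding[OF H countable M(3)]
  obtain a b :: "('g \<times> int) \<times> int \<Rightarrow> ('g \<times> int) \<times> int" and R k
    where ab: "bij a" "bij b" and R: "R \<in> mon H ?B"
      and comm': "\<forall>h\<in>carrier H. e dvd k h \<and>
        (\<exists>p. bij p \<and> (a ^^ k h) \<circ> p = b \<circ> (a ^^ k h) \<and> p \<circ> b = R h \<circ> b \<circ> p)"
    by (elim exE conjE) (rule that)
  note comm = bspec[OF comm']
  have xyF: "x \<in> carrier F" "y \<in> carrier F" using gen_subset by auto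
  have "(\<lambda>s. if s = x then a else b) \<in> {x, y} \<rightarrow> carrier ?B" using ab by auto
  from free_group_hom_exists[OF free group_bij_group this] xy
  obtain \<theta> where th: "\<theta> \<in> hom F ?B" "\<theta> x = a" "\<theta> y = b" by auto
  interpret \<theta>: group_hom F ?B \<theta> by unfold_locales (rule th(1))
  define p where "p h = inv\<^bsub>F\<^esub> (x [^]\<^bsub>F\<^esub> k h) \<otimes>\<^bsub>F\<^esub> y \<otimes>\<^bsub>F\<^esub> x [^]\<^bsub>F\<^esub> k h" for h
  define w where "w h = p h \<otimes>\<^bsub>F\<^esub> y \<otimes>\<^bsub>F\<^esub> inv\<^bsub>F\<^esub> (p h) \<otimes>\<^bsub>F\<^esub> inv\<^bsub>F\<^esub> y" for h
  have pF: "p h \<in> carrier F" and wF: "w h \<in> carrier F" for h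
    using xyF by (auto simp: p_def w_def)
  \<comment> \<open>Modulo \<open>M\<close> the power of \<open>x\<close> in \<open>p h\<close> is
    trivial, since \<open>e\<close> divides \<open>k h\<close>. So \<open>p h\<close> becomes
    \<open>y\<close>, and its commutator with \<open>y\<close> vanishes.\<close>
  have wM: "w h \<in> M" if h: "h \<in> carrier H" for h
  proof -
    interpret q: group_hom F "F Mod M" "\<lambda>a. M #>\<^bsub>F\<^esub> a"
      using M.r_coset_hom_Mod M.factorgroup_is_group
      by (simp add: group_hom_def group_hom_axioms_def)
    obtain j where "k h = e * j" using comm[OF h] by (auto simp: dvd_def)
    then have "x [^]\<^bsub>F\<^esub> k h \<in> M"
      using group_F.subgroup_nat_pow_closed[OF M.subgroup_axioms M(4), of j] xyF
      by (simp add: group_F.nat_pow_pow)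
    then have one: "M #>\<^bsub>F\<^esub> (x [^]\<^bsub>F\<^esub> k h) = \<one>\<^bsub>F Mod M\<^esub>"
      using M.r_coset_eq_self_iff xyF by simp
    have p: "M #>\<^bsub>F\<^esub> p h = M #>\<^bsub>F\<^esub> y"
      unfolding p_def using xyF one q.hom_closed[of y] by (simp del: mult_FactGroup one_FactGroup)
    have "M #>\<^bsub>F\<^esub> w h = \<one>\<^bsub>F Mod M\<^esub>"
      unfolding w_def using xyF pF[of h] p q.hom_closed[of y]
      by (simp add: q.H.m_assoc del: mult_FactGroup one_FactGroup)
    then show ?thesis using M.r_coset_eq_self_iff wF by simp
  qed
  have theta_w: "\<theta> (w h) = R h" if h: "h \<in> carrier H" for h
  proof -
    obtain q where q: "bij q" "(a ^^ k h) \<circ> q = b \<circ> (a ^^ k h)" "q \<circ> b = R h \<circ> b \<circ> q"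
      using comm[OF h] by blast
    have Rh: "R h \<in> carrier ?B" using R h unfolding mon_def hom_def by blast
    let ?c = "a ^^ k h"
    have c: "\<theta> (x [^]\<^bsub>F\<^esub> k h) = ?c"
      using xyF th by (simp add: \<theta>.hom_nat_pow bij_group_nat_pow)
    have cB: "?c \<in> carrier ?B" using \<theta>.hom_closed[of "x [^]\<^bsub>F\<^esub> k h"] c xyF by simp
    have qB: "q \<in> carrier ?B" and abB: "a \<in> carrier ?B" "b \<in> carrier ?B" using q(1) ab by auto
    have "\<theta> (p h) = inv\<^bsub>?B\<^esub> ?c \<otimes>\<^bsub>?B\<^esub> b \<otimes>\<^bsub>?B\<^esub> ?c"
      unfolding p_def using xyF th c by (simp del: bij_group_simps)
    also have "\<dots> = inv\<^bsub>?B\<^esub> ?c \<otimes>\<^bsub>?B\<^esub> (?c \<otimes>\<^bsub>?B\<^esub> q)"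
      using q B.inv_closed[OF cB] cB ab by (subst B.m_assoc) auto
    also have "\<dots> = q" using cB qB by (simp add: B.m_assoc[symmetric] del: bij_group_simps)
    finally have ph: "\<theta> (p h) = q" .
    have qb: "q \<otimes>\<^bsub>?B\<^esub> b = R h \<otimes>\<^bsub>?B\<^esub> (b \<otimes>\<^bsub>?B\<^esub> q)" using q(3) by (simp add: comp_assoc)
    have "\<theta> (w h) = (q \<otimes>\<^bsub>?B\<^esub> b) \<otimes>\<^bsub>?B\<^esub> inv\<^bsub>?B\<^esub> (b \<otimes>\<^bsub>?B\<^esub> q)"
      unfolding w_def using xyF pF[of h] th ph qB abB
      by (simp add: B.inv_mult_group B.m_assoc del: bij_group_simps)
    also have "\<dots> = R h"
      unfolding qb using Rh qB abB by (simp add: B.m_assoc del: bij_group_simps)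
    finally show ?thesis .
  qed
  define N0 where "N0 = M \<inter> kernel F ?B \<theta>"
  have N0: "N0 \<lhd> F"
    unfolding N0_def by (intro group_F.normal_subgroup_intersect M(1) \<theta>.normal_kernel)
  then have N0F: "N0 \<subseteq> carrier F" by (simp add: normal_imp_subgroup subgroup.subset)
  let ?N = "\<iota> ` N0" and ?I = "Fh\<lparr>carrier := \<iota> ` carrier F\<rparr>"
  have "group_hom F ?I \<iota>"
    using Fh.subgroup_imp_group[OF \<iota>.img_is_subgroup] hom_\<iota>
    by (auto simp: group_hom_def group_hom_axioms_def hom_def)
  then have N: "?N \<lhd> ?I" by (intro normal.surj_hom_normal_subgroup[OF N0]) auto
  have "?N \<inter> E = {}" using M(2) N0F by (auto simp: N0_def W_def)
  with CEP N have eq: "?N = \<iota> ` carrier F \<inter> normal_closure Fh ?N" by simp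
  let ?C = "normal_closure Fh ?N"
  let ?Q = "Fh Mod ?C"
  have C: "?C \<lhd> Fh" using N0F by (intro Fh.normal_closure_normal) auto
  interpret C: normal ?C Fh by (rule C)
  interpret \<pi>: group_hom Fh "?Q" "\<lambda>a. ?C #>\<^bsub>Fh\<^esub> a"
    using C.r_coset_hom_Mod C.factorgroup_is_group by (simp add: group_hom_def group_hom_axioms_def)
  \<comment> \<open>This is where CEP is used: through \<open>eq\<close>, the normal closure meets
    the image of \<open>F\<close> only in the image of \<open>N0\<close>.\<close>
  have pi_one: "?C #>\<^bsub>Fh\<^esub> \<iota> a = \<one>\<^bsub>?Q\<^esub> \<longleftrightarrow> a \<in> N0" if a: "a \<in> carrier F" for a
  proof -
    have "?C #>\<^bsub>Fh\<^esub> \<iota> a = \<one>\<^bsub>?Q\<^esub> \<longleftrightarrow> \<iota> a \<in> ?C"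
      using C.r_coset_eq_self_iff a by simp
    also have "\<dots> \<longleftrightarrow> \<iota> a \<in> ?N" using eq a by blast
    also have "\<dots> \<longleftrightarrow> a \<in> N0" using inj_on_image_mem_iff[OF inj_\<iota> a N0F] .
    finally show ?thesis .
  qed
  have pi_eq: "?C #>\<^bsub>Fh\<^esub> \<iota> a = ?C #>\<^bsub>Fh\<^esub> \<iota> b \<longleftrightarrow> a \<otimes>\<^bsub>F\<^esub> inv\<^bsub>F\<^esub> b \<in> N0"
    if "a \<in> carrier F" "b \<in> carrier F" for a b
  proof -
    have "?C #>\<^bsub>Fh\<^esub> \<iota> (a \<otimes>\<^bsub>F\<^esub> inv\<^bsub>F\<^esub> b) =
      (?C #>\<^bsub>Fh\<^esub> \<iota> a) \<otimes>\<^bsub>?Q\<^esub> inv\<^bsub>?Q\<^esub> (?C #>\<^bsub>Fh\<^esub> \<iota> b)"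
      using that by (simp del: mult_FactGroup one_FactGroup)
    moreover have "?C #>\<^bsub>Fh\<^esub> \<iota> a \<in> carrier (?Q)" "?C #>\<^bsub>Fh\<^esub> \<iota> b \<in> carrier (?Q)"
      using that \<pi>.hom_closed by auto
    ultimately show ?thesis
      using that pi_one[of "a \<otimes>\<^bsub>F\<^esub> inv\<^bsub>F\<^esub> b"]
        \<pi>.H.inv_solve_right'[of "\<one>\<^bsub>?Q\<^esub>" "?C #>\<^bsub>Fh\<^esub> \<iota> a" "?C #>\<^bsub>Fh\<^esub> \<iota> b"]
      by (simp del: mult_FactGroup one_FactGroup)
  qed
  have R_mult: "R (g \<otimes>\<^bsub>H\<^esub> h) = R g \<otimes>\<^bsub>?B\<^esub> R h" if "g \<in> carrier H" "h \<in> carrier H" for g h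
    using R that unfolding mon_def hom_def by blast
  have R_closed: "R g \<in> carrier ?B" if "g \<in> carrier H" for g
    using R that unfolding mon_def hom_def by blast
  have R_inj: "g = h" if "R g = R h" "g \<in> carrier H" "h \<in> carrier H" for g h
    using R that unfolding mon_def inj_on_def by blast
  have N0_iff: "a \<in> N0 \<longleftrightarrow> \<theta> a = \<one>\<^bsub>?B\<^esub>" if "a \<in> M" for a
    using that by (auto simp: N0_def kernel_def)
  have "(\<lambda>h. ?C #>\<^bsub>Fh\<^esub> \<iota> (w h)) \<in> mon H (?Q)"
    unfolding mon_def mem_Collect_eq
  proof (intro conjI homI inj_onI)
    show "?C #>\<^bsub>Fh\<^esub> \<iota> (w h) \<in> carrier (?Q)" for h
      using wF \<pi>.hom_closed by simp
    fix g h assume gh: "g \<in> carrier H" "h \<in> carrier H"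
    have "w (g \<otimes>\<^bsub>H\<^esub> h) \<otimes>\<^bsub>F\<^esub> inv\<^bsub>F\<^esub> (w g \<otimes>\<^bsub>F\<^esub> w h) \<in> N0"
      using gh wM wF by (subst N0_iff)
        (auto simp: theta_w R_mult R_closed subgroup.m_closed[OF M.subgroup_axioms]
          subgroup.m_inv_closed[OF M.subgroup_axioms] simp del: bij_group_simps)
    then show "?C #>\<^bsub>Fh\<^esub> \<iota> (w (g \<otimes>\<^bsub>H\<^esub> h)) = (?C #>\<^bsub>Fh\<^esub> \<iota> (w g)) \<otimes>\<^bsub>?Q\<^esub> (?C #>\<^bsub>Fh\<^esub> \<iota> (w h))"
      using pi_eq[of "w (g \<otimes>\<^bsub>H\<^esub> h)" "w g \<otimes>\<^bsub>F\<^esub> w h"] wF by (simp del: mult_FactGroup one_FactGroup)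
    assume "?C #>\<^bsub>Fh\<^esub> \<iota> (w g) = ?C #>\<^bsub>Fh\<^esub> \<iota> (w h)"
    then have "w g \<otimes>\<^bsub>F\<^esub> inv\<^bsub>F\<^esub> (w h) \<in> N0" using pi_eq wF by blast
    then have "R g \<otimes>\<^bsub>?B\<^esub> inv\<^bsub>?B\<^esub> (R h) = \<one>\<^bsub>?B\<^esub>"
      using gh wF by (simp add: N0_def kernel_def theta_w del: bij_group_simps)
    then have "R g = R h"
      using B.inv_solve_right'[of "\<one>\<^bsub>?B\<^esub>" "R g" "R h"] gh R_closed by (simp del: bij_group_simps)
    then show "g = h" using R_inj gh by blast
  qed
  then show "\<exists>N. N \<lhd> Fh \<and> mon H (Fh Mod N) \<noteq> {}" using C by blast
qed

end

section \<open>From SQ-universality to approximability\<close>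

lemma bij_comp_transpose:
  assumes "bij f" shows "f \<circ> transpose a b = transpose (f a) (f b) \<circ> f"
  using bij_is_inj[OF assms] by (auto simp: transpose_def fun_eq_iff dest: injD)

text \<open>In a suitable overgroup of \<open>G\<close>, all elements \<open>g \<noteq> \<one>\<close> of \<open>G\<close> share one and the same product
  \<open>c\<close> of a conjugate of \<open>g\<close> and a conjugate of \<open>g\<^sup>-\<^sup>1\<close>, and \<open>c\<close> is not central. So a map that
  detects \<open>c\<close> detects all these elements at once.\<close>

lemma common_product_of_conjugates:
  fixes G :: "('g, 'b) monoid_scheme"
  assumes "group G"
  shows "\<exists>j (r :: 'g \<times> nat \<Rightarrow> 'g \<times> nat) (c :: 'g \<times> nat \<Rightarrow> 'g \<times> nat) u t. j \<in> hom G bij_group \<and> bij r \<and> bij c \<and> bij u \<and>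
    (\<forall>g. bij (t g)) \<and> c \<circ> u \<noteq> u \<circ> c \<and>
    (\<forall>g\<in>carrier G. g \<noteq> \<one>\<^bsub>G\<^esub> \<longrightarrow> t g \<circ> j g \<circ> r = c \<circ> t g \<circ> r \<circ> j g)"
proof -
  interpret G: group G by fact
  define C where "C = carrier G"
  define j where "j g = (\<lambda>(a, k :: nat). (if a \<in> C then g \<otimes>\<^bsub>G\<^esub> a else a, k))" for g
  have jj: "j g \<circ> j h = j (g \<otimes>\<^bsub>G\<^esub> h)" if "g \<in> C" "h \<in> C" for g h
    using that by (auto simp: j_def C_def G.m_assoc fun_eq_iff)
  have j_one: "j \<one>\<^bsub>G\<^esub> = id" by (auto simp: j_def C_def fun_eq_iff)
  have j_bij: "bij (j g)" if "g \<in> C" for g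
    using that by (intro bij_of_mutual_inverses(1)[of _ "j (inv\<^bsub>G\<^esub> g)"])
      (simp_all add: jj C_def j_one)
  have j_hom: "j \<in> hom G bij_group"
    using j_bij by (auto simp: hom_def C_def[symmetric] jj)
  let ?o = "\<one>\<^bsub>G\<^esub>"
  \<comment> \<open>Conjugating \<open>r\<close> by \<open>j g\<close> gives the transposition of
    \<open>(g, 0)\<close> and \<open>(g, 1)\<close>. The permutation \<open>t g\<close> moves it to
    the spare levels \<open>2\<close> and \<open>3\<close> over \<open>\<one>\<close> and commutes
    with \<open>r\<close> when \<open>g \<noteq> \<one>\<close>, so the outcome \<open>c\<close> no
    longer depends on \<open>g\<close>.\<close>
  define r where "r = transpose (?o, 0 :: nat) (?o, 1)"
  define c where "c = transpose (?o, 2) (?o, 3) \<circ> transpose (?o, 0 :: nat) (?o, 1)"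
  define u where "u = transpose (?o, 0 :: nat) (?o, 2)"
  define t where "t g = transpose (g, 0 :: nat) (?o, 2) \<circ> transpose (g, 1) (?o, 3)" for g
  have bij: "bij r" "bij c" "bij u" "bij (t g)" for g
    by (auto simp: r_def c_def u_def t_def intro: bij_comp)
  have "(c \<circ> u) (?o, 0) \<noteq> (u \<circ> c) (?o, 0)" by (simp add: c_def u_def transpose_def)
  then have cu: "c \<circ> u \<noteq> u \<circ> c" by metis
  have "t g \<circ> j g \<circ> r = c \<circ> t g \<circ> r \<circ> j g" if g: "g \<in> C" "g \<noteq> ?o" for g
  proof -
    have "j g \<circ> r = transpose (g, 0) (g, 1) \<circ> j g"
      unfolding r_def bij_comp_transpose[OF j_bij[OF g(1)]] using g by (simp add: j_def C_def)
    moreover have "t g \<circ> transpose (g, 0) (g, 1) = transpose (?o, 2) (?o, 3) \<circ> t g"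
      unfolding bij_comp_transpose[OF bij(4)] using g by (simp add: t_def transpose_def)
    moreover have "t g \<circ> r = r \<circ> t g"
      unfolding r_def bij_comp_transpose[OF bij(4)] using g by (simp add: t_def transpose_def)
    moreover have "c \<circ> r = transpose (?o, 2) (?o, 3)"
      by (simp add: c_def r_def comp_assoc)
    ultimately show ?thesis by (metis comp_assoc)
  qed
  then have "j \<in> hom G bij_group \<and> bij r \<and> bij c \<and> bij u \<and> (\<forall>g. bij (t g)) \<and> c \<circ> u \<noteq> u \<circ> c \<and>
    (\<forall>g\<in>carrier G. g \<noteq> ?o \<longrightarrow> t g \<circ> j g \<circ> r = c \<circ> t g \<circ> r \<circ> j g)"
    using j_hom bij cu by (simp add: C_def)
  then show ?thesis
    by - (rule exI[of _ j], rule exI[of _ r], rule exI[of _ c], rule exI[of _ u], rule exI[of _ t])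
qed

context free_completion
begin

text \<open>If \<open>\<sigma> (l c)\<close> were a short product of conjugates of the relators
  \<open>?Y\<close> for every \<open>\<sigma>\<close>, then \<open>lifting\<close> would put the
  commutator of the lifts of \<open>c\<close> and \<open>u\<close> into \<open>N\<close>, although
  \<open>c\<close> and \<open>u\<close> do not commute. For a \<open>\<sigma>\<close> where this
  fails, \<open>\<sigma> \<circ> f\<close> is the required approximation.\<close>

theorem SQ_universal_imp_approximable:
  assumes inf: "infinite (UNIV :: 'g set)" and SQ: "SQ_universal TYPE('g) Fh"
  shows "all_groups_approximable TYPE('g) K"
  unfolding all_groups_approximable_def approximable_def approx_defects_def[symmetric]
proof (intro allI impI)
  fix G :: "'g monoid" and \<Phi> :: "'g set" and n :: nat
  assume G: "group G" and Phi: "finite \<Phi> \<and> \<Phi> \<subseteq> carrier G"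
  interpret G: group G by fact
  let ?B = "bij_group :: ('g \<times> nat \<Rightarrow> 'g \<times> nat) monoid"
  interpret B: group ?B by (rule group_bij_group)
  from common_product_of_conjugates[OF G]
  obtain j and r c u :: "'g \<times> nat \<Rightarrow> 'g \<times> nat" and t
    where j: "j \<in> hom G ?B" and bij: "bij r" "bij c" "bij u" "\<forall>g. bij (t g)"
      and cu: "c \<circ> u \<noteq> u \<circ> c"
      and comm: "\<forall>g\<in>carrier G. g \<noteq> \<one>\<^bsub>G\<^esub> \<longrightarrow> t g \<circ> j g \<circ> r = c \<circ> t g \<circ> r \<circ> j g"
    by (elim exE conjE) (rule that)
  interpret j: group_hom G ?B j by unfold_locales (rule j)
  \<comment> \<open>\<open>G\<close> may be uncountable, but only finitely many permutations occur
    in the argument; the subgroup they generate is countable.\<close>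
  define S where "S = {r, c, u} \<union> j ` \<Phi> \<union> t ` \<Phi>"
  have S: "S \<subseteq> carrier ?B" using bij Phi j.hom_closed by (auto simp: S_def)
  have "countable S" using Phi by (auto simp: S_def intro: countable_finite)
  define Q where "Q = ?B\<lparr>carrier := generate ?B S\<rparr>"
  have subQ: "subgroup (generate ?B S) ?B" by (rule B.generate_is_subgroup[OF S])
  have Q: "group Q" unfolding Q_def by (rule B.subgroup_imp_group[OF subQ])
  interpret Q: group Q by (rule Q)
  have "countable (carrier Q)"
    using B.countable_generate[OF S \<open>countable S\<close>] by (simp add: Q_def)
  from exists_iso_copy[OF Q this inf] obtain H' :: "'g monoid" and \<theta>
    where H': "group H'" and th: "\<theta> \<in> iso Q H'" by blast
  have "\<theta> ` carrier Q = carrier H'" using th by (simp add: iso_def bij_betw_def)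
  then have "countable (carrier H')"
    using countable_image[OF \<open>countable (carrier Q)\<close>, of \<theta>] by simp
  with SQ H' obtain N where N: "N \<lhd> Fh" and "mon H' (Fh Mod N) \<noteq> {}"
    unfolding SQ_universal_def by blast
  then obtain \<kappa> where kappa: "\<kappa> \<in> mon H' (Fh Mod N)" by blast
  interpret N: normal N Fh by (rule N)
  let ?Q = "Fh Mod N"
  have "\<theta> \<in> mon Q H'" using th by (simp add: iso_iff_mon_epi)
  then have qmon: "\<kappa> \<circ> \<theta> \<in> mon Q (?Q)" by (rule mon_compose[OF _ kappa])
  define q where "q = \<kappa> \<circ> \<theta>"
  interpret q: group_hom Q "?Q" q
    using qmon Q N.factorgroup_is_group
    by (simp add: group_hom_def group_hom_axioms_def mon_def q_def)
  have q_inj: "inj_on q (carrier Q)" using qmon by (simp add: mon_def q_def)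
  interpret \<pi>: group_hom Fh "?Q" "\<lambda>a. N #>\<^bsub>Fh\<^esub> a"
    using N.r_coset_hom_Mod N.factorgroup_is_group by (simp add: group_hom_def group_hom_axioms_def)
  have pi_one: "N #>\<^bsub>Fh\<^esub> a = \<one>\<^bsub>?Q\<^esub> \<longleftrightarrow> a \<in> N" if "a \<in> carrier Fh" for a
    using N.r_coset_eq_self_iff[OF that] by simp
  note [simp del] = mult_FactGroup one_FactGroup bij_group_simps
  have "\<forall>s\<in>carrier Q. \<exists>a\<in>carrier Fh. N #>\<^bsub>Fh\<^esub> a = q s"
    using q.hom_closed unfolding carrier_FactGroup by fast
  then obtain l where l: "\<And>s. s \<in> carrier Q \<Longrightarrow> l s \<in> carrier Fh" "\<And>s. s \<in> carrier Q \<Longrightarrow> N #>\<^bsub>Fh\<^esub> l s = q s"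
    by metis
  have SQ: "s \<in> carrier Q" if "s \<in> S" for s using that by (simp add: Q_def generate.incl)
  have multQ: "a \<otimes>\<^bsub>Q\<^esub> b = a \<circ> b" and oneQ: "\<one>\<^bsub>Q\<^esub> = id" for a b
    by (simp_all add: Q_def bij_group_simps)
  have inQ: "r \<in> carrier Q" "c \<in> carrier Q" "u \<in> carrier Q" "\<And>g. g \<in> \<Phi> \<Longrightarrow> j g \<in> carrier Q"
    "\<And>g. g \<in> \<Phi> \<Longrightarrow> t g \<in> carrier Q"
    by (auto intro!: SQ simp: S_def)
  \<comment> \<open>An arbitrary lift of the identity would only lie in \<open>N\<close>; an
    approximation must send \<open>\<one>\<close> exactly to \<open>\<one>\<close>.\<close>
  define f where "f g = (if g = \<one>\<^bsub>G\<^esub> then \<one>\<^bsub>Fh\<^esub> else l (j g))" for g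
  have f: "f g \<in> carrier Fh" "N #>\<^bsub>Fh\<^esub> f g = q (j g)" if "g \<in> \<Phi>" for g
  proof -
    show "f g \<in> carrier Fh" using l inQ that by (simp add: f_def)
    have "j \<one>\<^bsub>G\<^esub> = \<one>\<^bsub>Q\<^esub>" using j.hom_one by (simp add: oneQ bij_group_simps)
    then show "N #>\<^bsub>Fh\<^esub> f g = q (j g)"
      using l inQ that \<pi>.hom_one by (simp add: f_def)
  qed
  let ?X = "approx_defects G Fh \<Phi> f"
  have "?X \<subseteq> (\<lambda>(g, h). f g \<otimes>\<^bsub>Fh\<^esub> f h \<otimes>\<^bsub>Fh\<^esub> inv\<^bsub>Fh\<^esub> (f (g \<otimes>\<^bsub>G\<^esub> h))) ` (\<Phi> \<times> \<Phi>)"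
    by (auto simp: approx_defects_def)
  then have finX: "finite ?X" by (rule finite_subset) (use Phi in simp)
  have XN: "?X \<subseteq> N"
  proof
    fix d assume "d \<in> ?X"
    then obtain g h where gh: "g \<in> \<Phi>" "h \<in> \<Phi>" "g \<otimes>\<^bsub>G\<^esub> h \<in> \<Phi>"
      and d: "d = f g \<otimes>\<^bsub>Fh\<^esub> f h \<otimes>\<^bsub>Fh\<^esub> inv\<^bsub>Fh\<^esub> (f (g \<otimes>\<^bsub>G\<^esub> h))"
      by (auto simp: approx_defects_def)
    have "j (g \<otimes>\<^bsub>G\<^esub> h) = j g \<otimes>\<^bsub>Q\<^esub> j h"
      using subsetD[OF conjunct2[OF Phi]] gh j.hom_mult[of g h] by (simp add: multQ bij_group_simps)
    then have "N #>\<^bsub>Fh\<^esub> d = \<one>\<^bsub>?Q\<^esub>"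
      unfolding d using f gh inQ(4) q.hom_closed by simp
    moreover have "d \<in> carrier Fh" unfolding d using f gh by simp
    ultimately show "d \<in> N" using pi_one by blast
  qed
  \<comment> \<open>A lift of the two conjugates of \<open>g\<close> and its inverse whose product
    is \<open>c\<close>. The error \<open>m g\<close> lies in \<open>N\<close> and joins the defects
    as a relator, so that \<open>\<sigma> (v g)\<close> times \<open>\<sigma> (m g)\<close> is
    exactly \<open>\<sigma> (l c)\<close>.\<close>
  define v where "v g = (l (t g) \<otimes>\<^bsub>Fh\<^esub> f g \<otimes>\<^bsub>Fh\<^esub> inv\<^bsub>Fh\<^esub> l (t g)) \<otimes>\<^bsub>Fh\<^esub>
    ((l (t g) \<otimes>\<^bsub>Fh\<^esub> l r) \<otimes>\<^bsub>Fh\<^esub> inv\<^bsub>Fh\<^esub> f g \<otimes>\<^bsub>Fh\<^esub> inv\<^bsub>Fh\<^esub> (l (t g) \<otimes>\<^bsub>Fh\<^esub> l r))" for g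
  define m where "m g = inv\<^bsub>Fh\<^esub> v g \<otimes>\<^bsub>Fh\<^esub> l c" for g
  have v: "v g \<in> carrier Fh" if "g \<in> \<Phi>" for g using that f l inQ by (simp add: v_def)
  have m: "m g \<in> N" if g: "g \<in> \<Phi>" "g \<noteq> \<one>\<^bsub>G\<^esub>" for g
  proof -
    have "t g \<circ> j g \<circ> r = c \<circ> t g \<circ> r \<circ> j g" using comm g Phi by auto
    then have "t g \<otimes>\<^bsub>Q\<^esub> (j g \<otimes>\<^bsub>Q\<^esub> r) = c \<otimes>\<^bsub>Q\<^esub> (t g \<otimes>\<^bsub>Q\<^esub> (r \<otimes>\<^bsub>Q\<^esub> j g))"
      by (simp add: multQ comp_assoc)
    then have "q (t g \<otimes>\<^bsub>Q\<^esub> (j g \<otimes>\<^bsub>Q\<^esub> r)) = q (c \<otimes>\<^bsub>Q\<^esub> (t g \<otimes>\<^bsub>Q\<^esub> (r \<otimes>\<^bsub>Q\<^esub> j g)))" by simp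
    then have eq: "q (t g) \<otimes>\<^bsub>?Q\<^esub> (q (j g) \<otimes>\<^bsub>?Q\<^esub> q r) =
        q c \<otimes>\<^bsub>?Q\<^esub> (q (t g) \<otimes>\<^bsub>?Q\<^esub> (q r \<otimes>\<^bsub>?Q\<^esub> q (j g)))"
      using inQ g by simp
    note cl = q.hom_closed[OF inQ(1)] q.hom_closed[OF inQ(2)] q.hom_closed[OF inQ(4)[OF g(1)]]
      q.hom_closed[OF inQ(5)[OF g(1)]]
    have canc: "inv\<^bsub>?Q\<^esub> a \<otimes>\<^bsub>?Q\<^esub> (a \<otimes>\<^bsub>?Q\<^esub> b) = b"
      if "a \<in> carrier (?Q)" "b \<in> carrier (?Q)" for a b
      using that by (simp add: q.H.m_assoc[symmetric])
    have "N #>\<^bsub>Fh\<^esub> v g = (q (t g) \<otimes>\<^bsub>?Q\<^esub> (q (j g) \<otimes>\<^bsub>?Q\<^esub> q r)) \<otimes>\<^bsub>?Q\<^esub>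
        inv\<^bsub>?Q\<^esub> (q (t g) \<otimes>\<^bsub>?Q\<^esub> (q r \<otimes>\<^bsub>?Q\<^esub> q (j g)))"
      unfolding v_def using f g l inQ cl by (simp add: q.H.inv_mult_group q.H.m_assoc canc)
    also have "\<dots> = q c" unfolding eq using cl by (simp add: q.H.m_assoc)
    finally have "N #>\<^bsub>Fh\<^esub> m g = \<one>\<^bsub>?Q\<^esub>"
      unfolding m_def using v[OF g(1)] l inQ cl by simp
    moreover have "m g \<in> carrier Fh" using v[OF g(1)] l inQ by (simp add: m_def)
    ultimately show ?thesis using pi_one by blast
  qed
  let ?Y = "?X \<union> m ` (\<Phi> - {\<one>\<^bsub>G\<^esub>})"
  have YN: "?Y \<subseteq> N" using XN m by auto
  then have YF: "?Y \<subseteq> carrier Fh" using N.subset by blast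
  have finY: "finite ?Y" using finX Phi by simp
  let ?z = "l c \<otimes>\<^bsub>Fh\<^esub> l u \<otimes>\<^bsub>Fh\<^esub> inv\<^bsub>Fh\<^esub> l c \<otimes>\<^bsub>Fh\<^esub> inv\<^bsub>Fh\<^esub> l u"
  have "?z \<notin> N"
  proof
    assume "?z \<in> N"
    moreover have "?z \<in> carrier Fh" using l inQ by simp
    ultimately have "N #>\<^bsub>Fh\<^esub> ?z = \<one>\<^bsub>?Q\<^esub>" using pi_one by blast
    then have "q (c \<otimes>\<^bsub>Q\<^esub> u \<otimes>\<^bsub>Q\<^esub> inv\<^bsub>Q\<^esub> c \<otimes>\<^bsub>Q\<^esub> inv\<^bsub>Q\<^esub> u) = q \<one>\<^bsub>Q\<^esub>"
      using l inQ by simp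
    then have "c \<otimes>\<^bsub>Q\<^esub> u \<otimes>\<^bsub>Q\<^esub> inv\<^bsub>Q\<^esub> c \<otimes>\<^bsub>Q\<^esub> inv\<^bsub>Q\<^esub> u = \<one>\<^bsub>Q\<^esub>"
      using q_inj inQ by (subst (asm) inj_on_eq_iff[OF q_inj]) auto
    then have "(c \<otimes>\<^bsub>Q\<^esub> u) \<otimes>\<^bsub>Q\<^esub> inv\<^bsub>Q\<^esub> (u \<otimes>\<^bsub>Q\<^esub> c) = \<one>\<^bsub>Q\<^esub>"
      using inQ by (simp add: Q.inv_mult_group Q.m_assoc)
    then have "c \<otimes>\<^bsub>Q\<^esub> u = u \<otimes>\<^bsub>Q\<^esub> c"
      using inQ Q.inv_solve_right'[of "\<one>\<^bsub>Q\<^esub>" "c \<otimes>\<^bsub>Q\<^esub> u" "u \<otimes>\<^bsub>Q\<^esub> c"] by simp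
    then show False using cu by (simp add: multQ)
  qed
  then have "?z \<notin> normal_closure Fh ?Y" using Fh.normal_closure_subset[OF N YN] by blast
  \<comment> \<open>Bound \<open>n + n + 1\<close>: \<open>n\<close> factors for each of the two
    conjugates in \<open>v g\<close>, and one for \<open>m g\<close>.\<close>
  then have "\<not> (\<forall>H \<sigma>. K H \<longrightarrow> \<sigma> \<in> hom Fh H \<longrightarrow> \<sigma> (l c) \<in> conj_products (n + n + 1) (\<sigma> ` ?Y) H)"
    using lifting[OF l(1)[OF inQ(2)] l(1)[OF inQ(3)] YF finY, of "n + n + 1"] by blast
  then obtain H \<sigma> where H: "K H" and sigma: "\<sigma> \<in> hom Fh H"
    and notin: "\<sigma> (l c) \<notin> conj_products (n + n + 1) (\<sigma> ` ?Y) H" by blast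
  interpret \<sigma>: group_hom Fh H \<sigma>
    using K_group[OF H] sigma group_Fh by (simp add: group_hom_def group_hom_axioms_def)
  have "separated n ((\<sigma> \<circ> f) ` (\<Phi> - {\<one>\<^bsub>G\<^esub>})) (approx_defects G H \<Phi> (\<sigma> \<circ> f)) H"
    unfolding separated_def
  proof (rule ccontr)
    assume "(\<sigma> \<circ> f) ` (\<Phi> - {\<one>\<^bsub>G\<^esub>}) \<inter> conj_products n (approx_defects G H \<Phi> (\<sigma> \<circ> f)) H \<noteq> {}"
    then obtain g where g: "g \<in> \<Phi>" "g \<noteq> \<one>\<^bsub>G\<^esub>"
      and gin: "\<sigma> (f g) \<in> conj_products n (approx_defects G H \<Phi> (\<sigma> \<circ> f)) H" by auto
    have "approx_defects G H \<Phi> (\<sigma> \<circ> f) \<subseteq> \<sigma> ` ?Y"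
    proof
      fix d assume "d \<in> approx_defects G H \<Phi> (\<sigma> \<circ> f)"
      then obtain a b where ab: "a \<in> \<Phi>" "b \<in> \<Phi>" "a \<otimes>\<^bsub>G\<^esub> b \<in> \<Phi>"
        and d: "d = \<sigma> (f a) \<otimes>\<^bsub>H\<^esub> \<sigma> (f b) \<otimes>\<^bsub>H\<^esub> inv\<^bsub>H\<^esub> \<sigma> (f (a \<otimes>\<^bsub>G\<^esub> b))"
        by (auto simp: approx_defects_def)
      have "d = \<sigma> (f a \<otimes>\<^bsub>Fh\<^esub> f b \<otimes>\<^bsub>Fh\<^esub> inv\<^bsub>Fh\<^esub> f (a \<otimes>\<^bsub>G\<^esub> b))" unfolding d using f ab by simp
      moreover have "f a \<otimes>\<^bsub>Fh\<^esub> f b \<otimes>\<^bsub>Fh\<^esub> inv\<^bsub>Fh\<^esub> f (a \<otimes>\<^bsub>G\<^esub> b) \<in> ?X"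
        using ab by (auto simp: approx_defects_def)
      ultimately show "d \<in> \<sigma> ` ?Y" by blast
    qed
    then have gin': "\<sigma> (f g) \<in> conj_products n (\<sigma> ` ?Y) H"
      using gin conj_products_mono_set by blast
    note cl = f(1)[OF g(1)] l(1)[OF inQ(1)] l(1)[OF inQ(5)[OF g(1)]] l(1)[OF inQ(2)]
    have "\<sigma> (v g) = (\<sigma> (l (t g)) \<otimes>\<^bsub>H\<^esub> \<sigma> (f g) \<otimes>\<^bsub>H\<^esub> inv\<^bsub>H\<^esub> \<sigma> (l (t g))) \<otimes>\<^bsub>H\<^esub>
      (\<sigma> (l (t g) \<otimes>\<^bsub>Fh\<^esub> l r) \<otimes>\<^bsub>H\<^esub> inv\<^bsub>H\<^esub> \<sigma> (f g) \<otimes>\<^bsub>H\<^esub> inv\<^bsub>H\<^esub> \<sigma> (l (t g) \<otimes>\<^bsub>Fh\<^esub> l r))"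
      unfolding v_def using cl by simp
    moreover have "\<dots> \<in> conj_products (n + n) (\<sigma> ` ?Y) H"
      using gin' cl by (intro \<sigma>.H.conj_products_mult \<sigma>.H.conj_products_conj' \<sigma>.H.conj_products_inv) auto
    ultimately have vin: "\<sigma> (v g) \<in> conj_products (n + n) (\<sigma> ` ?Y) H" by simp
    have "m g \<in> ?Y" using g by blast
    then have "\<sigma> (m g) \<in> conj_products 1 (\<sigma> ` ?Y) H"
      using YF by (intro \<sigma>.H.conj_products_incl) (auto intro: \<sigma>.hom_closed)
    with vin have "\<sigma> (v g) \<otimes>\<^bsub>H\<^esub> \<sigma> (m g) \<in> conj_products (n + n + 1) (\<sigma> ` ?Y) H"
      by (rule \<sigma>.H.conj_products_mult)
    moreover have "\<sigma> (v g) \<otimes>\<^bsub>H\<^esub> \<sigma> (m g) = \<sigma> (l c)"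
      unfolding m_def using v[OF g(1)] cl by (simp add: \<sigma>.H.m_assoc[symmetric])
    ultimately show False using notin by simp
  qed
  moreover have "\<sigma> \<circ> f \<in> \<Phi> \<rightarrow> carrier H" using f by auto
  moreover have "(\<sigma> \<circ> f) \<one>\<^bsub>G\<^esub> = \<one>\<^bsub>H\<^esub>" by (simp add: f_def)
  ultimately show "\<exists>H \<phi>. K H \<and> \<phi> \<in> \<Phi> \<rightarrow> carrier H \<and> (\<one>\<^bsub>G\<^esub> \<in> \<Phi> \<longrightarrow> \<phi> \<one>\<^bsub>G\<^esub> = \<one>\<^bsub>H\<^esub>) \<and>
      separated n (\<phi> ` (\<Phi> - {\<one>\<^bsub>G\<^esub>})) (approx_defects G H \<Phi> \<phi>) H"
    using H by blast
qed

theorem all_equivalent_conditions: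
  assumes "infinite (UNIV :: 'g set)"
  shows "all_equivalent [all_groups_approximable TYPE('g) K, has_CEP Fh (\<iota> ` carrier F),
    almost_has_CEP Fh (\<iota> ` carrier F), SQ_universal TYPE('g) Fh]"
  using approximable_imp_CEP[OF assms] CEP_imp_almost_CEP[of Fh "\<iota> ` carrier F"]
    almost_CEP_imp_SQ_universal[where ?'g = 'g] SQ_universal_imp_approximable[OF assms]
  by (auto simp: all_equivalent_def)

end

section \<open>Pro-completions\<close>

text \<open>Tychonoff for the product of the finite discrete sets. \<open>C k\<close> demands
  coherence only for the maps out of \<open>k\<close>, which makes it easy to inhabit; by
  composition these sets shrink towards smaller indices, so directedness gives the finite
  intersection property.\<close>

lemma inverse_limit_nonempty:
  fixes S :: "'i \<Rightarrow> 's set" and le :: "'i \<Rightarrow> 'i \<Rightarrow> bool"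
  assumes fin: "\<And>i. i \<in> I \<Longrightarrow> finite (S i)" and ne: "\<And>i. i \<in> I \<Longrightarrow> S i \<noteq> {}"
    and refl: "\<And>i. i \<in> I \<Longrightarrow> le i i"
    and trans: "\<And>i j k. \<lbrakk>le i j; le j k\<rbrakk> \<Longrightarrow> le i k"
    and directed: "\<And>i j. \<lbrakk>i \<in> I; j \<in> I\<rbrakk> \<Longrightarrow> \<exists>k\<in>I. le k i \<and> le k j"
    and maps: "\<And>i j s. \<lbrakk>i \<in> I; j \<in> I; le i j; s \<in> S i\<rbrakk> \<Longrightarrow> p i j s \<in> S j"
    and p_refl: "\<And>i s. \<lbrakk>i \<in> I; s \<in> S i\<rbrakk> \<Longrightarrow> p i i s = s"
    and p_comp: "\<And>i j k s. \<lbrakk>i \<in> I; j \<in> I; k \<in> I; le i j; le j k; s \<in> S i\<rbrakk> \<Longrightarrow> p j k (p i j s) = p i k s"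
  shows "\<exists>s\<in>PiE I S. \<forall>i\<in>I. \<forall>j\<in>I. le i j \<longrightarrow> p i j (s i) = s j"
proof (cases "I = {}")
  case True
  then show ?thesis by auto
next
  case False
  define X where "X = product_topology (\<lambda>i. discrete_topology (S i)) I"
  have top: "topspace X = PiE I S" by (simp add: X_def)
  have compact: "compact_space X"
    unfolding X_def compact_space_product_topology using fin by (simp add: compact_space_discrete_topology)
  have slice: "closedin X {s \<in> topspace X. s i = v}" if "i \<in> I" "v \<in> S i" for i v
    using closedin_continuous_map_preimage[OF continuous_map_product_projection[of i I "\<lambda>i. discrete_topology (S i)"], of "{v}"] that
    unfolding X_def by simp
  define C where "C k = {s \<in> PiE I S. \<forall>j\<in>I. le k j \<longrightarrow> p k j (s k) = s j}" for k
  have closed: "closedin X (C k)" if k: "k \<in> I" for k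
  proof -
    have one: "closedin X {s \<in> topspace X. p k j (s k) = s j}" if j: "j \<in> I" "le k j" for j
    proof -
      have "{s \<in> topspace X. p k j (s k) = s j} =
        (\<Union>v\<in>S k. {s \<in> topspace X. s k = v} \<inter> {s \<in> topspace X. s j = p k j v})"
        using k by (auto simp: top PiE_iff)
      also have "closedin X \<dots>"
        using fin[OF k] k j maps by (intro closedin_Union) (auto intro!: closedin_Int slice)
      finally show ?thesis .
    qed
    have "C k = \<Inter>((\<lambda>j. {s \<in> topspace X. p k j (s k) = s j}) ` {j \<in> I. le k j})"
      using k refl[OF k] by (auto simp: C_def top)
    also have "closedin X \<dots>"
      using k refl[OF k] one by (intro closedin_Inter) auto
    finally show ?thesis .
  qed
  have lower: "\<exists>k\<in>I. \<forall>j\<in>J. le k j" if "finite J" "J \<subseteq> I" for J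
    using that
  proof (induction J)
    case empty
    then show ?case using False by auto
  next
    case (insert i J)
    then obtain k where "k \<in> I" "\<forall>j\<in>J. le k j" by auto
    moreover obtain l where "l \<in> I" "le l k" "le l i" using directed \<open>k \<in> I\<close> insert.prems by blast
    ultimately show ?case using trans by blast
  qed
  have antimono: "C k \<subseteq> C j" if "k \<in> I" "j \<in> I" "le k j" for k j
  proof
    fix s assume s: "s \<in> C k"
    then have "s k \<in> S k" using that by (auto simp: C_def)
    have "p j i (s j) = s i" if i: "i \<in> I" "le j i" for i
    proof -
      have "p j i (s j) = p j i (p k j (s k))" using s \<open>le k j\<close> \<open>j \<in> I\<close> by (simp add: C_def)
      also have "\<dots> = p k i (s k)" using i \<open>k \<in> I\<close> \<open>j \<in> I\<close> \<open>le k j\<close> \<open>s k \<in> S k\<close> by (intro p_comp)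
      also have "\<dots> = s i" using s i trans[OF \<open>le k j\<close> i(2)] by (simp add: C_def)
      finally show ?thesis .
    qed
    then show "s \<in> C j" using s by (auto simp: C_def)
  qed
  have nonempty: "C k \<noteq> {}" if k: "k \<in> I" for k
  proof -
    obtain v where v: "v \<in> S k" using ne[OF k] by blast
    \<comment> \<open>Only the coordinates reached from \<open>k\<close> are constrained by
      \<open>C k\<close>; elsewhere any element will do.\<close>
    define s where "s = (\<lambda>i\<in>I. if le k i then p k i v else SOME w. w \<in> S i)"
    have "s \<in> PiE I S"
      using maps[OF k] v ne by (auto simp: s_def some_in_eq)
    moreover have "p k j (s k) = s j" if "j \<in> I" "le k j" for j
      using that k refl[OF k] p_refl[OF k v] by (simp add: s_def)
    ultimately show ?thesis by (auto simp: C_def)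
  qed
  have "\<Inter>(C ` I) \<noteq> {}"
  proof (rule compact_space_fip[THEN iffD1, OF compact, rule_format], intro conjI ballI allI impI)
    show "closedin X c" if "c \<in> C ` I" for c using that closed by auto
    fix \<F> assume F: "finite \<F> \<and> \<F> \<subseteq> C ` I"
    from conjunct1[OF F] conjunct2[OF F] obtain J where J: "J \<subseteq> I" "finite J" "\<F> = C ` J"
      by (rule finite_subset_image[THEN exE]) auto
    obtain k where k: "k \<in> I" "\<forall>j\<in>J. le k j" using lower[OF J(2,1)] by blast
    have "C k \<subseteq> C j" if "j \<in> J" for j
      using antimono[OF k(1)] k(2) J(1) that by blast
    then have "C k \<subseteq> \<Inter>\<F>" using J(3) by auto
    then show "\<Inter>\<F> \<noteq> {}" using nonempty[OF k(1)] by blast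
  qed
  then obtain s where "\<And>i. i \<in> I \<Longrightarrow> s \<in> C i" by blast
  then show ?thesis using False by (intro bexI[of _ s]) (auto simp: C_def)
qed

section \<open>Products of conjugates as words with parameters\<close>

text \<open>The entry \<open>x\<close> stays symbolic and is read through \<open>h\<close>. The same
  list can thus be evaluated in different coordinates, and the choices of \<open>x\<close> made
  there can be compared.\<close>

definition conj_word ::
    "('h, 'c) monoid_scheme \<Rightarrow> ('x \<Rightarrow> 'h) \<Rightarrow> ('x \<times> 'h) list \<Rightarrow> 'h" where
  "conj_word H h ps = foldr (\<lambda>(x, g) r. (inv\<^bsub>H\<^esub> g \<otimes>\<^bsub>H\<^esub> h x \<otimes>\<^bsub>H\<^esub> g) \<otimes>\<^bsub>H\<^esub> r) ps \<one>\<^bsub>H\<^esub>"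

lemma conj_word_simps [simp]:
  "conj_word H h [] = \<one>\<^bsub>H\<^esub>"
  "conj_word H h ((x, g) # ps) = (inv\<^bsub>H\<^esub> g \<otimes>\<^bsub>H\<^esub> h x \<otimes>\<^bsub>H\<^esub> g) \<otimes>\<^bsub>H\<^esub> conj_word H h ps"
  by (simp_all add: conj_word_def)

text \<open>The hypothesis of \<open>lifting\<close> concerns groups on \<open>nat\<close>, whereas
  the coordinates of a completion live on other types; the isomorphic copy is undone here.\<close>

lemma conj_products_iso_copy:
  assumes A: "group A" and H: "group H" and pi: "\<pi> \<in> hom G A" and th: "\<theta> \<in> iso A H"
    and X: "X \<subseteq> carrier G" and a: "a \<in> carrier G"
    and c: "(\<theta> \<circ> \<pi>) a \<in> conj_products k ((\<theta> \<circ> \<pi>) ` X) H"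
  shows "\<pi> a \<in> conj_products k (\<pi> ` X) A"
proof -
  define \<eta> where "\<eta> = inv_into (carrier A) \<theta>"
  have eta: "\<eta> \<in> hom H A"
    using group.iso_set_sym[OF A th] by (simp add: \<eta>_def iso_def)
  have eta_th: "\<eta> (\<theta> (\<pi> b)) = \<pi> b" if "b \<in> carrier G" for b
    using th hom_in_carrier[OF pi that] by (simp add: \<eta>_def iso_def bij_betw_def)
  from hom_conj_products[OF H A eta c]
  have "\<pi> a \<in> conj_products k (\<eta> ` (\<theta> \<circ> \<pi>) ` X) A" using eta_th[OF a] by simp
  moreover have "\<eta> ` (\<theta> \<circ> \<pi>) ` X = \<pi> ` X"
    unfolding image_image using X eta_th by (intro image_cong) auto
  ultimately show ?thesis by simp
qed

lemma conj_products_image_word: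
  assumes "group G" "group H" "h \<in> hom G H" "X \<subseteq> carrier G" "c \<in> conj_products k (h ` X) H"
  shows "\<exists>ps. length ps = k \<and> set ps \<subseteq> {x \<in> carrier G. x \<in> X \<or> inv\<^bsub>G\<^esub> x \<in> X} \<times> carrier H \<and>
    conj_word H h ps = c"
proof -
  interpret group_hom G H h using assms by (simp add: group_hom_def group_hom_axioms_def)
  show ?thesis
    using assms(5)
  proof (induction k arbitrary: c)
    case (Suc k)
    from Suc.prems obtain z g r where c: "c = (inv\<^bsub>H\<^esub> g \<otimes>\<^bsub>H\<^esub> z \<otimes>\<^bsub>H\<^esub> g) \<otimes>\<^bsub>H\<^esub> r" "z \<in> carrier H"
      "z \<in> h ` X \<or> inv\<^bsub>H\<^esub> z \<in> h ` X" "g \<in> carrier H" "r \<in> conj_products k (h ` X) H"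
      by (rule conj_products_SucE)
    obtain ps where ps: "length ps = k"
      "set ps \<subseteq> {x \<in> carrier G. x \<in> X \<or> inv\<^bsub>G\<^esub> x \<in> X} \<times> carrier H" "conj_word H h ps = r"
      using Suc.IH[OF c(5)] by blast
    obtain x where x: "x \<in> carrier G" "x \<in> X \<or> inv\<^bsub>G\<^esub> x \<in> X" "h x = z"
    proof (cases "z \<in> h ` X")
      case True
      then show ?thesis using that assms(4) by blast
    next
      case False
      then obtain x where "x \<in> X" "inv\<^bsub>H\<^esub> z = h x" using c(3) by blast
      then show ?thesis
        using that[of "inv\<^bsub>G\<^esub> x"] assms(4) c(2) by (metis G.inv_closed G.inv_inv H.inv_inv hom_inv subsetD)
    qed
    show ?case
      by (rule exI[of _ "(x, g) # ps"]) (use ps x c in simp)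
  qed simp
qed

lemma conj_word_mem_conj_products:
  assumes "group G" "set ps \<subseteq> {x \<in> carrier G. x \<in> X \<or> inv\<^bsub>G\<^esub> x \<in> X} \<times> carrier G"
  shows "conj_word G (\<lambda>x. x) ps \<in> conj_products (length ps) X G"
  using assms(2)
proof (induction ps)
  case (Cons p ps)
  then show ?case by (cases p) (auto intro!: conj_products_SucI)
qed simp

lemma hom_conj_word:
  assumes "group G" "group H" "f \<in> hom G H" "set ps \<subseteq> Y \<times> carrier G" "h \<in> Y \<rightarrow> carrier G"
    "\<And>x. x \<in> Y \<Longrightarrow> f (h x) = h' x"
  shows "conj_word G h ps \<in> carrier G"
    and "f (conj_word G h ps) = conj_word H h' (map (apsnd f) ps)"
proof -
  interpret group_hom G H f using assms by (simp add: group_hom_def group_hom_axioms_def)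
  have "conj_word G h ps \<in> carrier G \<and> f (conj_word G h ps) = conj_word H h' (map (apsnd f) ps)"
    using assms(4)
  proof (induction ps)
    case (Cons p ps)
    then obtain x g where p: "p = (x, g)" "x \<in> Y" "g \<in> carrier G" by auto
    have "h x \<in> carrier G" using p assms(5) by auto
    then show ?case using p Cons assms(6)[OF p(2)] by simp
  qed simp
  then show "conj_word G h ps \<in> carrier G"
    and "f (conj_word G h ps) = conj_word H h' (map (apsnd f) ps)" by auto
qed

lemma (in group) set_mult_r_coset_subset:
  assumes "subgroup N G" "subgroup M G" "N \<subseteq> M" "a \<in> carrier G"
  shows "M <#> (N #> a) = M #> a"
proof -
  interpret N: subgroup N G by fact
  interpret M: subgroup M G by fact
  have "M <#> N = M"
  proof
    show "M <#> N \<subseteq> M" using assms(3) by (auto simp: set_mult_def)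
    show "M \<subseteq> M <#> N"
    proof
      fix m assume "m \<in> M"
      then have "m = m \<otimes> \<one>" "m \<in> M" by auto
      then show "m \<in> M <#> N" unfolding set_mult_def using N.one_closed by blast
    qed
  qed
  then show ?thesis
    using setmult_rcos_assoc[OF M.subset N.subset assms(4)] by simp
qed

section \<open>The pro-completion as a free completion\<close>

text \<open>\<open>K'\<close> and \<open>K\<close> stand for one class at two types: on quotients of
  \<open>F\<close>, and on copies of them over \<open>nat\<close>.\<close>

locale pro_setting =
  fixes F :: "('f, 'b) monoid_scheme" and x y :: 'f
    and K' :: "'f set monoid \<Rightarrow> bool" and K :: "nat monoid \<Rightarrow> bool"
  assumes free: "free_group_on F {x, y}" and xy: "x \<noteq> y"
    and K_group: "K H \<Longrightarrow> group H" and K_finite: "K H \<Longrightarrow> finite (carrier H)"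
    and K'_copy: "\<lbrakk>N \<lhd> F; K' (F Mod N)\<rbrakk> \<Longrightarrow> \<exists>H \<theta>. K H \<and> \<theta> \<in> iso (F Mod N) H"
    and K'_kernel: "\<lbrakk>K H; \<psi> \<in> hom F H\<rbrakk> \<Longrightarrow> K' (F Mod kernel F H \<psi>)"
    and K'_Int: "\<lbrakk>N \<lhd> F; M \<lhd> F; K' (F Mod N); K' (F Mod M)\<rbrakk> \<Longrightarrow> K' (F Mod (N \<inter> M))"
    and K_residual: "\<lbrakk>w \<in> carrier F; w \<noteq> \<one>\<^bsub>F\<^esub>\<rbrakk> \<Longrightarrow> \<exists>H. K H \<and> (\<exists>\<psi>\<in>hom F H. \<psi> w \<noteq> \<one>\<^bsub>H\<^esub>)"
begin

sublocale F: group F using free by (simp add: free_group_on_def)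

abbreviation "I \<equiv> class_kernels K' F"
abbreviation "P \<equiv> product_group I (\<lambda>N. F Mod N)"
abbreviation "Fh \<equiv> pro_completion K' F"
abbreviation "\<iota> \<equiv> pro_embedding K' F"

lemma I_normal: "N \<in> I \<Longrightarrow> N \<lhd> F" and I_subgroup: "N \<in> I \<Longrightarrow> subgroup N F"
  by (auto simp: class_kernels_def normal_imp_subgroup)

lemma group_Mod: "N \<in> I \<Longrightarrow> group (F Mod N)"
  using I_normal normal.factorgroup_is_group by blast

lemma Mod_copy: "N \<in> I \<Longrightarrow> \<exists>H \<theta>. K H \<and> \<theta> \<in> iso (F Mod N) H"
  using K'_copy by (simp add: class_kernels_def)

lemma group_P: "group P"
  by (intro product_group group_Mod)

lemma up_coset:
  assumes "N \<in> I" "M \<in> I" "N \<subseteq> M" "a \<in> carrier F"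
  shows "M <#>\<^bsub>F\<^esub> (N #>\<^bsub>F\<^esub> a) = M #>\<^bsub>F\<^esub> a"
  using assms by (intro F.set_mult_r_coset_subset I_subgroup)

lemma up_hom:
  assumes "N \<in> I" "M \<in> I" "N \<subseteq> M"
  shows "(\<lambda>c. M <#>\<^bsub>F\<^esub> c) \<in> hom (F Mod N) (F Mod M)"
proof (rule homI)
  interpret N: normal N F using I_normal assms by blast
  interpret M: normal M F using I_normal assms by blast
  fix c d assume "c \<in> carrier (F Mod N)" "d \<in> carrier (F Mod N)"
  then obtain a b where ab: "a \<in> carrier F" "c = N #>\<^bsub>F\<^esub> a" "b \<in> carrier F" "d = N #>\<^bsub>F\<^esub> b"
    by (auto simp: carrier_FactGroup)
  show "M <#>\<^bsub>F\<^esub> c \<in> carrier (F Mod M)"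
    using ab up_coset[OF assms] by (auto simp: carrier_FactGroup)
  show "M <#>\<^bsub>F\<^esub> (c \<otimes>\<^bsub>F Mod N\<^esub> d) = (M <#>\<^bsub>F\<^esub> c) \<otimes>\<^bsub>F Mod M\<^esub> (M <#>\<^bsub>F\<^esub> d)"
    using ab by (simp add: N.rcos_sum M.rcos_sum up_coset[OF assms])
qed

lemma carrier_Fh_iff:
  "s \<in> carrier Fh \<longleftrightarrow> s \<in> carrier P \<and> (\<forall>N\<in>I. \<forall>M\<in>I. N \<subseteq> M \<longrightarrow> s M = M <#>\<^bsub>F\<^esub> s N)"
  by (simp add: pro_completion_def)

lemma Fh_subset_P: "s \<in> carrier Fh \<Longrightarrow> s \<in> carrier P"
  and Fh_compatible: "\<lbrakk>s \<in> carrier Fh; N \<in> I; M \<in> I; N \<subseteq> M\<rbrakk> \<Longrightarrow> s M = M <#>\<^bsub>F\<^esub> s N"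
  unfolding carrier_Fh_iff by blast+

lemma Fh_coordinate:
  assumes "s \<in> carrier Fh" "N \<in> I" shows "s N \<in> carrier (F Mod N)"
  using Fh_subset_P[OF assms(1)] assms(2) by (auto simp del: mult_product_group)

lemma subgroup_Fh: "subgroup (carrier Fh) P"
proof -
  interpret P: group P by (rule group_P)
  have up: "group_hom (F Mod N) (F Mod M) (\<lambda>c. M <#>\<^bsub>F\<^esub> c)" if "N \<in> I" "M \<in> I" "N \<subseteq> M" for N M
    using group_Mod up_hom that by (simp add: group_hom_def group_hom_axioms_def)
  show ?thesis
  proof (rule P.subgroupI)
    show "carrier Fh \<subseteq> carrier P" by (rule subsetI) (simp only: carrier_Fh_iff)
    have "\<one>\<^bsub>P\<^esub> \<in> carrier Fh"
      unfolding carrier_Fh_iff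
    proof (intro conjI ballI impI)
      fix N M assume NM: "N \<in> I" "M \<in> I" "N \<subseteq> M"
      show "\<one>\<^bsub>P\<^esub> M = M <#>\<^bsub>F\<^esub> \<one>\<^bsub>P\<^esub> N"
        using group_hom.hom_one[OF up[OF NM]] NM by simp
    qed (rule P.one_closed)
    then show "carrier Fh \<noteq> {}" by blast
  next
    fix s assume s: "s \<in> carrier Fh"
    show "inv\<^bsub>P\<^esub> s \<in> carrier Fh"
      unfolding carrier_Fh_iff
    proof (intro conjI ballI impI)
      show "inv\<^bsub>P\<^esub> s \<in> carrier P" using Fh_subset_P[OF s] by (rule P.inv_closed)
      fix N M assume NM: "N \<in> I" "M \<in> I" "N \<subseteq> M"
      have sP: "s \<in> (\<Pi>\<^sub>E N\<in>I. carrier (F Mod N))" using Fh_subset_P[OF s] by simp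
      have "inv\<^bsub>P\<^esub> s = (\<lambda>N\<in>I. inv\<^bsub>F Mod N\<^esub> s N)" using sP group_Mod by (rule inv_product_group)
      moreover note Fh_coordinate[OF s NM(1)] Fh_compatible[OF s NM]
      ultimately show "(inv\<^bsub>P\<^esub> s) M = M <#>\<^bsub>F\<^esub> (inv\<^bsub>P\<^esub> s) N"
        using group_hom.hom_inv[OF up[OF NM]] NM by simp
    qed
  next
    fix s t assume st: "s \<in> carrier Fh" "t \<in> carrier Fh"
    show "s \<otimes>\<^bsub>P\<^esub> t \<in> carrier Fh"
      unfolding carrier_Fh_iff
    proof (intro conjI ballI impI)
      show "s \<otimes>\<^bsub>P\<^esub> t \<in> carrier P" using st by (intro P.m_closed Fh_subset_P)
      fix N M assume NM: "N \<in> I" "M \<in> I" "N \<subseteq> M"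
      note Fh_coordinate[OF st(1) NM(1)] Fh_coordinate[OF st(2) NM(1)]
        Fh_compatible[OF st(1) NM] Fh_compatible[OF st(2) NM]
      then show "(s \<otimes>\<^bsub>P\<^esub> t) M = M <#>\<^bsub>F\<^esub> (s \<otimes>\<^bsub>P\<^esub> t) N"
        using group_hom.hom_mult[OF up[OF NM]] NM by (simp del: mult_FactGroup)
    qed
  qed
qed

lemma Fh_eq: "Fh = P\<lparr>carrier := carrier Fh\<rparr>"
  by (simp add: pro_completion_def)

lemma group_Fh: "group Fh"
  using group.subgroup_imp_group[OF group_P subgroup_Fh] Fh_eq by simp

lemma mult_Fh: "s \<otimes>\<^bsub>Fh\<^esub> t = (\<lambda>N\<in>I. s N \<otimes>\<^bsub>F Mod N\<^esub> t N)"
  by (simp add: pro_completion_def del: mult_FactGroup)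

lemma coordinate_hom:
  assumes "N \<in> I" shows "(\<lambda>s. s N) \<in> hom Fh (F Mod N)"
  using assms Fh_coordinate by (auto simp: hom_def mult_Fh simp del: mult_FactGroup)

lemma \<iota>_apply: "N \<in> I \<Longrightarrow> \<iota> w N = N #>\<^bsub>F\<^esub> w"
  by (simp add: pro_embedding_def)

lemma hom_\<iota>: "\<iota> \<in> hom F Fh"
proof (rule homI)
  fix w assume w: "w \<in> carrier F"
  then show "\<iota> w \<in> carrier Fh"
    using up_coset by (auto simp: carrier_Fh_iff pro_embedding_def carrier_FactGroup)
  fix v assume v: "v \<in> carrier F"
  show "\<iota> (w \<otimes>\<^bsub>F\<^esub> v) = \<iota> w \<otimes>\<^bsub>Fh\<^esub> \<iota> v"
    unfolding mult_Fh using w v I_normal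
    by (auto simp: pro_embedding_def normal.rcos_sum intro!: restrict_ext)
qed

lemma extend:
  assumes H: "K H" and psi: "\<psi> \<in> hom F H"
  shows "\<exists>\<sigma>\<in>hom Fh H. \<forall>a\<in>carrier F. \<sigma> (\<iota> a) = \<psi> a"
proof -
  interpret group_hom F H \<psi>
    using K_group[OF H] psi F.group_axioms by (simp add: group_hom_def group_hom_axioms_def)
  let ?N = "kernel F H \<psi>"
  have N: "?N \<in> I" using normal_kernel K'_kernel[OF H psi] by (simp add: class_kernels_def)
  interpret N: normal ?N F by (rule normal_kernel)
  obtain g where g: "g \<in> hom (F Mod ?N) H" "\<And>a. a \<in> carrier F \<Longrightarrow> g (?N #>\<^bsub>F\<^esub> a) = \<psi> a"
  proof (rule FactGroup_universal[OF psi normal_kernel])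
    fix a b assume ab: "a \<in> carrier F" "b \<in> carrier F" "?N #>\<^bsub>F\<^esub> a = ?N #>\<^bsub>F\<^esub> b"
    then have "a \<in> ?N #>\<^bsub>F\<^esub> b" using F.rcos_self[OF ab(1) N.subgroup_axioms] by simp
    then obtain n where n: "n \<in> carrier F" "\<psi> n = \<one>\<^bsub>H\<^esub>" "a = n \<otimes>\<^bsub>F\<^esub> b"
      unfolding r_coset_def kernel_def by blast
    show "\<psi> a = \<psi> b"
      unfolding n(3) hom_mult[OF n(1) ab(2)] n(2) by (rule H.l_one[OF hom_closed[OF ab(2)]])
  next
    fix g assume "g \<in> hom (F Mod ?N) H" "\<And>a. a \<in> carrier F \<Longrightarrow> g (?N #>\<^bsub>F\<^esub> a) = \<psi> a"
    then show thesis by (rule that)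
  qed
  have "g \<circ> (\<lambda>s. s ?N) \<in> hom Fh H" using Group.hom_compose[OF coordinate_hom[OF N] g(1)] .
  then show ?thesis using g(2) \<iota>_apply[OF N] by (intro bexI[of _ "g \<circ> (\<lambda>s. s ?N)"]) auto
qed

text \<open>In every finite quotient there are only finitely many expressions of \<open>a\<close> of
  length \<open>k\<close>, and they form an inverse system. A coherent thread fixes the relators
  used and assembles the conjugators into elements of \<open>Fh\<close>.\<close>

lemma lifting_conj_products:
  assumes a: "a \<in> carrier Fh" and X: "X \<subseteq> carrier Fh" "finite X"
    and hyp: "\<And>H \<sigma>. \<lbrakk>K H; \<sigma> \<in> hom Fh H\<rbrakk> \<Longrightarrow> \<sigma> a \<in> conj_products k (\<sigma> ` X) H"
  shows "a \<in> conj_products k X Fh"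
proof -
  interpret Fh: group Fh by (rule group_Fh)
  define Y where "Y = {z \<in> carrier Fh. z \<in> X \<or> inv\<^bsub>Fh\<^esub> z \<in> X}"
  have "Y \<subseteq> X \<union> m_inv Fh ` X"
    using image_iff by (fastforce simp: Y_def)
  then have "finite Y" using X(2) finite_subset by blast
  have fin_Mod: "finite (carrier (F Mod N))" if N: "N \<in> I" for N
  proof -
    obtain H \<theta> where "K H" "\<theta> \<in> iso (F Mod N) H"
      using Mod_copy[OF N] by blast
    then show ?thesis using K_finite bij_betw_finite by (auto simp: iso_def)
  qed
  \<comment> \<open>The relators are recorded as elements of \<open>Fh\<close> and only the
    conjugators in \<open>F Mod N\<close>, so that the canonical maps change the second components
    alone.\<close>
  define S where "S N = {ps. length ps = k \<and> set ps \<subseteq> Y \<times> carrier (F Mod N) \<and>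
    conj_word (F Mod N) (\<lambda>s. s N) ps = a N}" for N
  have fin: "finite (S N)" if N: "N \<in> I" for N
  proof (rule finite_subset)
    show "S N \<subseteq> {ps. set ps \<subseteq> Y \<times> carrier (F Mod N) \<and> length ps = k}" by (auto simp: S_def)
    show "finite {ps. set ps \<subseteq> Y \<times> carrier (F Mod N) \<and> length ps = k}"
      by (rule finite_lists_length_eq) (use \<open>finite Y\<close> fin_Mod[OF N] in auto)
  qed
  have ne: "S N \<noteq> {}" if N: "N \<in> I" for N
  proof -
    obtain H \<theta> where H: "K H" and th: "\<theta> \<in> iso (F Mod N) H"
      using Mod_copy[OF N] by blast
    have "\<theta> \<in> hom (F Mod N) H" using th by (simp add: iso_def)
    then have "\<theta> \<circ> (\<lambda>s. s N) \<in> hom Fh H" by (rule Group.hom_compose[OF coordinate_hom[OF N]])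
    from conj_products_iso_copy[OF group_Mod[OF N] K_group[OF H] coordinate_hom[OF N] th X(1) a
        hyp[OF H this]]
    have "a N \<in> conj_products k ((\<lambda>s. s N) ` X) (F Mod N)" .
    from conj_products_image_word[OF group_Fh group_Mod[OF N] coordinate_hom[OF N] X(1) this]
    show ?thesis unfolding S_def Y_def by blast
  qed
  have directed: "N \<inter> M \<in> I" if "N \<in> I" "M \<in> I" for N M
    using that K'_Int F.normal_subgroup_intersect by (auto simp: class_kernels_def)
  define p :: "'f set \<Rightarrow> 'f set \<Rightarrow> (('f set \<Rightarrow> 'f set) \<times> 'f set) list \<Rightarrow> _"
    where "p N M = map (apsnd (\<lambda>c. M <#>\<^bsub>F\<^esub> c))" for N M
  have Y_coord: "z N \<in> carrier (F Mod N)" "z M = M <#>\<^bsub>F\<^esub> z N"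
    if "z \<in> Y" "N \<in> I" "M \<in> I" "N \<subseteq> M" for z N M
    using that Fh_coordinate Fh_compatible by (auto simp: Y_def)
  have maps: "p N M ps \<in> S M" if NM: "N \<in> I" "M \<in> I" "N \<subseteq> M" and ps: "ps \<in> S N" for N M ps
  proof -
    have "M <#>\<^bsub>F\<^esub> conj_word (F Mod N) (\<lambda>s. s N) ps = conj_word (F Mod M) (\<lambda>s. s M) (p N M ps)"
      unfolding p_def using ps Y_coord NM
      by (intro hom_conj_word(2)[OF group_Mod group_Mod up_hom, where Y = Y]) (auto simp: S_def)
    moreover note Fh_compatible[OF a NM]
    moreover have "M <#>\<^bsub>F\<^esub> c \<in> carrier (F Mod M)" if "c \<in> carrier (F Mod N)" for c
      using up_hom[OF NM] that by (auto simp: hom_def)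
    ultimately show ?thesis
      using ps by (fastforce simp: S_def p_def)
  qed
  have up_up: "M' <#>\<^bsub>F\<^esub> (M <#>\<^bsub>F\<^esub> c) = M' <#>\<^bsub>F\<^esub> c"
    if up: "N \<in> I" "M \<in> I" "M' \<in> I" "N \<subseteq> M" "M \<subseteq> M'" "c \<in> carrier (F Mod N)" for N M M' c
  proof -
    obtain b where b: "b \<in> carrier F" "c = N #>\<^bsub>F\<^esub> b" using up by (auto simp: carrier_FactGroup)
    show ?thesis
      unfolding b(2) using up b up_coset[of N M b] up_coset[of M M' b] up_coset[of N M' b] by simp
  qed
  have up_self: "N <#>\<^bsub>F\<^esub> c = c" if "N \<in> I" "c \<in> carrier (F Mod N)" for N c
    using that up_coset[of N N] by (auto simp: carrier_FactGroup)
  have "\<exists>s\<in>PiE I S. \<forall>N\<in>I. \<forall>M\<in>I. N \<subseteq> M \<longrightarrow> p N M (s N) = s M"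
  proof (rule inverse_limit_nonempty[where le = "(\<subseteq>)"])
    show "\<exists>L\<in>I. L \<subseteq> N \<and> L \<subseteq> M" if "N \<in> I" "M \<in> I" for N M
      using directed[OF that] by blast
    show "p N N ps = ps" if "N \<in> I" "ps \<in> S N" for N ps
      unfolding p_def using that up_self[OF that(1)] by (intro map_idI) (auto simp: S_def)
    show "p M L (p N M ps) = p N L ps"
      if "N \<in> I" "M \<in> I" "L \<in> I" "N \<subseteq> M" "M \<subseteq> L" "ps \<in> S N" for N M L ps
      unfolding p_def map_map using that up_up[OF that(1-5)] by (intro map_cong) (auto simp: S_def)
  qed (use fin ne maps in auto)
  then obtain s where sS: "s \<in> PiE I S"
    and s_compat: "\<forall>N\<in>I. \<forall>M\<in>I. N \<subseteq> M \<longrightarrow> p N M (s N) = s M" by blast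
  have s: "s N \<in> S N" if "N \<in> I" for N using sS that by (rule PiE_mem)
  have compat: "p N M (s N) = s M" if "N \<in> I" "M \<in> I" "N \<subseteq> M" for N M
    using s_compat that by blast
  \<comment> \<open>Some index \<open>N0\<close> is required as a reference. A nontrivial element of
    \<open>F\<close> yields a group in the class, and the kernel of a map to it is an index.\<close>
  have "x \<noteq> \<one>\<^bsub>F\<^esub> \<or> y \<noteq> \<one>\<^bsub>F\<^esub>" using xy by auto
  then obtain w where "w \<in> carrier F" "w \<noteq> \<one>\<^bsub>F\<^esub>" using free by (auto simp: free_group_on_def)
  then obtain H \<psi> where H: "K H" and psi: "\<psi> \<in> hom F H" using K_residual by blast
  have "group_hom F H \<psi>"
    using K_group[OF H] psi F.group_axioms by (simp add: group_hom_def group_hom_axioms_def)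
  then have "kernel F H \<psi> \<in> I"
    using group_hom.normal_kernel K'_kernel[OF H psi] by (auto simp: class_kernels_def)
  then obtain N0 where N0: "N0 \<in> I" by blast
  \<comment> \<open>The transition maps leave first components alone, and any two indices can be
    compared through their intersection.\<close>
  have fst_const: "map fst (s N) = map fst (s N0)" if N: "N \<in> I" for N
  proof -
    have "map fst (s M) = map fst (s (N \<inter> N0))" if "M \<in> I" "N \<inter> N0 \<subseteq> M" for M
      unfolding compat[OF directed[OF N N0] that, symmetric] by (simp add: p_def)
    from this[OF N] this[OF N0] show ?thesis by simp
  qed
  define g where "g i = (\<lambda>N\<in>I. snd (s N ! i))" for i
  have len: "length (s N) = k" if "N \<in> I" for N using s[OF that] by (simp add: S_def)
  have nth_s: "fst (s N ! i) \<in> Y" "snd (s N ! i) \<in> carrier (F Mod N)" if "N \<in> I" "i < k" for N i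
  proof -
    have "s N ! i \<in> set (s N)" using len[OF that(1)] that(2) by simp
    then have "s N ! i \<in> Y \<times> carrier (F Mod N)" using s[OF that(1)] unfolding S_def by blast
    then show "fst (s N ! i) \<in> Y" "snd (s N ! i) \<in> carrier (F Mod N)" by auto
  qed
  have g: "g i \<in> carrier Fh" if i: "i < k" for i
    unfolding carrier_Fh_iff
  proof (intro conjI ballI impI)
    show "g i \<in> carrier P" using nth_s[OF _ i] by (auto simp: g_def)
    fix N M assume NM: "N \<in> I" "M \<in> I" "N \<subseteq> M"
    show "g i M = M <#>\<^bsub>F\<^esub> g i N"
      using NM i len by (simp add: g_def compat[OF NM, symmetric]) (simp add: p_def)
  qed
  define ps where "ps = map (\<lambda>i. (fst (s N0 ! i), g i)) [0..<k]"
  have ps: "set ps \<subseteq> Y \<times> carrier Fh" using g nth_s[OF N0] by (auto simp: ps_def)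
  have "conj_word Fh (\<lambda>z. z) ps = a"
  proof (rule ext)
    have in_Fh: "conj_word Fh (\<lambda>z. z) ps \<in> carrier Fh"
      using ps by (intro hom_conj_word(1)[OF group_Fh group_Fh iso_imp_homomorphism[OF id_iso], where Y = Y and h' = "\<lambda>z. z"])
        (auto simp: Y_def)
    fix N
    show "conj_word Fh (\<lambda>z. z) ps N = a N"
    proof (cases "N \<in> I")
      case True
      have "map (apsnd (\<lambda>t. t N)) ps = s N"
      proof (rule nth_equalityI)
        fix i assume "i < length (map (apsnd (\<lambda>t. t N)) ps)"
        then have i: "i < k" by (simp add: ps_def)
        have "fst (s N0 ! i) = fst (s N ! i)"
          using arg_cong[OF fst_const[OF True], of "\<lambda>l. l ! i"] i len N0 True by simp
        then show "map (apsnd (\<lambda>t. t N)) ps ! i = s N ! i"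
          using i True by (simp add: ps_def g_def prod_eq_iff)
      qed (use len True in \<open>simp add: ps_def\<close>)
      moreover have "conj_word Fh (\<lambda>z. z) ps N = conj_word (F Mod N) (\<lambda>z. z N) (map (apsnd (\<lambda>t. t N)) ps)"
        using ps by (intro hom_conj_word(2)[OF group_Fh group_Mod[OF True] coordinate_hom[OF True], where Y = Y])
          (auto simp: Y_def)
      ultimately show ?thesis using s[OF True] by (simp add: S_def)
    next
      case False
      then show ?thesis
        using Fh_subset_P[OF in_Fh] Fh_subset_P[OF a] by (simp add: PiE_iff extensional_def)
    qed
  qed
  moreover have "length ps = k" by (simp add: ps_def)
  ultimately show ?thesis
    using conj_word_mem_conj_products[OF group_Fh, of ps X] ps by (auto simp: Y_def)
qed

text \<open>Compactness puts \<open>a\<close> itself into the normal closure, and normality takes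
  care of its conjugate by \<open>u\<close>.\<close>

lemma lifting:
  assumes a: "a \<in> carrier Fh" and u: "u \<in> carrier Fh" and X: "X \<subseteq> carrier Fh" "finite X"
    and hyp: "\<And>H \<sigma>. \<lbrakk>K H; \<sigma> \<in> hom Fh H\<rbrakk> \<Longrightarrow> \<sigma> a \<in> conj_products k (\<sigma> ` X) H"
  shows "a \<otimes>\<^bsub>Fh\<^esub> u \<otimes>\<^bsub>Fh\<^esub> inv\<^bsub>Fh\<^esub> a \<otimes>\<^bsub>Fh\<^esub> inv\<^bsub>Fh\<^esub> u \<in> normal_closure Fh X"
proof -
  interpret Fh: group Fh by (rule group_Fh)
  interpret C: normal "normal_closure Fh X" Fh by (rule Fh.normal_closure_normal[OF X(1)])
  have aC: "a \<in> normal_closure Fh X"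
    using lifting_conj_products[OF a X hyp] Fh.conj_products_subset_normal_closure[OF X(1)] by blast
  have "a \<otimes>\<^bsub>Fh\<^esub> (u \<otimes>\<^bsub>Fh\<^esub> inv\<^bsub>Fh\<^esub> a \<otimes>\<^bsub>Fh\<^esub> inv\<^bsub>Fh\<^esub> u) \<in> normal_closure Fh X"
    using aC u by (intro subgroup.m_closed[OF C.subgroup_axioms] C.inv_op_closed2
      subgroup.m_inv_closed[OF C.subgroup_axioms])
  then show ?thesis
    using a u by (simp add: Fh.m_assoc)
qed

lemma free_completion: "free_completion F x y Fh \<iota> K"
  by (rule free_completion.intro;
      fact free xy group_Fh hom_\<iota> K_group K_finite extend K_residual lifting)

end

section \<open>Products over all homomorphisms\<close>

text \<open>The elements \<open>z\<^sup>g (z\<^sup>-\<^sup>1)\<^sup>h\<close> include \<open>\<one>\<close>, so products of them along a fixed list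
  of \<open>z\<close> absorb any choice of which \<open>z\<close> really occur. This is what fails for products of
  conjugates, where the choice may vary with the coordinate of an infinite product.\<close>

primrec conj_differences :: "('a, 'b) monoid_scheme \<Rightarrow> 'a list \<Rightarrow> 'a set" where
  "conj_differences H [] = {\<one>\<^bsub>H\<^esub>}"
| "conj_differences H (z # zs) =
     {(inv\<^bsub>H\<^esub> g \<otimes>\<^bsub>H\<^esub> z \<otimes>\<^bsub>H\<^esub> g) \<otimes>\<^bsub>H\<^esub> (inv\<^bsub>H\<^esub> h \<otimes>\<^bsub>H\<^esub> inv\<^bsub>H\<^esub> z \<otimes>\<^bsub>H\<^esub> h) \<otimes>\<^bsub>H\<^esub> r | g h r.
        g \<in> carrier H \<and> h \<in> carrier H \<and> r \<in> conj_differences H zs}"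

context group
begin

lemma conj_differences_ConsI:
  assumes "g \<in> carrier G" "h \<in> carrier G" "r \<in> conj_differences G zs"
  shows "(inv g \<otimes> z \<otimes> g) \<otimes> (inv h \<otimes> inv z \<otimes> h) \<otimes> r \<in> conj_differences G (z # zs)"
  using assms by auto

lemma conj_differences_closed:
  "set zs \<subseteq> carrier G \<Longrightarrow> c \<in> conj_differences G zs \<Longrightarrow> c \<in> carrier G"
  by (induction zs arbitrary: c) auto

lemma conj_differences_Cons_subset:
  assumes "set (z # zs) \<subseteq> carrier G"
  shows "conj_differences G zs \<subseteq> conj_differences G (z # zs)"
proof
  fix c assume c: "c \<in> conj_differences G zs"
  then have "c = (inv \<one> \<otimes> z \<otimes> \<one>) \<otimes> (inv \<one> \<otimes> inv z \<otimes> \<one>) \<otimes> c"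
    using assms conj_differences_closed[of zs c] by simp
  then show "c \<in> conj_differences G (z # zs)"
    using conj_differences_ConsI[OF one_closed one_closed c, of z] by simp
qed

lemma one_in_conj_differences:
  "set zs \<subseteq> carrier G \<Longrightarrow> \<one> \<in> conj_differences G zs"
  using conj_differences_Cons_subset by (induction zs) (auto simp del: conj_differences.simps(2))

lemma conj_differences_append:
  assumes "set ys \<subseteq> carrier G" "set zs \<subseteq> carrier G"
    and "a \<in> conj_differences G ys" "b \<in> conj_differences G zs"
  shows "a \<otimes> b \<in> conj_differences G (ys @ zs)"
  using assms(1,3)
proof (induction ys arbitrary: a)
  case Nil
  then show ?case using assms(2,4) conj_differences_closed by simp
next
  case (Cons z ys)
  then obtain g h r where a: "a = (inv g \<otimes> z \<otimes> g) \<otimes> (inv h \<otimes> inv z \<otimes> h) \<otimes> r"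
    "g \<in> carrier G" "h \<in> carrier G" "r \<in> conj_differences G ys" by auto
  have "a \<otimes> b = (inv g \<otimes> z \<otimes> g) \<otimes> (inv h \<otimes> inv z \<otimes> h) \<otimes> (r \<otimes> b)"
    using a Cons.prems conj_differences_closed[of ys r] conj_differences_closed[OF assms(2,4)]
    by (simp add: m_assoc)
  then show ?case
    using Cons a conj_differences_ConsI[of g h "r \<otimes> b" "ys @ zs" z]
    by (simp del: conj_differences.simps(2))
qed

lemma conj_differences_conj:
  assumes "set zs \<subseteq> carrier G" "c \<in> conj_differences G zs" "k \<in> carrier G"
  shows "inv k \<otimes> c \<otimes> k \<in> conj_differences G zs"
  using assms(1,2)
proof (induction zs arbitrary: c)
  case Nil
  then show ?case using assms(3) by simp
next
  case (Cons z zs)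
  then obtain g h r where c: "c = (inv g \<otimes> z \<otimes> g) \<otimes> (inv h \<otimes> inv z \<otimes> h) \<otimes> r"
    "g \<in> carrier G" "h \<in> carrier G" "r \<in> conj_differences G zs" by auto
  have canc: "k \<otimes> (inv k \<otimes> a) = a" if "a \<in> carrier G" for a
    using that assms(3) by (simp add: m_assoc[symmetric])
  have "inv k \<otimes> c \<otimes> k =
    (inv (g \<otimes> k) \<otimes> z \<otimes> (g \<otimes> k)) \<otimes> (inv (h \<otimes> k) \<otimes> inv z \<otimes> (h \<otimes> k)) \<otimes> (inv k \<otimes> r \<otimes> k)"
    using c Cons.prems conj_differences_closed[of zs r] assms(3)
    by (simp add: m_assoc inv_mult_group canc)
  moreover have "inv k \<otimes> r \<otimes> k \<in> conj_differences G zs" using Cons c by simp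
  ultimately show ?case
    using c assms(3) conj_differences_ConsI[of "g \<otimes> k" "h \<otimes> k" "inv k \<otimes> r \<otimes> k" zs z]
    by (simp del: conj_differences.simps(2))
qed

lemma conj_differences_member:
  assumes "set zs \<subseteq> carrier G" "z \<in> set zs" "g \<in> carrier G" "h \<in> carrier G"
  shows "(inv g \<otimes> z \<otimes> g) \<otimes> (inv h \<otimes> inv z \<otimes> h) \<in> conj_differences G zs"
  using assms(1,2)
proof (induction zs)
  case (Cons y zs)
  show ?case
  proof (cases "y = z")
    case True
    have "\<one> \<in> conj_differences G zs" using Cons.prems by (intro one_in_conj_differences) auto
    then show ?thesis
      using conj_differences_ConsI[OF assms(3,4), of \<one> zs z] True Cons.prems assms(3,4)
      by (simp del: conj_differences.simps(2))
  next
    case False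
    then show ?thesis using Cons conj_differences_Cons_subset[of y zs] by auto
  qed
qed simp

text \<open>For a conjugate \<open>y\<close> of \<open>x\<close> or its inverse, the commutator of
  \<open>y r\<close> with \<open>u\<close> is that of \<open>r\<close> conjugated, times that of
  \<open>y\<close>, and the latter is one pair along \<open>x\<close>. Any element of
  \<open>xs\<close> may occur in each of the \<open>k\<close> factors, hence \<open>k\<close> copies
  of \<open>xs\<close>.\<close>

lemma commutator_conj_products:
  assumes xs: "set xs \<subseteq> carrier G" and u: "u \<in> carrier G" and c: "c \<in> conj_products k (set xs) G"
  shows "c \<otimes> u \<otimes> inv c \<otimes> inv u \<in> conj_differences G (concat (replicate k xs))"
  using c
proof (induction k arbitrary: c)
  case 0
  then show ?case using u by simp
next
  case (Suc k)
  from Suc.prems obtain x g r where c: "c = (inv g \<otimes> x \<otimes> g) \<otimes> r" "x \<in> carrier G"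
    "x \<in> set xs \<or> inv x \<in> set xs" "g \<in> carrier G" "r \<in> conj_products k (set xs) G"
    by (rule conj_products_SucE)
  have r: "r \<in> carrier G" using conj_products_closed[OF c(5)] .
  let ?y = "inv g \<otimes> x \<otimes> g"
  have canc: "inv b \<otimes> (b \<otimes> a) = a" "b \<otimes> (inv b \<otimes> a) = a" if "a \<in> carrier G" "b \<in> carrier G" for a b
    using that by (simp_all add: m_assoc[symmetric])
  have sets: "set (concat (replicate k xs)) \<subseteq> carrier G" using xs by (induction k) auto
  have "c \<otimes> u \<otimes> inv c \<otimes> inv u =
    (inv (inv ?y) \<otimes> (r \<otimes> u \<otimes> inv r \<otimes> inv u) \<otimes> inv ?y) \<otimes> (?y \<otimes> u \<otimes> inv ?y \<otimes> inv u)"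
    using c r u by (simp add: m_assoc inv_mult_group canc)
  moreover have "inv (inv ?y) \<otimes> (r \<otimes> u \<otimes> inv r \<otimes> inv u) \<otimes> inv ?y \<in> conj_differences G (concat (replicate k xs))"
    using sets Suc.IH[OF c(5)] c by (intro conj_differences_conj) auto
  moreover have "?y \<otimes> u \<otimes> inv ?y \<otimes> inv u \<in> conj_differences G xs"
  proof (cases "x \<in> set xs")
    case True
    have "?y \<otimes> u \<otimes> inv ?y \<otimes> inv u =
        (inv g \<otimes> x \<otimes> g) \<otimes> (inv (g \<otimes> inv u) \<otimes> inv x \<otimes> (g \<otimes> inv u))"
      using c u by (simp add: m_assoc inv_mult_group)
    then show ?thesis
      using conj_differences_member[OF xs True c(4), of "g \<otimes> inv u"] c u by simp
  next
    case False
    \<comment> \<open>Only the inverse of \<open>x\<close> is in the list, so the pair comes out in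
      the wrong order; moving \<open>b\<close> to the front conjugates the other factor by
      \<open>b\<close>.\<close>
    define z where "z = inv x"
    have z: "z \<in> set xs" "z \<in> carrier G" "x = inv z" using c False by (auto simp: z_def)
    define b where "b = inv (g \<otimes> inv u) \<otimes> z \<otimes> (g \<otimes> inv u)"
    have b: "b \<in> carrier G" using z c u by (simp add: b_def)
    have "?y \<otimes> u \<otimes> inv ?y \<otimes> inv u = (inv g \<otimes> inv z \<otimes> g) \<otimes> b"
      using z c u by (simp add: b_def m_assoc inv_mult_group)
    also have "\<dots> = b \<otimes> (inv (g \<otimes> b) \<otimes> inv z \<otimes> (g \<otimes> b))"
      using z(2) c b by (simp add: m_assoc inv_mult_group canc)
    finally show ?thesis
      using conj_differences_member[OF xs z(1), of "g \<otimes> inv u" "g \<otimes> b"] c u b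
      by (simp add: b_def)
  qed
  ultimately have "c \<otimes> u \<otimes> inv c \<otimes> inv u \<in> conj_differences G (concat (replicate k xs) @ xs)"
    using conj_differences_append[OF sets xs] by simp
  moreover have "concat (replicate k xs) @ xs = concat (replicate (Suc k) xs)"
    by (induction k) auto
  ultimately show ?case by simp
qed

lemma conj_differences_subset_normal:
  assumes "M \<lhd> G" "set zs \<subseteq> M"
  shows "conj_differences G zs \<subseteq> M"
proof
  interpret M: normal M G by fact
  fix c assume "c \<in> conj_differences G zs"
  then show "c \<in> M"
    using assms(2)
  proof (induction zs arbitrary: c)
    case (Cons z zs)
    then obtain g h r where c: "c = (inv g \<otimes> z \<otimes> g) \<otimes> (inv h \<otimes> inv z \<otimes> h) \<otimes> r"
      "g \<in> carrier G" "h \<in> carrier G" "r \<in> conj_differences G zs" by auto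
    have "z \<in> M" "r \<in> M" using Cons c by auto
    then show ?case
      unfolding c(1) using c
      by (intro subgroup.m_closed[OF M.subgroup_axioms] M.inv_op_closed1
          subgroup.m_inv_closed[OF M.subgroup_axioms])
  qed simp
qed

end

text \<open>The list \<open>zs\<close> is common to all coordinates, so the conjugators chosen in
  each coordinate combine into elements of the product.\<close>

lemma conj_differences_product_group:
  assumes A: "\<And>i. i \<in> I \<Longrightarrow> group (A i)"
    and zs: "set zs \<subseteq> carrier (product_group I A)" and c: "c \<in> carrier (product_group I A)"
    and "\<And>i. i \<in> I \<Longrightarrow> c i \<in> conj_differences (A i) (map (\<lambda>z. z i) zs)"
  shows "c \<in> conj_differences (product_group I A) zs"
  using zs c assms(4)
proof (induction zs arbitrary: c)
  case Nil
  then show ?case by (auto simp: PiE_iff extensional_def fun_eq_iff)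
next
  case (Cons z zs)
  interpret P: group "product_group I A" using A by (rule product_group)
  let ?P = "product_group I A"
  have "\<forall>i\<in>I. \<exists>g h r. g \<in> carrier (A i) \<and> h \<in> carrier (A i) \<and>
      r \<in> conj_differences (A i) (map (\<lambda>z. z i) zs) \<and>
      c i = (inv\<^bsub>A i\<^esub> g \<otimes>\<^bsub>A i\<^esub> z i \<otimes>\<^bsub>A i\<^esub> g) \<otimes>\<^bsub>A i\<^esub> (inv\<^bsub>A i\<^esub> h \<otimes>\<^bsub>A i\<^esub> inv\<^bsub>A i\<^esub> (z i) \<otimes>\<^bsub>A i\<^esub> h) \<otimes>\<^bsub>A i\<^esub> r"
    using Cons.prems(3) by fastforce
  then obtain g h r where ghr: "\<And>i. i \<in> I \<Longrightarrow> g i \<in> carrier (A i) \<and> h i \<in> carrier (A i) \<and>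
      r i \<in> conj_differences (A i) (map (\<lambda>z. z i) zs) \<and>
      c i = (inv\<^bsub>A i\<^esub> g i \<otimes>\<^bsub>A i\<^esub> z i \<otimes>\<^bsub>A i\<^esub> g i) \<otimes>\<^bsub>A i\<^esub> (inv\<^bsub>A i\<^esub> h i \<otimes>\<^bsub>A i\<^esub> inv\<^bsub>A i\<^esub> (z i) \<otimes>\<^bsub>A i\<^esub> h i) \<otimes>\<^bsub>A i\<^esub> r i"
    by metis
  have zi: "set (map (\<lambda>z. z i) zs) \<subseteq> carrier (A i)" if "i \<in> I" for i
    using Cons.prems(1) that by auto
  have ri: "r i \<in> carrier (A i)" if "i \<in> I" for i
    using group.conj_differences_closed[OF A zi] ghr that by blast
  let ?g = "restrict g I" and ?h = "restrict h I" and ?r = "restrict r I"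
  have closed: "?g \<in> carrier (?P)" "?h \<in> carrier (?P)"
    "?r \<in> carrier (?P)" "z \<in> carrier (?P)"
    using ghr ri Cons.prems(1) by auto
  have "?r \<in> conj_differences (?P) zs"
    using Cons.prems(1) closed(3) ghr by (intro Cons.IH) auto
  moreover have "c = (inv\<^bsub>?P\<^esub> ?g \<otimes>\<^bsub>?P\<^esub> z \<otimes>\<^bsub>?P\<^esub> ?g)
      \<otimes>\<^bsub>?P\<^esub> (inv\<^bsub>?P\<^esub> ?h \<otimes>\<^bsub>?P\<^esub>
      inv\<^bsub>?P\<^esub> z \<otimes>\<^bsub>?P\<^esub> ?h) \<otimes>\<^bsub>?P\<^esub> ?r" (is "_ = ?d")
  proof (rule extensionalityI)
    show "c \<in> extensional I" using Cons.prems(2) by (simp add: PiE_iff)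
    show "?d \<in> extensional I" by simp
    fix i assume i: "i \<in> I"
    show "c i = ?d i"
      using closed A i ghr[OF i] by simp
  qed
  ultimately show ?case using P.conj_differences_ConsI[OF closed(1,2), of ?r zs z] by argo
qed

section \<open>The unrestricted product as a free completion\<close>

locale product_setting =
  fixes F :: "('f, 'b) monoid_scheme" and x y :: 'f
    and A :: "nat \<Rightarrow> ('c, 'd) monoid_scheme" and K :: "nat monoid \<Rightarrow> bool"
  assumes free: "free_group_on F {x, y}" and xy: "x \<noteq> y"
    and K_group: "K H \<Longrightarrow> group H" and K_finite: "K H \<Longrightarrow> finite (carrier H)"
    and group_A: "m \<ge> 1 \<Longrightarrow> group (A m)"
    and A_copy: "m \<ge> 1 \<Longrightarrow> \<exists>H \<theta>. K H \<and> \<theta> \<in> iso (A m) H"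
    and K_iso: "K H \<Longrightarrow> \<exists>m\<ge>1. H \<cong> A m"
    and K_residual: "\<lbrakk>w \<in> carrier F; w \<noteq> \<one>\<^bsub>F\<^esub>\<rbrakk> \<Longrightarrow> \<exists>H. K H \<and> (\<exists>\<psi>\<in>hom F H. \<psi> w \<noteq> \<one>\<^bsub>H\<^esub>)"
begin

sublocale F: group F using free by (simp add: free_group_on_def)

abbreviation "J \<equiv> hom_index F A"
abbreviation "Fh \<equiv> hom_product F A"
abbreviation "\<iota> \<equiv> hom_embedding F A"

abbreviation B :: "nat \<times> ('f \<Rightarrow> 'c) \<Rightarrow> ('c, 'd) monoid_scheme" where "B \<equiv> \<lambda>(m, \<phi>). A m"

lemma group_B: "i \<in> J \<Longrightarrow> group (B i)"
  using group_A by (auto simp: hom_index_def)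

lemma group_Fh: "group Fh"
  unfolding hom_product_def using group_B by (rule product_group)

lemma coordinate_hom: "i \<in> J \<Longrightarrow> (\<lambda>s. s i) \<in> hom Fh (B i)"
  by (auto simp: hom_def hom_product_def)

lemma index_hom: "(m, \<phi>) \<in> J \<Longrightarrow> \<phi> \<in> hom F (A m)"
  by (simp add: hom_index_def)

lemma hom_\<iota>: "\<iota> \<in> hom F Fh"
proof (rule homI)
  fix w assume w: "w \<in> carrier F"
  have in_A: "\<phi> w \<in> carrier (A m)" if "(m, \<phi>) \<in> J" for m \<phi>
    using hom_in_carrier[OF index_hom[OF that] w] .
  then show "\<iota> w \<in> carrier Fh"
    by (auto simp: hom_embedding_def hom_product_def)
  fix v assume v: "v \<in> carrier F"
  have "\<phi> (w \<otimes>\<^bsub>F\<^esub> v) = \<phi> w \<otimes>\<^bsub>A m\<^esub> \<phi> v" if "(m, \<phi>) \<in> J" for m \<phi>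
    using hom_mult[OF index_hom[OF that] w v] .
  then show "\<iota> (w \<otimes>\<^bsub>F\<^esub> v) = \<iota> w \<otimes>\<^bsub>Fh\<^esub> \<iota> v"
    by (auto simp: hom_embedding_def hom_product_def intro!: restrict_ext)
qed

lemma extend:
  assumes H: "K H" and psi: "\<psi> \<in> hom F H"
  shows "\<exists>\<sigma>\<in>hom Fh H. \<forall>a\<in>carrier F. \<sigma> (\<iota> a) = \<psi> a"
proof -
  obtain m \<theta> where m: "m \<ge> 1" and th: "\<theta> \<in> iso H (A m)"
    using K_iso[OF H] by (auto simp: is_iso_def)
  \<comment> \<open>Indices are extensional homomorphisms, so the composite is cut off outside the
    carrier.\<close>
  define \<phi> where "\<phi> = restrict (\<theta> \<circ> \<psi>) (carrier F)"
  define \<eta> where "\<eta> = inv_into (carrier H) \<theta>"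
  have eta: "\<eta> \<in> hom (A m) H"
    using group.iso_set_sym[OF K_group[OF H] th] by (simp add: \<eta>_def iso_def)
  have "\<theta> \<circ> \<psi> \<in> hom F (A m)" using Group.hom_compose[OF psi, of \<theta> "A m"] th by (simp add: iso_def)
  then have "\<phi> \<in> hom F (A m)" unfolding \<phi>_def by (auto simp: hom_def)
  then have i: "(m, \<phi>) \<in> J" using m by (simp add: hom_index_def \<phi>_def)
  have "\<eta> \<circ> (\<lambda>s. s (m, \<phi>)) \<in> hom Fh H"
    using coordinate_hom[OF i] eta by (intro Group.hom_compose[where H = "A m"]) auto
  moreover have "(\<eta> \<circ> (\<lambda>s. s (m, \<phi>))) (\<iota> a) = \<psi> a" if "a \<in> carrier F" for a
    using i that hom_in_carrier[OF psi that] th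
    by (simp add: hom_embedding_def \<phi>_def \<eta>_def iso_def bij_betw_def)
  ultimately show ?thesis by blast
qed

text \<open>Which elements of \<open>X\<close> express \<open>a i\<close> may vary with
  \<open>i\<close>, but the list \<open>?zs\<close> does not: in every coordinate the commutator is
  a product of differences along it.\<close>

lemma lifting:
  assumes a: "a \<in> carrier Fh" and u: "u \<in> carrier Fh" and X: "X \<subseteq> carrier Fh" "finite X"
    and hyp: "\<And>H \<sigma>. \<lbrakk>K H; \<sigma> \<in> hom Fh H\<rbrakk> \<Longrightarrow> \<sigma> a \<in> conj_products k (\<sigma> ` X) H"
  shows "a \<otimes>\<^bsub>Fh\<^esub> u \<otimes>\<^bsub>Fh\<^esub> inv\<^bsub>Fh\<^esub> a \<otimes>\<^bsub>Fh\<^esub> inv\<^bsub>Fh\<^esub> u \<in> normal_closure Fh X"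
proof -
  interpret Fh: group Fh by (rule group_Fh)
  obtain xs where xs: "set xs = X" using finite_list[OF X(2)] by blast
  let ?zs = "concat (replicate k xs)"
  let ?c = "a \<otimes>\<^bsub>Fh\<^esub> u \<otimes>\<^bsub>Fh\<^esub> inv\<^bsub>Fh\<^esub> a \<otimes>\<^bsub>Fh\<^esub> inv\<^bsub>Fh\<^esub> u"
  have zs: "set ?zs \<subseteq> X" using xs by (induction k) auto
  have "?c \<in> conj_differences Fh ?zs"
    unfolding hom_product_def
  proof (rule conj_differences_product_group, unfold hom_product_def[symmetric])
    show "group (B i)" if "i \<in> J" for i using group_B[OF that] .
    show "set ?zs \<subseteq> carrier Fh" using zs X(1) by blast
    show "?c \<in> carrier Fh" using a u by simp
    fix i assume i: "i \<in> J"
    interpret \<pi>: group_hom Fh "B i" "\<lambda>s. s i"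
      using coordinate_hom[OF i] group_B[OF i] group_Fh by (simp add: group_hom_def group_hom_axioms_def)
    obtain H \<theta> where H: "K H" and th: "\<theta> \<in> iso (B i) H"
      using A_copy i by (fastforce simp: hom_index_def)
    have "\<theta> \<circ> (\<lambda>s. s i) \<in> hom Fh H"
      using th by (intro Group.hom_compose[OF coordinate_hom[OF i]]) (simp add: iso_def)
    from conj_products_iso_copy[OF group_B[OF i] K_group[OF H] coordinate_hom[OF i] th X(1) a
        hyp[OF H this]]
    have "a i \<in> conj_products k (set (map (\<lambda>s. s i) xs)) (B i)" by (simp add: xs)
    moreover have "set (map (\<lambda>s. s i) xs) \<subseteq> carrier (B i)" using X(1) xs \<pi>.hom_closed by auto
    ultimately have "a i \<otimes>\<^bsub>B i\<^esub> u i \<otimes>\<^bsub>B i\<^esub> inv\<^bsub>B i\<^esub> a i \<otimes>\<^bsub>B i\<^esub> inv\<^bsub>B i\<^esub> u i \<in>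
      conj_differences (B i) (concat (replicate k (map (\<lambda>s. s i) xs)))"
      using \<pi>.hom_closed[OF u] by (intro \<pi>.H.commutator_conj_products)
    moreover have "?c i = a i \<otimes>\<^bsub>B i\<^esub> u i \<otimes>\<^bsub>B i\<^esub> inv\<^bsub>B i\<^esub> a i \<otimes>\<^bsub>B i\<^esub> inv\<^bsub>B i\<^esub> u i"
      using a u \<pi>.hom_mult \<pi>.hom_inv Fh.m_closed Fh.inv_closed by presburger
    ultimately show "?c i \<in> conj_differences (B i) (map (\<lambda>s. s i) ?zs)"
      by (simp add: map_concat)
  qed
  then show ?thesis
    using Fh.conj_differences_subset_normal[OF Fh.normal_closure_normal[OF X(1)]]
      zs Fh.subset_normal_closure[of X] by blast
qed

lemma free_completion: "free_completion F x y Fh \<iota> K"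
  by (rule free_completion.intro;
      fact free xy group_Fh hom_\<iota> K_group K_finite extend K_residual lifting)

end

section \<open>Unitriangular matrices and residual nilpotence of the free group\<close>

text \<open>Upper unitriangular matrices of size \<open>N + 1\<close> over the integers modulo
  \<open>q\<close>, extended by the identity matrix. Entries are representatives in
  \<open>{0..<q}\<close>, and the sum runs over \<open>i..j\<close> because all other terms
  vanish.\<close>

definition unitriangular :: "nat \<Rightarrow> int \<Rightarrow> (nat \<Rightarrow> nat \<Rightarrow> int) monoid" where
  "unitriangular N q =
     \<lparr>carrier = {f. \<forall>i j. if i < j \<and> j \<le> N then f i j \<in> {0..<q} else f i j = (if i = j then 1 else 0)},
      mult = (\<lambda>f g i j. (\<Sum>k=i..j. f i k * g k j) mod q),
      one = (\<lambda>i j. if i = j then 1 else 0)\<rparr>"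

lemma sum_mod_mult_left: "(\<Sum>k\<in>K. (a k mod q) * b k) mod q = (\<Sum>k\<in>K. a k * b k) mod (q :: int)"
proof -
  have "(\<Sum>k\<in>K. (a k mod q) * b k) mod q = (\<Sum>k\<in>K. ((a k mod q) * b k) mod q) mod q"
    by (rule mod_sum_eq[symmetric])
  also have "\<dots> = (\<Sum>k\<in>K. (a k * b k) mod q) mod q" by (simp add: mod_mult_left_eq)
  finally show ?thesis by (simp add: mod_sum_eq)
qed

lemma sum_mod_mult_right: "(\<Sum>k\<in>K. a k * (b k mod q)) mod q = (\<Sum>k\<in>K. a k * b k) mod (q :: int)"
  using sum_mod_mult_left[of b q a K] by (simp add: mult.commute)

locale unitriangular_group =
  fixes N :: nat and q :: int
  assumes q: "q \<ge> 2"
begin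

abbreviation "U \<equiv> unitriangular N q"

lemma U_mult: "(f \<otimes>\<^bsub>U\<^esub> g) i j = (\<Sum>k=i..j. f i k * g k j) mod q"
  and U_one: "\<one>\<^bsub>U\<^esub> i j = (if i = j then 1 else 0)"
  by (simp_all add: unitriangular_def)

lemma U_entry:
  assumes "f \<in> carrier U"
  shows "i > j \<Longrightarrow> f i j = 0" and "f i i = 1" and "j > N \<Longrightarrow> i \<noteq> j \<Longrightarrow> f i j = 0"
    and "i < j \<Longrightarrow> j \<le> N \<Longrightarrow> 0 \<le> f i j \<and> f i j < q"
  using assms by (auto simp: unitriangular_def dest: spec[of _ i] split: if_splits)

lemma U_mod:
  assumes f: "f \<in> carrier U" shows "f i j mod q = f i j"
proof (cases "i < j \<and> j \<le> N")
  case True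
  then show ?thesis using U_entry(4)[OF f, of i j] by simp
next
  case False
  then show ?thesis
    using U_entry(1-3)[OF f] q by (cases i j rule: linorder_cases) auto
qed

lemma U_I:
  assumes "\<And>i. f i i = 1" "\<And>i j. i > j \<Longrightarrow> f i j = 0" "\<And>i j. i < j \<Longrightarrow> j > N \<Longrightarrow> f i j = 0"
    "\<And>i j. i < j \<Longrightarrow> j \<le> N \<Longrightarrow> 0 \<le> f i j \<and> f i j < q"
  shows "f \<in> carrier U"
proof -
  have "if i < j \<and> j \<le> N then f i j \<in> {0..<q} else f i j = (if i = j then 1 else 0)" for i j
    using assms by (cases i j rule: linorder_cases) auto
  then show ?thesis unfolding unitriangular_def partial_object.select_convs by blast
qed

lemma finite_U: "finite (carrier U)"
proof (rule finite_subset)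
  let ?h = "\<lambda>h i j. if i < j \<and> j \<le> N then h (i, j) else if i = j then 1 else (0 :: int)"
  show "carrier U \<subseteq> ?h ` (PiE ({0..N} \<times> {0..N}) (\<lambda>_. {0..<q}))"
  proof
    fix f assume f: "f \<in> carrier U"
    show "f \<in> ?h ` (PiE ({0..N} \<times> {0..N}) (\<lambda>_. {0..<q}))"
    proof (rule image_eqI)
      let ?r = "\<lambda>p\<in>{0..N} \<times> {0..N}. f (fst p) (snd p) mod q"
      show "?r \<in> PiE ({0..N} \<times> {0..N}) (\<lambda>_. {0..<q})" using q by auto
      show "f = ?h ?r"
        using U_entry(1-3)[OF f] by (auto simp: fun_eq_iff U_mod[OF f] not_less nat_less_le)
    qed
  qed
  show "finite (?h ` (PiE ({0..N} \<times> {0..N}) (\<lambda>_. {0..<q})))"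
    by (intro finite_imageI finite_PiE) auto
qed

lemma U_closed:
  assumes f: "f \<in> carrier U" and g: "g \<in> carrier U"
  shows "f \<otimes>\<^bsub>U\<^esub> g \<in> carrier U"
proof (rule U_I)
  show "(f \<otimes>\<^bsub>U\<^esub> g) i i = 1" for i
    using q by (simp add: U_mult U_entry(2)[OF f] U_entry(2)[OF g])
  show "(f \<otimes>\<^bsub>U\<^esub> g) i j = 0" if "i < j" "j > N" for i j
  proof -
    have "(\<Sum>k=i..j. f i k * g k j) = 0"
    proof (rule sum.neutral, clarify)
      fix k assume "k \<in> {i..j}"
      show "f i k * g k j = 0"
        using U_entry(3)[OF f, of j i] U_entry(3)[OF g, of j k] that by (cases "k = j") auto
    qed
    then show ?thesis by (simp add: U_mult)
  qed
qed (use q in \<open>auto simp: U_mult\<close>)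

lemma U_assoc:
  assumes f: "f \<in> carrier U" and g: "g \<in> carrier U" and h: "h \<in> carrier U"
  shows "f \<otimes>\<^bsub>U\<^esub> g \<otimes>\<^bsub>U\<^esub> h = f \<otimes>\<^bsub>U\<^esub> (g \<otimes>\<^bsub>U\<^esub> h)"
proof (intro ext)
  fix i j
  have 1: "(\<Sum>l=i..k. f i l * g l k) = (\<Sum>l=i..j. f i l * g l k)" if "k \<in> {i..j}" for k
    using that U_entry(1)[OF g] by (intro sum.mono_neutral_left) auto
  have 2: "(\<Sum>k=l..j. g l k * h k j) = (\<Sum>k=i..j. g l k * h k j)" if "l \<in> {i..j}" for l
    using that U_entry(1)[OF g] by (intro sum.mono_neutral_left) auto
  have "(f \<otimes>\<^bsub>U\<^esub> g \<otimes>\<^bsub>U\<^esub> h) i j = (\<Sum>k=i..j. (\<Sum>l=i..k. f i l * g l k) * h k j) mod q"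
    by (simp add: U_mult sum_mod_mult_left)
  also have "(\<Sum>k=i..j. (\<Sum>l=i..k. f i l * g l k) * h k j) =
      (\<Sum>k=i..j. \<Sum>l=i..j. f i l * (g l k * h k j))"
    by (intro sum.cong refl) (simp add: 1 sum_distrib_right mult.assoc)
  also have "\<dots> = (\<Sum>l=i..j. \<Sum>k=i..j. f i l * (g l k * h k j))" by (rule sum.swap)
  also have "\<dots> = (\<Sum>l=i..j. f i l * (\<Sum>k=l..j. g l k * h k j))"
    by (intro sum.cong refl) (simp add: 2 sum_distrib_left)
  also have "\<dots> mod q = (f \<otimes>\<^bsub>U\<^esub> (g \<otimes>\<^bsub>U\<^esub> h)) i j"
    by (simp add: U_mult sum_mod_mult_right)
  finally show "(f \<otimes>\<^bsub>U\<^esub> g \<otimes>\<^bsub>U\<^esub> h) i j = (f \<otimes>\<^bsub>U\<^esub> (g \<otimes>\<^bsub>U\<^esub> h)) i j" .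
qed

lemma U_mult_last:
  assumes "f \<in> carrier U" "i < j"
  shows "(g \<otimes>\<^bsub>U\<^esub> f) i j = ((\<Sum>k=i..<j. g i k * f k j) + g i j) mod q"
proof -
  have "{i..j} = insert j {i..<j}" using assms(2) by auto
  then show ?thesis using U_entry(2)[OF assms(1), of j] by (simp add: U_mult add.commute)
qed

lemma mod_add_cancel_range:
  assumes "(s + a) mod q = (s + b) mod q" "0 \<le> a" "a < q" "0 \<le> b" "b < q"
  shows "a = b"
proof -
  have "(s + a - s) mod q = (s + b - s) mod q" using assms(1) by (rule mod_diff_cong) simp
  then show ?thesis using assms by simp
qed

text \<open>Column by column: \<open>g i j\<close> enters the product entry with coefficient
  \<open>1\<close>, and everything else there involves earlier columns of \<open>g\<close>.\<close>

lemma U_right_cancel: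
  assumes f: "f \<in> carrier U" and g: "g \<in> carrier U" "g' \<in> carrier U"
    and eq: "g \<otimes>\<^bsub>U\<^esub> f = g' \<otimes>\<^bsub>U\<^esub> f"
  shows "g = g'"
proof (intro ext)
  fix i j
  show "g i j = g' i j"
  proof (induction j rule: less_induct)
    case (less j)
    show ?case
    proof (cases "i < j \<and> j \<le> N")
      case True
      have "(\<Sum>k=i..<j. g i k * f k j) = (\<Sum>k=i..<j. g' i k * f k j)"
        using less by (intro sum.cong) auto
      then have "((\<Sum>k=i..<j. g i k * f k j) + g i j) mod q = ((\<Sum>k=i..<j. g i k * f k j) + g' i j) mod q"
        using U_mult_last[OF f conjunct1[OF True], of g] U_mult_last[OF f conjunct1[OF True], of g'] eq
        by argo
      from mod_add_cancel_range[OF this] show ?thesis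
        using U_entry(4)[OF g(1), of i j] U_entry(4)[OF g(2), of i j] True by simp
    next
      case False
      then show ?thesis
        using U_entry(1-3)[OF g(1)] U_entry(1-3)[OF g(2)] by (cases i j rule: linorder_cases) auto
    qed
  qed
qed

lemma group_U: "group U"
proof (rule groupI)
  show one: "\<one>\<^bsub>U\<^esub> \<in> carrier U" using q by (intro U_I) (auto simp: U_one)
  show one_mult: "\<one>\<^bsub>U\<^esub> \<otimes>\<^bsub>U\<^esub> f = f" if f: "f \<in> carrier U" for f
  proof (intro ext)
    fix i j
    have "(\<Sum>k=i..j. \<one>\<^bsub>U\<^esub> i k * f k j) = (\<Sum>k=i..j. if k = i then f k j else 0)"
      by (intro sum.cong) (auto simp: U_one)
    also have "\<dots> = f i j" using U_entry(1)[OF f, of j i] by (simp add: sum.delta)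
    finally show "(\<one>\<^bsub>U\<^esub> \<otimes>\<^bsub>U\<^esub> f) i j = f i j" by (simp add: U_mult U_mod[OF f])
  qed
  show "\<exists>g\<in>carrier U. g \<otimes>\<^bsub>U\<^esub> f = \<one>\<^bsub>U\<^esub>" if f: "f \<in> carrier U" for f
  proof -
    \<comment> \<open>Inverses come from finiteness: an injective right multiplication is
      onto.\<close>
    have "(\<lambda>g. g \<otimes>\<^bsub>U\<^esub> f) ` carrier U = carrier U"
      using f U_closed U_right_cancel[OF f]
      by (intro endo_inj_surj[OF finite_U]) (auto simp: inj_on_def)
    then show ?thesis using one by (metis imageE)
  qed
qed (use U_closed U_assoc in auto)

sublocale U: group U by (rule group_U)

section \<open>The central filtration of the unitriangular group\<close>

text \<open>The first \<open>n\<close> superdiagonals vanish.\<close>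

definition level :: "nat \<Rightarrow> (nat \<Rightarrow> nat \<Rightarrow> int) set" where
  "level n = {f \<in> carrier U. \<forall>i j. i < j \<and> j \<le> i + n \<longrightarrow> f i j = 0}"

text \<open>A test for a quotient such as a commutator or an inverse that avoids computing inverse
  matrices: only the products \<open>c d\<close> and \<open>d\<close> are compared near the
  diagonal.\<close>

lemma level_of_quotient:
  assumes c: "c \<in> carrier U" and d: "d \<in> carrier U"
    and eq: "\<And>i j. i < j \<Longrightarrow> j \<le> i + n \<Longrightarrow> (c \<otimes>\<^bsub>U\<^esub> d) i j = d i j"
  shows "c \<in> level n"
proof -
  have "c i j = 0" if "i < j" "j \<le> i + n" for i j
    using that
  proof (induction j rule: less_induct)
    case (less j)
    show ?case
    proof (cases "j \<le> N")
      case True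
      have "(\<Sum>k=i..<j. c i k * d k j) = (\<Sum>k=i..<j. if k = i then d k j else 0)"
        using less U_entry(2)[OF c, of i] by (intro sum.cong) auto
      also have "\<dots> = d i j" using less.prems by (simp add: sum.delta)
      finally have "(d i j + c i j) mod q = (d i j + 0) mod q"
        using eq[OF less.prems] U_mult_last[OF d less.prems(1), of c] U_mod[OF d, of i j] by simp
      then show ?thesis
        using mod_add_cancel_range[of "d i j" "c i j" 0] U_entry(4)[OF c less.prems(1) True] q by simp
    next
      case False
      then show ?thesis using U_entry(3)[OF c, of j i] less.prems by simp
    qed
  qed
  then show ?thesis using c by (simp add: level_def)
qed

lemma subgroup_level: "subgroup (level n) U"
proof (rule U.subgroupI)
  show "level n \<subseteq> carrier U" by (auto simp: level_def)
  have "\<one>\<^bsub>U\<^esub> \<in> level n" by (auto simp: level_def U_one)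
  then show "level n \<noteq> {}" by blast
  show "inv\<^bsub>U\<^esub> f \<in> level n" if "f \<in> level n" for f
    using that by (intro level_of_quotient[of _ f]) (auto simp: level_def U_one)
  show "f \<otimes>\<^bsub>U\<^esub> g \<in> level n" if f: "f \<in> level n" and g: "g \<in> level n" for f g
  proof -
    have "(\<Sum>k=i..j. f i k * g k j) = 0" if ij: "i < j" "j \<le> i + n" for i j
    proof (rule sum.neutral, clarify)
      fix k assume k: "k \<in> {i..j}"
      show "f i k * g k j = 0"
        using f g ij k by (cases "k = i") (auto simp: level_def)
    qed
    then show ?thesis using f g U_closed by (auto simp: level_def U_mult)
  qed
qed

text \<open>To first order multiplication is addition: if one factor is in \<open>level n\<close>,
  then up to the next superdiagonal entries add, in either order. Hence a commutator with such an
  element climbs one level.\<close>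

lemma level_mult:
  assumes a: "a \<in> level n" and b: "b \<in> carrier U" and ij: "i < j" "j \<le> i + Suc n"
  shows "(a \<otimes>\<^bsub>U\<^esub> b) i j = (a i j + b i j) mod q" and "(b \<otimes>\<^bsub>U\<^esub> a) i j = (a i j + b i j) mod q"
proof -
  have aU: "a \<in> carrier U" using a by (simp add: level_def)
  have "(\<Sum>k=i..<j. a i k * b k j) = (\<Sum>k=i..<j. if k = i then b k j else 0)"
    using a ij U_entry(2)[OF aU, of i] by (intro sum.cong) (auto simp: level_def)
  then show "(a \<otimes>\<^bsub>U\<^esub> b) i j = (a i j + b i j) mod q"
    using U_mult_last[OF b ij(1), of a] ij by (simp add: sum.delta add.commute)
  have "(\<Sum>k=i..<j. b i k * a k j) = (\<Sum>k=i..<j. if k = i then a k j else 0)"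
    using a ij U_entry(2)[OF b, of i] by (intro sum.cong) (auto simp: level_def)
  then show "(b \<otimes>\<^bsub>U\<^esub> a) i j = (a i j + b i j) mod q"
    using U_mult_last[OF aU ij(1), of b] ij by (simp add: sum.delta)
qed

lemma lower_central_subset_level: "lower_central U n \<subseteq> level n"
proof (induction n)
  case 0
  then show ?case by (auto simp: level_def)
next
  case (Suc n)
  have "{a \<otimes>\<^bsub>U\<^esub> b \<otimes>\<^bsub>U\<^esub> inv\<^bsub>U\<^esub> a \<otimes>\<^bsub>U\<^esub> inv\<^bsub>U\<^esub> b | a b. a \<in> lower_central U n \<and> b \<in> carrier U} \<subseteq> level (Suc n)"
  proof clarify
    fix a b assume "a \<in> lower_central U n" and b: "b \<in> carrier U"
    then have a: "a \<in> level n" "a \<in> carrier U" using Suc by (auto simp: level_def)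
    \<comment> \<open>The commutator is the quotient of \<open>a b\<close> by \<open>b a\<close>,
      and these two products agree up to superdiagonal \<open>n + 1\<close>.\<close>
    have "a \<otimes>\<^bsub>U\<^esub> b \<otimes>\<^bsub>U\<^esub> inv\<^bsub>U\<^esub> a \<otimes>\<^bsub>U\<^esub> inv\<^bsub>U\<^esub> b = (a \<otimes>\<^bsub>U\<^esub> b) \<otimes>\<^bsub>U\<^esub> inv\<^bsub>U\<^esub> (b \<otimes>\<^bsub>U\<^esub> a)"
      using a b by (simp add: U.m_assoc U.inv_mult_group)
    then have eq: "a \<otimes>\<^bsub>U\<^esub> b \<otimes>\<^bsub>U\<^esub> inv\<^bsub>U\<^esub> a \<otimes>\<^bsub>U\<^esub> inv\<^bsub>U\<^esub> b \<otimes>\<^bsub>U\<^esub> (b \<otimes>\<^bsub>U\<^esub> a) = a \<otimes>\<^bsub>U\<^esub> b"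
      using U.inv_solve_right[of "a \<otimes>\<^bsub>U\<^esub> b \<otimes>\<^bsub>U\<^esub> inv\<^bsub>U\<^esub> a \<otimes>\<^bsub>U\<^esub> inv\<^bsub>U\<^esub> b" "a \<otimes>\<^bsub>U\<^esub> b" "b \<otimes>\<^bsub>U\<^esub> a"] a b
      by simp
    show "a \<otimes>\<^bsub>U\<^esub> b \<otimes>\<^bsub>U\<^esub> inv\<^bsub>U\<^esub> a \<otimes>\<^bsub>U\<^esub> inv\<^bsub>U\<^esub> b \<in> level (Suc n)"
      by (rule level_of_quotient[of _ "b \<otimes>\<^bsub>U\<^esub> a"])
        (use a b level_mult[OF a(1) b] in \<open>simp_all add: eq\<close>)
  qed
  then show ?case
    using U.generate_subgroup_incl[OF _ subgroup_level] by simp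
qed

lemma fin_nilpotent_U: "fin_nilpotent U"
proof -
  have "level N \<subseteq> {\<one>\<^bsub>U\<^esub>}"
  proof
    fix f assume f: "f \<in> level N"
    then have fU: "f \<in> carrier U" by (simp add: level_def)
    have "f i j = \<one>\<^bsub>U\<^esub> i j" for i j
      using f U_entry(1-3)[OF fU]
      by (cases i j rule: linorder_cases; cases "j \<le> N") (auto simp: level_def U_one)
    then show "f \<in> {\<one>\<^bsub>U\<^esub>}" by auto
  qed
  moreover have "\<one>\<^bsub>U\<^esub> \<in> lower_central U N" by (cases N) (use U.one_closed in \<open>auto intro: generate.one\<close>)
  ultimately show ?thesis
    unfolding fin_nilpotent_def using group_U finite_U lower_central_subset_level[of N] by blast
qed

section \<open>Matrix images of words and residual nilpotence\<close>

definition elementary :: "(nat \<Rightarrow> bool) \<Rightarrow> nat \<Rightarrow> nat \<Rightarrow> int" where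
  "elementary P i j = (if i = j then 1 else if j = Suc i \<and> j \<le> N \<and> P i then 1 else 0)"

lemma elementary_closed: "elementary P \<in> carrier U"
  using q by (intro U_I) (auto simp: elementary_def)

lemma mult_elementary:
  assumes "f \<in> carrier U" "Suc j \<le> N"
  shows "(f \<otimes>\<^bsub>U\<^esub> elementary P) 0 (Suc j) = (f 0 (Suc j) + (if P j then f 0 j else 0)) mod q"
    and "(f \<otimes>\<^bsub>U\<^esub> elementary P) 0 0 = 1"
proof -
  have "(\<Sum>k=0..<Suc j. f 0 k * elementary P k (Suc j)) = (\<Sum>k=0..<Suc j. if k = j then (if P j then f 0 j else 0) else 0)"
    using assms(2) by (intro sum.cong) (auto simp: elementary_def)
  then show "(f \<otimes>\<^bsub>U\<^esub> elementary P) 0 (Suc j) = (f 0 (Suc j) + (if P j then f 0 j else 0)) mod q"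
    using U_mult_last[OF elementary_closed, of 0 "Suc j" f P] by (simp add: sum.delta add.commute)
  show "(f \<otimes>\<^bsub>U\<^esub> elementary P) 0 0 = 1"
    using U_entry(2)[OF U_closed[OF assms(1) elementary_closed]] by blast
qed

end

text \<open>The top row of the product of the elementary matrices (or inverses) attached to the letters
  of a word, over the integers. A letter \<open>s\<close> contributes the entries \<open>(i, i + 1)\<close> with \<open>P s i\<close>.\<close>

fun row_step :: "('a \<Rightarrow> nat \<Rightarrow> bool) \<Rightarrow> 'a \<times> bool \<Rightarrow> (nat \<Rightarrow> int) \<Rightarrow> nat \<Rightarrow> int" where
  "row_step P (s, e) v 0 = v 0"
| "row_step P (s, e) v (Suc j) = v (Suc j) + (if P s j then (if e then v j else - v j) else 0)"

definition row :: "('a \<Rightarrow> nat \<Rightarrow> bool) \<Rightarrow> ('a \<times> bool) list \<Rightarrow> nat \<Rightarrow> int" where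
  "row P w = foldl (\<lambda>v l. row_step P l v) (\<lambda>j. if j = 0 then 1 else 0) w"

lemma row_simps: "row P [] j = (if j = 0 then 1 else 0)" "row P (w @ [l]) = row_step P l (row P w)"
  by (simp_all add: row_def)

lemma reduced_word_snocD:
  assumes "reduced_word (w @ [l])"
  shows "reduced_word w" and "w \<noteq> [] \<Longrightarrow> fst (last w) = fst l \<Longrightarrow> snd (last w) = snd l"
proof -
  show "reduced_word w" using assms unfolding reduced_word_def by (metis append.assoc)
  assume w: "w \<noteq> []" "fst (last w) = fst l"
  show "snd (last w) = snd l"
  proof (rule ccontr)
    assume "snd (last w) \<noteq> snd l"
    then have "l = (fst l, \<not> snd (last w))" and "last w = (fst l, snd (last w))"
      using w(2) by (auto simp: prod_eq_iff)
    moreover have "w @ [l] = butlast w @ [last w, l] @ []"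
      using append_butlast_last_id[OF w(1)] by simp
    ultimately have "w @ [l] = butlast w @ [(fst l, snd (last w)), (fst l, \<not> snd (last w))] @ []"
      by argo
    then show False using assms unfolding reduced_word_def by blast
  qed
qed

text \<open>The syllables of a reduced word cross the superdiagonal positions one after the other: with
  \<open>t\<close> the number of completed syllables, the entry \<open>t + 1\<close> is the exponent \<open>m\<close> of the current
  syllable times the entry \<open>t\<close>.\<close>

lemma row_reduced_word:
  assumes P: "\<And>s j. s \<in> {x, y} \<Longrightarrow> P s j \<longleftrightarrow> (if even j then s = s0 else s \<noteq> s0)"
    and s0: "s0 \<in> {x, y}"
    and w: "fst ` set w \<subseteq> {x, y}" "reduced_word w" "w \<noteq> []" "fst (hd w) = s0"
  shows "\<exists>t m. Suc t \<le> length w \<and> m \<noteq> 0 \<and> row P w (Suc t) = m * row P w t \<and> row P w t \<noteq> 0 \<and>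
    (\<forall>j>Suc t. row P w j = 0) \<and> P (fst (last w)) t \<and> (m > 0 \<longleftrightarrow> snd (last w))"
  using w
proof (induction w rule: rev_induct)
  case (snoc l w)
  obtain s e where l: "l = (s, e)" by (cases l)
  have s: "s \<in> {x, y}" using snoc.prems by (simp add: l)
  show ?case
  proof (cases "w = []")
    case True
    then have "s = s0" using snoc.prems by (simp add: l)
    then have "P s 0" using P[OF s, of 0] by simp
    moreover have "row P [(s, e)] = row_step P (s, e) (row P [])" using row_simps(2)[of P "[]"] by simp
    moreover have "row_step P (s, e) (row P []) j = 0" if j: "j > Suc 0" for j
    proof -
      obtain i where "j = Suc i" "i > 0" using j by (cases j) auto
      then show ?thesis by (simp add: row_simps)
    qed
    ultimately show ?thesis
      using True by (intro exI[of _ 0] exI[of _ "if e then 1 else -1"]) (auto simp: l row_simps)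
  next
    case False
    have red: "reduced_word w" "fst (last w) = s \<Longrightarrow> snd (last w) = e"
      using reduced_word_snocD[OF snoc.prems(2)] False by (auto simp: l)
    obtain t m where tm: "Suc t \<le> length w" "m \<noteq> 0" "row P w (Suc t) = m * row P w t" "row P w t \<noteq> 0"
      "\<forall>j>Suc t. row P w j = 0" "P (fst (last w)) t" "m > 0 \<longleftrightarrow> snd (last w)"
      using snoc.IH red(1) snoc.prems False by (auto simp: hd_append)
    have last: "fst (last w) \<in> {x, y}" using imageI[OF last_in_set[OF False], of fst] snoc.prems(1) by auto
    have row: "row P (w @ [(s, e)]) = row_step P (s, e) (row P w)" by (simp add: row_simps)
    have alt: "P s (Suc j) \<longleftrightarrow> \<not> P s j" for j using P[OF s] by simp
    show ?thesis
    proof (cases "P s t")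
      case True
      \<comment> \<open>The letter continues the current syllable. Reducedness gives it the same
        sign, so \<open>m\<close> moves away from \<open>0\<close>.\<close>
      then have same: "fst (last w) = s"
        using tm(6) P[OF s, of t] P[OF last, of t] s last s0 by (auto split: if_splits)
      then have e: "snd (last w) = e" by (rule red(2))
      have "row_step P (s, e) (row P w) t = row P w t"
        using True alt by (cases t) auto
      moreover have "row_step P (s, e) (row P w) (Suc t) = (m + (if e then 1 else -1)) * row P w t"
        using True tm(3) by (simp add: algebra_simps)
      moreover have "row_step P (s, e) (row P w) j = 0" if j: "j > Suc t" for j
      proof -
        obtain i where i: "j = Suc i" "i \<ge> Suc t" using j by (cases j) auto
        then show ?thesis using tm(5) True alt[of t] by (cases "i = Suc t") auto
      qed
      ultimately show ?thesis
        using tm(1,2,4,6,7) e same True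
        by (intro exI[of _ t] exI[of _ "m + (if e then 1 else -1)"]) (auto simp: row l simp del: row_step.simps)
    next
      case False
      \<comment> \<open>A new syllable starts, with exponent \<open>1\<close> or \<open>-1\<close>,
        and crosses the next position; the old entry \<open>t + 1\<close> is nonzero and stays
        unchanged.\<close>
      then have next_P: "P s (Suc t)" using alt by simp
      have "row_step P (s, e) (row P w) (Suc t) = row P w (Suc t)" using False by simp
      moreover have "row_step P (s, e) (row P w) (Suc (Suc t)) = (if e then 1 else -1) * row P w (Suc t)"
        using next_P tm(5) by simp
      moreover have "row_step P (s, e) (row P w) j = 0" if "j > Suc (Suc t)" for j
        using that tm(5) by (cases j) auto
      ultimately show ?thesis
        using tm(1-4) next_P
        by (intro exI[of _ "Suc t"] exI[of _ "if e then 1 else -1"]) (auto simp: row l simp del: row_step.simps)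
    qed
  qed
qed simp

text \<open>Inverse letters are handled by solving for the new row instead of inverting the matrix.
  By \<open>alt\<close> a letter never uses two adjacent positions, so one subtraction suffices, as
  in \<open>row_step\<close>.\<close>

lemma (in unitriangular_group) row_cong:
  assumes F: "group F" and psi: "\<psi> \<in> hom F U" and S: "S \<subseteq> carrier F"
    and gens: "\<And>s. s \<in> S \<Longrightarrow> \<psi> s = elementary (P s)"
    and alt: "\<And>s j. s \<in> S \<Longrightarrow> P s j \<Longrightarrow> \<not> P s (Suc j)"
    and w: "fst ` set w \<subseteq> S" and "j \<le> N"
  shows "\<psi> (word_value F w) 0 j mod q = row P w j mod q"
  using w \<open>j \<le> N\<close>
proof (induction w arbitrary: j rule: rev_induct)
  case Nil
  interpret group_hom F U \<psi> using F psi group_U by (simp add: group_hom_def group_hom_axioms_def)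
  show ?case by (simp add: row_simps U_one)
next
  case (snoc l w)
  interpret h: group_hom F U \<psi> using F psi group_U by (simp add: group_hom_def group_hom_axioms_def)
  obtain s e where l: "l = (s, e)" by (cases l)
  have s: "s \<in> S" "s \<in> carrier F" using snoc.prems S by (auto simp: l)
  have wF: "fst ` set w \<subseteq> carrier F" "word_value F w \<in> carrier F"
    using snoc.prems S by (auto intro!: h.G.word_value_closed)
  let ?f = "\<psi> (word_value F w)" and ?g = "\<psi> (word_value F (w @ [l]))" and ?E = "elementary (P s)"
  have fU: "?f \<in> carrier U" using wF by simp
  have IH: "?f 0 j mod q = row P w j mod q" if "j \<le> N" for j using snoc that by simp
  have "word_value F (w @ [l]) = word_value F w \<otimes>\<^bsub>F\<^esub> letter F l"
    using wF s by (subst h.G.word_value_append) (auto simp: l letter_def)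
  then have g: "?g = ?f \<otimes>\<^bsub>U\<^esub> (if e then ?E else inv\<^bsub>U\<^esub> ?E)"
    using wF s gens[OF s(1)] by (simp add: l letter_def)
  have gU: "?g \<in> carrier U" unfolding g using fU elementary_closed by simp
  show ?case
  proof (cases j)
    case 0
    then show ?thesis using U_entry(2)[OF fU, of 0] U_entry(2)[OF gU, of 0] IH[of 0] by (simp add: row_simps l)
  next
    case (Suc i)
    show ?thesis
    proof (cases e)
      case True
      have "?g 0 (Suc i) mod q = (?f 0 (Suc i) + (if P s i then ?f 0 i else 0)) mod q"
        using mult_elementary(1)[OF fU, of i] Suc snoc.prems True by (simp add: g)
      also have "\<dots> = (row P w (Suc i) + (if P s i then row P w i else 0)) mod q"
        using IH[of i] IH[of "Suc i"] Suc snoc.prems by (intro mod_add_cong) auto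
      finally show ?thesis using True Suc by (simp add: row_simps l)
    next
      case False
      have f: "?f = ?g \<otimes>\<^bsub>U\<^esub> ?E"
        using False fU elementary_closed[of "P s"] by (simp add: g U.m_assoc)
      have rec: "?f 0 (Suc k) = (?g 0 (Suc k) + (if P s k then ?g 0 k else 0)) mod q" if "Suc k \<le> N" for k
        using mult_elementary(1)[OF gU that, of "P s"] f by simp
      \<comment> \<open>If position \<open>i\<close> belongs to \<open>s\<close>, the one before it
        does not, so the entry \<open>i\<close> is unaffected by this letter.\<close>
      have prev: "?g 0 i mod q = ?f 0 i mod q" if "P s i"
      proof (cases i)
        case 0
        then show ?thesis using U_entry(2)[OF fU, of 0] U_entry(2)[OF gU, of 0] by simp
      next
        case (Suc k)
        then show ?thesis
          using rec[of k] alt[OF s(1), of k] that \<open>j = Suc i\<close> snoc.prems by auto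
      qed
      have "?g 0 (Suc i) mod q = (?g 0 (Suc i) + (if P s i then ?g 0 i else 0) - (if P s i then ?g 0 i else 0)) mod q"
        by simp
      also have "\<dots> = (?f 0 (Suc i) - (if P s i then ?f 0 i else 0)) mod q"
        using rec[of i] prev Suc snoc.prems by (intro mod_diff_cong) auto
      also have "\<dots> = (row P w (Suc i) - (if P s i then row P w i else 0)) mod q"
        using IH[of i] IH[of "Suc i"] Suc snoc.prems by (intro mod_diff_cong) auto
      finally show ?thesis using False Suc by (simp add: row_simps l)
    qed
  qed
qed

text \<open>The integer row of a reduced word has a nonzero entry away from the diagonal; matrix
  size and modulus are then adapted to the word.\<close>

lemma free_group_residually_nilpotent:
  assumes F: "free_group_on F {x, y}" and a: "a \<in> carrier F" "a \<noteq> \<one>\<^bsub>F\<^esub>"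
  shows "\<exists>N q \<psi>. fin_nilpotent (unitriangular N q) \<and> \<psi> \<in> hom F (unitriangular N q) \<and>
    \<psi> a \<noteq> \<one>\<^bsub>unitriangular N q\<^esub>"
proof -
  have group_F: "group F" and S: "{x, y} \<subseteq> carrier F" using F by (auto simp: free_group_on_def)
  obtain w where w: "fst ` set w \<subseteq> {x, y}" "reduced_word w" "word_value F w = a"
    using free_group_reduced_word[OF F a(1)] by blast
  have "w \<noteq> []" using w(3) a(2) by auto
  define s0 where "s0 = fst (hd w)"
  have s0: "s0 \<in> {x, y}" using w(1) imageI[OF hd_in_set[OF \<open>w \<noteq> []\<close>], of fst] by (auto simp: s0_def)
  \<comment> \<open>Superdiagonal positions alternate between the first letter of the word and the
    other generator, as the syllables of a reduced word do.\<close>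
  define P where "P s j \<longleftrightarrow> (if even j then s = s0 else s \<noteq> s0)" for s :: 'a and j :: nat
  obtain t m where t: "Suc t \<le> length w" "m \<noteq> 0" "row P w (Suc t) = m * row P w t" "row P w t \<noteq> 0"
    using row_reduced_word[of x y P s0, OF P_def s0 w(1,2) \<open>w \<noteq> []\<close>] s0_def by blast
  define r where "r = row P w (Suc t)"
  have "r \<noteq> 0" using t by (simp add: r_def)
  \<comment> \<open>Larger than the absolute value of \<open>r\<close>, so that \<open>r\<close>
    survives reduction, and at least \<open>2\<close>.\<close>
  define q where "q = \<bar>r\<bar> + 2"
  interpret unitriangular_group "length w" q by unfold_locales (simp add: q_def)
  have "(\<lambda>s. elementary (P s)) \<in> {x, y} \<rightarrow> carrier U" using elementary_closed by auto
  from free_group_hom_exists[OF F group_U this]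
  obtain \<psi> where psi: "\<psi> \<in> hom F U" "\<And>s. s \<in> {x, y} \<Longrightarrow> \<psi> s = elementary (P s)" by blast
  have "\<psi> (word_value F w) 0 (Suc t) mod q = r mod q"
    unfolding r_def
    by (rule row_cong[OF group_F psi(1) S psi(2) _ w(1) t(1)]) (auto simp: P_def)
  moreover have "r mod q \<noteq> 0"
  proof
    assume "r mod q = 0"
    then have "q dvd r" by auto
    then show False using dvd_imp_le_int[OF \<open>r \<noteq> 0\<close>, of q] by (simp add: q_def)
  qed
  ultimately have "\<psi> a \<noteq> \<one>\<^bsub>U\<^esub>" using w(3) U_one[of 0 "Suc t"] by auto
  then show ?thesis using fin_nilpotent_U psi(1) by blast
qed

section \<open>The five classes\<close>

lemma (in group) lower_central_subset: "lower_central G n \<subseteq> carrier G"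
proof (induction n)
  case (Suc n)
  then show ?case by (auto intro!: generate_incl)
qed simp

lemma (in group) one_in_lower_central: "\<one> \<in> lower_central G n"
  by (cases n) (auto intro: generate.one)

lemma (in group) lower_central_antimono:
  assumes "m \<le> n" shows "lower_central G n \<subseteq> lower_central G m"
proof -
  have "lower_central G (Suc k) \<subseteq> lower_central G k" for k
  proof (induction k)
    case 0
    then show ?case using lower_central_subset[of "Suc 0"] by simp
  next
    case (Suc k)
    show ?case
      unfolding lower_central.simps(2)[of G "Suc k"] lower_central.simps(2)[of G k]
      by (rule mono_generate) (use Suc in auto)
  qed
  then show ?thesis using assms by (rule lift_Suc_antimono_le[of "lower_central G"])
qed

lemma (in group_hom) lower_central_image: "h ` lower_central G n \<subseteq> lower_central H n"
proof (induction n)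
  case (Suc n)
  let ?C = "{a \<otimes>\<^bsub>G\<^esub> b \<otimes>\<^bsub>G\<^esub> inv\<^bsub>G\<^esub> a \<otimes>\<^bsub>G\<^esub> inv\<^bsub>G\<^esub> b | a b. a \<in> lower_central G n \<and> b \<in> carrier G}"
  let ?D = "{a \<otimes>\<^bsub>H\<^esub> b \<otimes>\<^bsub>H\<^esub> inv\<^bsub>H\<^esub> a \<otimes>\<^bsub>H\<^esub> inv\<^bsub>H\<^esub> b | a b. a \<in> lower_central H n \<and> b \<in> carrier H}"
  have sub: "lower_central G n \<subseteq> carrier G" by (rule G.lower_central_subset)
  then have C: "?C \<subseteq> carrier G" by auto
  have "h ` ?C \<subseteq> ?D"
  proof clarify
    fix a b assume ab: "a \<in> lower_central G n" "b \<in> carrier G"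
    then have "h (a \<otimes>\<^bsub>G\<^esub> b \<otimes>\<^bsub>G\<^esub> inv\<^bsub>G\<^esub> a \<otimes>\<^bsub>G\<^esub> inv\<^bsub>G\<^esub> b) =
        h a \<otimes>\<^bsub>H\<^esub> h b \<otimes>\<^bsub>H\<^esub> inv\<^bsub>H\<^esub> (h a) \<otimes>\<^bsub>H\<^esub> inv\<^bsub>H\<^esub> (h b)"
      using subsetD[OF sub ab(1)] by simp
    moreover have "h a \<in> lower_central H n" "h b \<in> carrier H" using Suc ab by auto
    ultimately show "\<exists>a' b'. h (a \<otimes>\<^bsub>G\<^esub> b \<otimes>\<^bsub>G\<^esub> inv\<^bsub>G\<^esub> a \<otimes>\<^bsub>G\<^esub> inv\<^bsub>G\<^esub> b) =
        a' \<otimes>\<^bsub>H\<^esub> b' \<otimes>\<^bsub>H\<^esub> inv\<^bsub>H\<^esub> a' \<otimes>\<^bsub>H\<^esub> inv\<^bsub>H\<^esub> b' \<and> a' \<in> lower_central H n \<and> b' \<in> carrier H" by blast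
  qed
  then have "generate H (h ` ?C) \<subseteq> generate H ?D" by (rule H.mono_generate)
  then show ?case using generate_img[OF C] by simp
qed auto

lemma mon_finite_carrier:
  "h \<in> mon G H \<Longrightarrow> finite (carrier H) \<Longrightarrow> finite (carrier G)"
  by (auto simp: mon_def hom_def intro: inj_on_finite)

lemma fin_group_mon:
  "group G \<Longrightarrow> h \<in> mon G H \<Longrightarrow> fin_group H \<Longrightarrow> fin_group G"
  by (auto simp: fin_group_def mon_finite_carrier)

lemma fin_nilpotent_mon:
  assumes G: "group G" and h: "h \<in> mon G H" and H: "fin_nilpotent H"
  shows "fin_nilpotent G"
proof -
  interpret group_hom G H h
    using G H h by (simp add: group_hom_def group_hom_axioms_def fin_nilpotent_def mon_def)
  obtain n where n: "lower_central H n = {\<one>\<^bsub>H\<^esub>}" using H by (auto simp: fin_nilpotent_def)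
  have "lower_central G n \<subseteq> {\<one>\<^bsub>G\<^esub>}"
  proof
    fix a assume a: "a \<in> lower_central G n"
    then have "h a = h \<one>\<^bsub>G\<^esub>" using lower_central_image[of n] n by auto
    then show "a \<in> {\<one>\<^bsub>G\<^esub>}"
      using h a G.lower_central_subset[of n] inj_onD[of h "carrier G" a "\<one>\<^bsub>G\<^esub>"] by (auto simp: mon_def)
  qed
  then show ?thesis
    using G.one_in_lower_central[of n] H G mon_finite_carrier[OF h] by (auto simp: fin_nilpotent_def)
qed

lemma fin_solvable_mon:
  assumes G: "group G" and h: "h \<in> mon G H" and H: "fin_solvable H"
  shows "fin_solvable G"
proof -
  interpret group_hom G H h
    using G H h by (simp add: group_hom_def group_hom_axioms_def fin_solvable_def mon_def)
  obtain n where n: "(derived H ^^ n) (carrier H) = {\<one>\<^bsub>H\<^esub>}"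
    using H H.solvable_iff_trivial_derived_seq by (auto simp: fin_solvable_def)
  have sub: "(derived G ^^ n) (carrier G) \<subseteq> carrier G" by (rule G.exp_of_derived_in_carrier) simp
  have "h ` (derived G ^^ n) (carrier G) = (derived H ^^ n) (h ` carrier G)"
    by (rule exp_of_derived_img[symmetric]) simp
  also have "\<dots> \<subseteq> {\<one>\<^bsub>H\<^esub>}"
    unfolding n[symmetric] by (rule H.mono_exp_of_derived) auto
  finally have im: "h ` (derived G ^^ n) (carrier G) \<subseteq> {\<one>\<^bsub>H\<^esub>}" .
  have "(derived G ^^ n) (carrier G) \<subseteq> {\<one>\<^bsub>G\<^esub>}"
  proof
    fix a assume a: "a \<in> (derived G ^^ n) (carrier G)"
    then have "h a = h \<one>\<^bsub>G\<^esub>" using im by auto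
    then show "a \<in> {\<one>\<^bsub>G\<^esub>}"
      using h a sub inj_onD[of h "carrier G" a "\<one>\<^bsub>G\<^esub>"] by (auto simp: mon_def)
  qed
  moreover have "\<one>\<^bsub>G\<^esub> \<in> (derived G ^^ n) (carrier G)"
    using subgroup.one_closed[OF G.exp_of_derived_is_subgroup[OF G.subgroup_self]] .
  ultimately have "solvable G" using G.solvable_iff_trivial_derived_seq by blast
  then show ?thesis using G H mon_finite_carrier[OF h] by (auto simp: fin_solvable_def)
qed

lemma hom_fst_DirProd: "fst \<in> hom (G \<times>\<times> H) G" and hom_snd_DirProd: "snd \<in> hom (G \<times>\<times> H) H"
  by (auto simp: hom_def DirProd_def)

lemma fin_group_DirProd: "fin_group G \<Longrightarrow> fin_group H \<Longrightarrow> fin_group (G \<times>\<times> H)"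
  by (auto simp: fin_group_def DirProd_group)

lemma fin_nilpotent_DirProd:
  assumes G: "fin_nilpotent G" and H: "fin_nilpotent H"
  shows "fin_nilpotent (G \<times>\<times> H)"
proof -
  have GH: "group G" "group H" using G H by (auto simp: fin_nilpotent_def)
  interpret G: group G by fact
  interpret H: group H by fact
  interpret P: group "G \<times>\<times> H" by (rule DirProd_group[OF GH])
  interpret f: group_hom "G \<times>\<times> H" G fst by unfold_locales (rule hom_fst_DirProd)
  interpret s: group_hom "G \<times>\<times> H" H snd by unfold_locales (rule hom_snd_DirProd)
  obtain m n where mn: "lower_central G m = {\<one>\<^bsub>G\<^esub>}" "lower_central H n = {\<one>\<^bsub>H\<^esub>}"
    using G H by (auto simp: fin_nilpotent_def)
  let ?k = "max m n"
  have "lower_central G ?k \<subseteq> {\<one>\<^bsub>G\<^esub>}" "lower_central H ?k \<subseteq> {\<one>\<^bsub>H\<^esub>}"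
    using G.lower_central_antimono[of m ?k] H.lower_central_antimono[of n ?k] mn by auto
  then have "lower_central (G \<times>\<times> H) ?k \<subseteq> {\<one>\<^bsub>G \<times>\<times> H\<^esub>}"
    using f.lower_central_image[of ?k] s.lower_central_image[of ?k] by fastforce
  then have "lower_central (G \<times>\<times> H) ?k = {\<one>\<^bsub>G \<times>\<times> H\<^esub>}" using P.one_in_lower_central[of ?k] by blast
  then show ?thesis
    using G H P.group_axioms unfolding fin_nilpotent_def by auto
qed

lemma (in group) exp_of_derived_antimono:
  assumes "m \<le> n" shows "(derived G ^^ n) (carrier G) \<subseteq> (derived G ^^ m) (carrier G)"
proof -
  have "(derived G ^^ Suc k) (carrier G) \<subseteq> (derived G ^^ k) (carrier G)" for k
    using mono_exp_of_derived[OF derived_in_carrier[OF subset_refl], of k] by (simp add: funpow_Suc_right del: funpow.simps)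
  then show ?thesis using assms by (rule lift_Suc_antimono_le[of "\<lambda>k. (derived G ^^ k) (carrier G)"])
qed

lemma fin_solvable_DirProd:
  assumes G: "fin_solvable G" and H: "fin_solvable H"
  shows "fin_solvable (G \<times>\<times> H)"
proof -
  have GH: "group G" "group H" using G H by (auto simp: fin_solvable_def)
  interpret G: group G by fact
  interpret H: group H by fact
  interpret P: group "G \<times>\<times> H" by (rule DirProd_group[OF GH])
  interpret f: group_hom "G \<times>\<times> H" G fst by unfold_locales (rule hom_fst_DirProd)
  interpret s: group_hom "G \<times>\<times> H" H snd by unfold_locales (rule hom_snd_DirProd)
  obtain m n where mn: "(derived G ^^ m) (carrier G) = {\<one>\<^bsub>G\<^esub>}" "(derived H ^^ n) (carrier H) = {\<one>\<^bsub>H\<^esub>}"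
    using G H G.solvable_iff_trivial_derived_seq H.solvable_iff_trivial_derived_seq
    by (auto simp: fin_solvable_def)
  let ?k = "max m n" and ?P = "G \<times>\<times> H"
  have im: "fst ` carrier ?P = carrier G" "snd ` carrier ?P = carrier H"
    using G.one_closed H.one_closed by (auto simp: image_iff)
  have 1: "fst ` (derived ?P ^^ ?k) (carrier ?P) \<subseteq> {\<one>\<^bsub>G\<^esub>}"
    using f.exp_of_derived_img[of "carrier ?P" ?k] im G.exp_of_derived_antimono[of m ?k] mn by simp
  have 2: "snd ` (derived ?P ^^ ?k) (carrier ?P) \<subseteq> {\<one>\<^bsub>H\<^esub>}"
    using s.exp_of_derived_img[of "carrier ?P" ?k] im H.exp_of_derived_antimono[of n ?k] mn by simp
  have "(derived ?P ^^ ?k) (carrier ?P) \<subseteq> {\<one>\<^bsub>?P\<^esub>}" using 1 2 by fastforce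
  moreover have "\<one>\<^bsub>?P\<^esub> \<in> (derived ?P ^^ ?k) (carrier ?P)"
    by (rule subgroup.one_closed[OF P.exp_of_derived_is_subgroup[OF P.subgroup_self]])
  ultimately have "solvable ?P" using P.solvable_iff_trivial_derived_seq by blast
  then show ?thesis
    using G H P.group_axioms unfolding fin_solvable_def by auto
qed

lemma (in group) fin_nilpotent_imp_fin_solvable:
  assumes "fin_nilpotent G" shows "fin_solvable G"
proof -
  obtain n where n: "lower_central G n = {\<one>}" using assms by (auto simp: fin_nilpotent_def)
  have "(derived G ^^ k) (carrier G) \<subseteq> lower_central G k" for k
  proof (induction k)
    case (Suc k)
    have "derived_set G ((derived G ^^ k) (carrier G)) \<subseteq>
        {a \<otimes> b \<otimes> inv a \<otimes> inv b | a b. a \<in> lower_central G k \<and> b \<in> carrier G}"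
      using Suc lower_central_subset[of k] by fastforce
    from mono_generate[OF this] show ?case
      by (simp add: derived_def[of G "(derived G ^^ k) (carrier G)"])
  qed simp
  moreover have "\<one> \<in> (derived G ^^ n) (carrier G)"
    by (rule subgroup.one_closed[OF exp_of_derived_is_subgroup[OF subgroup_self]])
  ultimately have "(derived G ^^ n) (carrier G) = {\<one>}" using n by blast
  then show ?thesis
    using assms solvable_iff_trivial_derived_seq by (auto simp: fin_nilpotent_def fin_solvable_def)
qed

section \<open>Quotients by kernels and by intersections\<close>

lemma kernel_quotient_mon:
  assumes "group G" "group H" "h \<in> hom G H"
  shows "group (G Mod kernel G H h)" and "\<exists>\<theta>. \<theta> \<in> mon (G Mod kernel G H h) H"
proof -
  interpret group_hom G H h using assms by (simp add: group_hom_def group_hom_axioms_def)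
  show "group (G Mod kernel G H h)" by (rule normal.factorgroup_is_group[OF normal_kernel])
  show "\<exists>\<theta>. \<theta> \<in> mon (G Mod kernel G H h) H"
    using FactGroup_hom FactGroup_inj_on by (auto simp: mon_def)
qed

text \<open>This makes the index set of a pro-completion directed: a class closed under subgroups
  and products contains the quotient by an intersection.\<close>

lemma (in group) Int_quotient_mon:
  assumes N: "N \<lhd> G" and M: "M \<lhd> G"
  shows "\<exists>\<theta>. \<theta> \<in> mon (G Mod (N \<inter> M)) ((G Mod N) \<times>\<times> (G Mod M))"
proof -
  interpret N: normal N G by fact
  interpret M: normal M G by fact
  let ?P = "(G Mod N) \<times>\<times> (G Mod M)" and ?h = "\<lambda>a. (N #> a, M #> a)"
  have h: "?h \<in> hom G ?P"
    using hom_mult[OF N.r_coset_hom_Mod] hom_mult[OF M.r_coset_hom_Mod]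
    by (auto simp: hom_def DirProd_def carrier_FactGroup N.rcos_sum M.rcos_sum)
  have "kernel G ?P ?h = N \<inter> M"
    using N.r_coset_eq_self_iff M.r_coset_eq_self_iff N.subset by (auto simp: kernel_def)
  then show ?thesis
    using kernel_quotient_mon(2)[OF group_axioms DirProd_group[OF N.factorgroup_is_group M.factorgroup_is_group] h]
    by simp
qed

lemma exists_nat_copy_mon:
  assumes "group G" "finite (carrier G)"
  shows "\<exists>(H :: nat monoid) \<theta> \<eta>. group H \<and> \<theta> \<in> iso G H \<and> \<eta> \<in> mon H G"
proof -
  obtain H :: "nat monoid" and \<theta> where H: "group H" "\<theta> \<in> iso G H"
    using exists_iso_copy[OF assms(1) countable_finite[OF assms(2)] infinite_UNIV_nat] by blast
  then show ?thesis
    using group.iso_set_sym[OF assms(1) H(2)] by (auto simp: iso_iff_mon_epi)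
qed

section \<open>Residual properties of the free group in the five classes\<close>

lemma free_group_residually_fin_nilpotent:
  assumes F: "free_group_on F {x, y}" and a: "a \<in> carrier F" "a \<noteq> \<one>\<^bsub>F\<^esub>"
  shows "\<exists>H :: nat monoid. fin_nilpotent H \<and> (\<exists>\<psi>\<in>hom F H. \<psi> a \<noteq> \<one>\<^bsub>H\<^esub>)"
proof -
  obtain N q \<psi> where U: "fin_nilpotent (unitriangular N q)" and psi: "\<psi> \<in> hom F (unitriangular N q)"
    "\<psi> a \<noteq> \<one>\<^bsub>unitriangular N q\<^esub>"
    using free_group_residually_nilpotent[OF F a] by blast
  let ?U = "unitriangular N q"
  have gU: "group ?U" "finite (carrier ?U)" using U by (auto simp: fin_nilpotent_def)
  obtain H :: "nat monoid" and \<theta> \<eta> where H: "group H" "\<theta> \<in> iso ?U H" "\<eta> \<in> mon H ?U"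
    using exists_nat_copy_mon[OF gU] by blast
  interpret \<theta>: group_hom ?U H \<theta>
    using H gU by (simp add: group_hom_def group_hom_axioms_def iso_def)
  have "\<theta> \<circ> \<psi> \<in> hom F H" using Group.hom_compose[OF psi(1) \<theta>.homh] .
  moreover have "\<theta> (\<psi> a) \<noteq> \<one>\<^bsub>H\<^esub>"
    using H(2) psi hom_in_carrier[OF psi(1) a(1)] \<theta>.iso_iff by blast
  ultimately show ?thesis using fin_nilpotent_mon[OF H(1,3) U] by (metis comp_apply)
qed

text \<open>Doubling the regular representation makes every permutation even.\<close>

lemma (in group) finite_group_embeds_alt_group:
  assumes "finite (carrier G)"
  shows "\<exists>m\<ge>1. \<exists>h. h \<in> mon G (alt_group m)"
proof -
  define n where "n = card (carrier G)"
  have "n \<ge> 1" using assms one_closed card_gt_0_iff[of "carrier G"] by (auto simp: n_def Suc_le_eq)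
  obtain e where e: "bij_betw e {1..n} (carrier G)"
    using ex_bij_betw_nat_finite_1[OF assms] unfolding n_def by blast
  define f where "f = inv_into {1..n} e"
  have f: "bij_betw f (carrier G) {1..n}" unfolding f_def by (rule bij_betw_inv_into[OF e])
  have ef: "e (f a) = a" if "a \<in> carrier G" for a
    using that e by (simp add: f_def bij_betw_inv_into_right)
  have fe: "f (e i) = i" if "i \<in> {1..n}" for i
    using that e by (simp add: f_def bij_betw_inv_into_left)
  have e_in: "e i \<in> carrier G" if "i \<in> {1..n}" for i using e that by (auto simp: bij_betw_def)
  have f_in: "f a \<in> {1..n}" if "a \<in> carrier G" for a using f that by (auto simp: bij_betw_def)
  define P where "P g i = (if i \<in> {1..n} then f (g \<otimes> e i) else i)" for g i
  have P_mult: "P g \<circ> P h = P (g \<otimes> h)" if "g \<in> carrier G" "h \<in> carrier G" for g h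
    using that e_in f_in ef by (auto simp: P_def fun_eq_iff m_assoc)
  have P_one: "P \<one> = id" using e_in fe by (auto simp: P_def fun_eq_iff)
  have P_perm: "P g permutes {1..n}" if g: "g \<in> carrier G" for g
  proof (rule bij_imp_permutes)
    have "bij (P g)"
      using g by (intro bij_of_mutual_inverses(1)[of _ "P (inv g)"]) (simp_all add: P_mult P_one)
    moreover have "P g ` {1..n} \<subseteq> {1..n}" using g e_in f_in by (auto simp: P_def)
    ultimately show "bij_betw (P g) {1..n} {1..n}"
      by (metis bij_betw_def bij_is_inj endo_inj_surj finite_atLeastAtMost inj_on_subset subset_UNIV)
    show "P g i = i" if "i \<notin> {1..n}" for i using that by (auto simp: P_def)
  qed
  \<comment> \<open>\<open>s\<close> exchanges the two copies of \<open>{1..n}\<close>, so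
    \<open>Q g\<close> is \<open>P g\<close> acting on the second copy, and \<open>P\<close> and
    \<open>Q\<close> have disjoint supports.\<close>
  define s where "s i = (if i \<in> {1..n} then i + n else if i \<in> {n<..2 * n} then i - n else i)" for i
  have ss: "s \<circ> s = id" using \<open>n \<ge> 1\<close> by (auto simp: s_def fun_eq_iff)
  have s_perm: "s permutes {1..2 * n}"
  proof (rule bij_imp_permutes)
    have "s ` {1..2 * n} \<subseteq> {1..2 * n}" by (auto simp: s_def)
    moreover have "inj_on s {1..2 * n}"
      using bij_of_mutual_inverses(1)[OF ss ss] by (meson bij_is_inj inj_on_subset subset_UNIV)
    ultimately show "bij_betw s {1..2 * n} {1..2 * n}"
      by (simp add: bij_betw_def endo_inj_surj)
    show "s i = i" if "i \<notin> {1..2 * n}" for i using that by (auto simp: s_def)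
  qed
  define Q where "Q g = s \<circ> P g \<circ> s" for g
  define T where "T g = P g \<circ> Q g" for g
  have P_range: "P g i \<in> {1..n}" if "g \<in> carrier G" "i \<in> {1..n}" for g i
    using that e_in f_in by (auto simp: P_def)
  have Q_apply: "Q g i = (if i \<in> {n<..2 * n} then P g (i - n) + n else i)" if g: "g \<in> carrier G" for g i
  proof (cases "i \<in> {n<..2 * n}")
    case True
    then have "i - n \<in> {1..n}" by auto
    then show ?thesis using True P_range[OF g, of "i - n"] by (simp add: Q_def s_def)
  next
    case False
    then show ?thesis by (auto simp: Q_def s_def P_def)
  qed
  have Q_mult: "Q g \<circ> Q h = Q (g \<otimes> h)" if "g \<in> carrier G" "h \<in> carrier G" for g h
  proof -
    have "Q g \<circ> Q h = s \<circ> P g \<circ> (s \<circ> s) \<circ> P h \<circ> s" by (simp add: Q_def comp_assoc)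
    then show ?thesis using P_mult[OF that] by (simp add: ss Q_def comp_assoc)
  qed
  have PQ: "Q g \<circ> P h = P h \<circ> Q g" if gh: "g \<in> carrier G" "h \<in> carrier G" for g h
  proof
    fix i
    consider "i \<in> {1..n}" | "i \<in> {n<..2 * n}" | "i \<notin> {1..n}" "i \<notin> {n<..2 * n}" by blast
    then show "(Q g \<circ> P h) i = (P h \<circ> Q g) i"
    proof cases
      case 1
      then show ?thesis using P_range[OF gh(2) 1] by (simp add: Q_apply[OF gh(1)])
    next
      case 2
      then have "i - n \<in> {1..n}" by auto
      then show ?thesis using 2 P_range[OF gh(1), of "i - n"] by (simp add: Q_apply[OF gh(1)]) (simp add: P_def)
    next
      case 3
      have "P h i = i" by (simp only: P_def 3(1) if_False)
      moreover have "Q g i = i" by (simp only: Q_apply[OF gh(1)] 3(2) if_False)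
      ultimately show ?thesis by simp
    qed
  qed
  have T_mult: "T g \<circ> T h = T (g \<otimes> h)" if "g \<in> carrier G" "h \<in> carrier G" for g h
  proof -
    have "T g \<circ> T h = P g \<circ> (Q g \<circ> P h) \<circ> Q h" by (simp add: T_def comp_assoc)
    also have "\<dots> = (P g \<circ> P h) \<circ> (Q g \<circ> Q h)" by (simp add: PQ[OF that] comp_assoc)
    finally show ?thesis using that by (simp add: P_mult Q_mult T_def)
  qed
  have T_alt: "T g \<in> carrier (alt_group (2 * n))" if g: "g \<in> carrier G" for g
  proof -
    have P_double: "P g permutes {1..2 * n}" by (rule permutes_subset[OF P_perm[OF g]]) auto
    have Q_double: "Q g permutes {1..2 * n}" unfolding Q_def by (intro permutes_compose s_perm P_double)
    have perm: "permutation (P g)" "permutation s" "permutation (Q g)"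
      using P_double Q_double s_perm permutation_permutes by blast+
    \<comment> \<open>Conjugate permutations have equal parity, so the product of \<open>P g\<close>
      and \<open>Q g\<close> is even.\<close>
    have "evenperm (Q g) = evenperm (P g)"
      unfolding Q_def using perm by (simp add: evenperm_comp permutation_compose) blast
    then have "evenperm (T g)" unfolding T_def using perm by (simp add: evenperm_comp)
    moreover have "T g permutes {1..2 * n}" unfolding T_def by (intro permutes_compose P_double Q_double)
    ultimately show ?thesis by (simp add: alt_group_carrier)
  qed
  have "inj_on T (carrier G)"
  proof (rule inj_onI)
    fix g h assume gh: "g \<in> carrier G" "h \<in> carrier G" "T g = T h"
    have "e 1 \<in> carrier G" using \<open>n \<ge> 1\<close> by (intro e_in) simp
    have "f (g \<otimes> e 1) = f (h \<otimes> e 1)"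
      using fun_cong[OF gh(3), of 1] gh(1,2) \<open>n \<ge> 1\<close> by (simp add: T_def Q_apply P_def)
    from arg_cong[OF this, of e] have "g \<otimes> e 1 = h \<otimes> e 1"
      using gh(1,2) \<open>e 1 \<in> carrier G\<close> by (simp only: ef m_closed)
    then show "g = h" using gh(1,2) \<open>e 1 \<in> carrier G\<close> by simp
  qed
  then have "T \<in> mon G (alt_group (2 * n))"
    using T_alt T_mult by (auto simp: mon_def hom_def alt_group_mult)
  then show ?thesis using \<open>n \<ge> 1\<close> by (intro exI[of _ "2 * n"]) auto
qed

lemma alt_group_residual:
  assumes F: "free_group_on F {x, y}" and a: "a \<in> carrier F" "a \<noteq> \<one>\<^bsub>F\<^esub>"
  shows "\<exists>m\<ge>1. \<exists>\<psi>\<in>hom F (alt_group m). \<psi> a \<noteq> id"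
proof -
  obtain H :: "nat monoid" and \<psi> where H: "fin_nilpotent H" and psi: "\<psi> \<in> hom F H" "\<psi> a \<noteq> \<one>\<^bsub>H\<^esub>"
    using free_group_residually_fin_nilpotent[OF F a] by blast
  then obtain m h where m: "m \<ge> 1" and h: "h \<in> mon H (alt_group m)"
    using group.finite_group_embeds_alt_group[of H] by (auto simp: fin_nilpotent_def)
  have hH: "h \<in> hom H (alt_group m)" and "inj_on h (carrier H)" using h by (auto simp: mon_def)
  then have "h (\<psi> a) \<noteq> h \<one>\<^bsub>H\<^esub>"
    using psi hom_in_carrier[OF psi(1) a(1)] H
    by (auto simp: fin_nilpotent_def inj_on_eq_iff group.is_monoid monoid.one_closed)
  moreover have "h \<one>\<^bsub>H\<^esub> = id"
    using hom_one[OF hH] H alt_group_is_group by (simp add: fin_nilpotent_def alt_group_one)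
  ultimately show ?thesis
    using m Group.hom_compose[OF psi(1) hH] by (intro exI[of _ m] conjI bexI[of _ "h \<circ> \<psi>"]) auto
qed

lemma sym_group_residual:
  assumes F: "free_group_on F {x, y}" and a: "a \<in> carrier F" "a \<noteq> \<one>\<^bsub>F\<^esub>"
  shows "\<exists>m\<ge>1. \<exists>\<psi>\<in>hom F (sym_group m). \<psi> a \<noteq> id"
proof -
  obtain m \<psi> where "m \<ge> 1" "\<psi> \<in> hom F (alt_group m)" "\<psi> a \<noteq> id"
    using alt_group_residual[OF F a] by blast
  moreover from this have "\<psi> \<in> hom F (sym_group m)"
    by (auto simp: hom_def alt_group_mult sym_group_mult alt_group_carrier sym_group_carrier Pi_iff)
  ultimately show ?thesis by blast
qed

lemma fin_nilpotent_group: "fin_nilpotent G \<Longrightarrow> group G \<and> finite (carrier G)"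
  and fin_solvable_group: "fin_solvable G \<Longrightarrow> group G \<and> finite (carrier G)"
  and fin_group_group: "fin_group G \<Longrightarrow> group G \<and> finite (carrier G)"
  by (auto simp: fin_nilpotent_def fin_solvable_def fin_group_def)

lemma finite_sym_group: "finite (carrier (sym_group m))"
  using finite_permutations[of "{1..m}"] by (simp add: sym_group_def)

lemma finite_alt_group: "finite (carrier (alt_group m))"
  by (rule finite_subset[OF _ finite_sym_group[of m]]) (auto simp: alt_group_carrier sym_group_carrier)

lemma finite_is_iso: "H \<cong> G \<Longrightarrow> finite (carrier G) \<Longrightarrow> finite (carrier H)"
  by (auto simp: is_iso_def iso_def bij_betw_finite)

section \<open>Instantiating the two kinds of completion\<close>

text \<open>\<open>K\<close>, \<open>K'\<close> and \<open>K''\<close> are one class at three types: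
  on \<open>nat\<close>, on quotients of \<open>F\<close>, and on products of two such quotients.
  The \<open>mon\<close> conditions express closure under subgroups and at the same time transfer
  between the types.\<close>

lemma pro_settingI:
  fixes F :: "('f, 'b) monoid_scheme"
    and K' :: "'f set monoid \<Rightarrow> bool" and K :: "nat monoid \<Rightarrow> bool"
    and K'' :: "('f set \<times> 'f set) monoid \<Rightarrow> bool"
  assumes free: "free_group_on F {x, y}" "x \<noteq> y"
    and K: "\<And>H. K H \<Longrightarrow> group H \<and> finite (carrier H)" and K': "\<And>H. K' H \<Longrightarrow> group H \<and> finite (carrier H)"
    and mon_K: "\<And>G h H. \<lbrakk>group G; h \<in> mon G H; K' H\<rbrakk> \<Longrightarrow> K G"
    and mon_K': "\<And>G h H. \<lbrakk>group G; h \<in> mon G H; K H\<rbrakk> \<Longrightarrow> K' G"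
    and mon_K'': "\<And>G h H. \<lbrakk>group G; h \<in> mon G H; K'' H\<rbrakk> \<Longrightarrow> K' G"
    and prod: "\<And>G H. K' G \<Longrightarrow> K' H \<Longrightarrow> K'' (G \<times>\<times> H)"
    and residual: "\<And>w. \<lbrakk>w \<in> carrier F; w \<noteq> \<one>\<^bsub>F\<^esub>\<rbrakk> \<Longrightarrow> \<exists>H. K H \<and> (\<exists>\<psi>\<in>hom F H. \<psi> w \<noteq> \<one>\<^bsub>H\<^esub>)"
  shows "pro_setting F x y K' K"
proof (rule pro_setting.intro)
  interpret F: group F using free by (simp add: free_group_on_def)
  show "\<exists>H \<theta>. K H \<and> \<theta> \<in> iso (F Mod N) H" if N: "N \<lhd> F" "K' (F Mod N)" for N
  proof -
    obtain H :: "nat monoid" and \<theta> \<eta> where H: "group H" "\<theta> \<in> iso (F Mod N) H" "\<eta> \<in> mon H (F Mod N)"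
      using exists_nat_copy_mon[of "F Mod N"] K'[OF N(2)] by blast
    then show ?thesis using mon_K[OF H(1,3) N(2)] by blast
  qed
  show "K' (F Mod kernel F H \<psi>)" if H: "K H" and psi: "\<psi> \<in> hom F H" for H \<psi>
  proof -
    have gH: "group H" using K[OF H] by blast
    obtain \<theta> where "\<theta> \<in> mon (F Mod kernel F H \<psi>) H"
      using kernel_quotient_mon(2)[OF F.group_axioms gH psi] by blast
    with kernel_quotient_mon(1)[OF F.group_axioms gH psi] show ?thesis
      using H by (rule mon_K')
  qed
  show "K' (F Mod (N \<inter> M))" if NM: "N \<lhd> F" "M \<lhd> F" "K' (F Mod N)" "K' (F Mod M)" for N M
  proof -
    obtain \<theta> where "\<theta> \<in> mon (F Mod (N \<inter> M)) ((F Mod N) \<times>\<times> (F Mod M))"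
      using F.Int_quotient_mon[OF NM(1,2)] by blast
    with normal.factorgroup_is_group[OF F.normal_subgroup_intersect[OF NM(1,2)]] show ?thesis
      using prod[OF NM(3,4)] by (rule mon_K'')
  qed
qed (use free K residual in auto)

lemma product_settingI:
  fixes F :: "('f, 'b) monoid_scheme" and A :: "nat \<Rightarrow> ('c, 'd) monoid_scheme"
  assumes free: "free_group_on F {x, y}" "x \<noteq> y"
    and A: "\<And>m. group (A m)" "\<And>m. finite (carrier (A m))"
    and residual: "\<And>w. \<lbrakk>w \<in> carrier F; w \<noteq> \<one>\<^bsub>F\<^esub>\<rbrakk> \<Longrightarrow> \<exists>m\<ge>1. \<exists>\<psi>\<in>hom F (A m). \<psi> w \<noteq> \<one>\<^bsub>A m\<^esub>"
  shows "product_setting F x y A (\<lambda>H :: nat monoid. group H \<and> (\<exists>m\<ge>1. H \<cong> A m))"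
proof (rule product_setting.intro)
  interpret F: group F using free by (simp add: free_group_on_def)
  show copy: "\<exists>(H :: nat monoid) \<theta>. (group H \<and> (\<exists>m\<ge>1. H \<cong> A m)) \<and> \<theta> \<in> iso (A m) H" if m: "m \<ge> 1" for m
  proof -
    obtain H :: "nat monoid" and \<theta> where H: "group H" "\<theta> \<in> iso (A m) H"
      using exists_nat_copy_mon[OF A] by blast
    have "H \<cong> A m" using group.iso_set_sym[OF A(1) H(2)] by (auto simp: is_iso_def)
    then show ?thesis using H m by (intro exI[of _ H] exI[of _ \<theta>]) auto
  qed
  show "\<exists>H :: nat monoid. (group H \<and> (\<exists>m\<ge>1. H \<cong> A m)) \<and> (\<exists>\<psi>\<in>hom F H. \<psi> w \<noteq> \<one>\<^bsub>H\<^esub>)"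
    if w: "w \<in> carrier F" "w \<noteq> \<one>\<^bsub>F\<^esub>" for w
  proof -
    obtain m \<psi> where m: "m \<ge> 1" and psi: "\<psi> \<in> hom F (A m)" "\<psi> w \<noteq> \<one>\<^bsub>A m\<^esub>"
      using residual[OF w] by blast
    obtain H :: "nat monoid" and \<theta> where H: "group H \<and> (\<exists>m\<ge>1. H \<cong> A m)" and th: "\<theta> \<in> iso (A m) H"
      using copy[OF m] by blast
    interpret \<theta>: group_hom "A m" H \<theta>
      using H th A by (simp add: group_hom_def group_hom_axioms_def iso_def)
    have "\<theta> \<circ> \<psi> \<in> hom F H" using Group.hom_compose[OF psi(1) \<theta>.homh] .
    moreover have "\<theta> (\<psi> w) \<noteq> \<one>\<^bsub>H\<^esub>"
      using th psi hom_in_carrier[OF psi(1) w(1)] \<theta>.iso_iff by blast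
    ultimately show ?thesis using H by (metis comp_apply)
  qed
  show "finite (carrier H)" if "group H \<and> (\<exists>m\<ge>1. H \<cong> A m)" for H :: "nat monoid"
    using that finite_is_iso A(2) by blast
qed (use free A in auto)

lemma product_setting_alt:
  assumes "free_group_on F {x, y}" "x \<noteq> y"
  shows "product_setting F x y alt_group fin_alternating"
  unfolding fin_alternating_def[abs_def]
  using alt_group_residual[OF assms(1)]
  by (intro product_settingI assms alt_group_is_group finite_alt_group) (simp add: alt_group_one)

lemma product_setting_sym:
  assumes "free_group_on F {x, y}" "x \<noteq> y"
  shows "product_setting F x y sym_group fin_symmetric"
  unfolding fin_symmetric_def[abs_def]
  using sym_group_residual[OF assms(1)]
  by (intro product_settingI assms sym_group_is_group finite_sym_group) (simp add: sym_group_one)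

theorem mainTheorem9:
  fixes F :: "('f, 'b) monoid_scheme" and x y :: 'f
  assumes "free_group_on F {x, y}" and "x \<noteq> y"
    and "infinite (UNIV :: 'g set)"
  shows "all_equivalent
           [all_groups_approximable TYPE('g) fin_nilpotent,
            has_CEP (pro_completion fin_nilpotent F) (pro_embedding fin_nilpotent F ` carrier F),
            almost_has_CEP (pro_completion fin_nilpotent F) (pro_embedding fin_nilpotent F ` carrier F),
            SQ_universal TYPE('g) (pro_completion fin_nilpotent F)]
       \<and> all_equivalent
           [all_groups_approximable TYPE('g) fin_solvable,
            has_CEP (pro_completion fin_solvable F) (pro_embedding fin_solvable F ` carrier F),
            almost_has_CEP (pro_completion fin_solvable F) (pro_embedding fin_solvable F ` carrier F),
            SQ_universal TYPE('g) (pro_completion fin_solvable F)]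
       \<and> all_equivalent
           [all_groups_approximable TYPE('g) fin_group,
            has_CEP (pro_completion fin_group F) (pro_embedding fin_group F ` carrier F),
            almost_has_CEP (pro_completion fin_group F) (pro_embedding fin_group F ` carrier F),
            SQ_universal TYPE('g) (pro_completion fin_group F)]
       \<and> all_equivalent
           [all_groups_approximable TYPE('g) fin_alternating,
            has_CEP (hom_product F alt_group) (hom_embedding F alt_group ` carrier F),
            almost_has_CEP (hom_product F alt_group) (hom_embedding F alt_group ` carrier F),
            SQ_universal TYPE('g) (hom_product F alt_group)]
       \<and> all_equivalent
           [all_groups_approximable TYPE('g) fin_symmetric,
            has_CEP (hom_product F sym_group) (hom_embedding F sym_group ` carrier F),
            almost_has_CEP (hom_product F sym_group) (hom_embedding F sym_group ` carrier F),
            SQ_universal TYPE('g) (hom_product F sym_group)]"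
proof -
  note F = assms(1,2)
  note nil_residual = free_group_residually_fin_nilpotent[OF F(1)]
  have sol_residual: "\<exists>H :: nat monoid. fin_solvable H \<and> (\<exists>\<psi>\<in>hom F H. \<psi> w \<noteq> \<one>\<^bsub>H\<^esub>)"
    and fin_residual: "\<exists>H :: nat monoid. fin_group H \<and> (\<exists>\<psi>\<in>hom F H. \<psi> w \<noteq> \<one>\<^bsub>H\<^esub>)"
    if w: "w \<in> carrier F" "w \<noteq> \<one>\<^bsub>F\<^esub>" for w
  proof -
    obtain H :: "nat monoid" where H: "fin_nilpotent H" "\<exists>\<psi>\<in>hom F H. \<psi> w \<noteq> \<one>\<^bsub>H\<^esub>"
      using nil_residual[OF w] by blast
    then show "\<exists>H :: nat monoid. fin_solvable H \<and> (\<exists>\<psi>\<in>hom F H. \<psi> w \<noteq> \<one>\<^bsub>H\<^esub>)"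
      using group.fin_nilpotent_imp_fin_solvable[of H] by (auto simp: fin_nilpotent_def)
    show "\<exists>H :: nat monoid. fin_group H \<and> (\<exists>\<psi>\<in>hom F H. \<psi> w \<noteq> \<one>\<^bsub>H\<^esub>)"
      using H by (auto simp: fin_nilpotent_def fin_group_def)
  qed
  interpret nil: pro_setting F x y fin_nilpotent fin_nilpotent
    by (rule pro_settingI[OF F, where K'' = fin_nilpotent];
        fact fin_nilpotent_group fin_nilpotent_mon fin_nilpotent_DirProd nil_residual)
  interpret sol: pro_setting F x y fin_solvable fin_solvable
    by (rule pro_settingI[OF F, where K'' = fin_solvable];
        fact fin_solvable_group fin_solvable_mon fin_solvable_DirProd sol_residual)
  interpret fin: pro_setting F x y fin_group fin_group
    by (rule pro_settingI[OF F, where K'' = fin_group];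
        fact fin_group_group fin_group_mon fin_group_DirProd fin_residual)
  note eqv = free_completion.all_equivalent_conditions[OF _ assms(3)]
  show ?thesis
    by (intro conjI eqv[OF nil.free_completion] eqv[OF sol.free_completion] eqv[OF fin.free_completion]
        eqv[OF product_setting.free_completion[OF product_setting_alt[OF F]]]
        eqv[OF product_setting.free_completion[OF product_setting_sym[OF F]]])
qed

end
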